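(* Let $D\subset\mathbb R^3$ be the open unit ball centered at the origin, with elastic parameters $(\tilde\lambda,\tilde\mu,\tilde\rho)$, embedded in the homogeneous elastic medium $(\mathbb R^3\setminus\overline D;\lambda,\mu,\rho)$, and let $B_R\supseteq D$ be the ball of radius $R$ centered at the origin. Assume $\tilde\lambda=\lambda/\delta$, $\tilde\mu=\mu/\delta$, $\tilde\rho=\rho/\epsilon$ with constants $0<\delta\ll1$, $0<\epsilon\ll1$, $\tau=\sqrt{\delta/\epsilon}<1$; $\lambda,\mu,\rho=\mathcal O(1)$; and $\omega=o(1)$. Let the incident wave be $\mathbf u^i(\mathbf x)=f_{n,n}\,j_n(k_s|\mathbf x|)\,\mathcal T_n^n(\theta,\varphi)$ with $f_{n,n}\in\mathbb C\setminus\{0\}$, and let $\mathbf u$ in $D$ and $\mathbf u^s$ in $\mathbb R^3\setminus\overline D$ be the corresponding total field and scattered field of the elastic scattering problem described in the context. Let $\gamma_1\in(0,1)$, $\gamma_2\in(1,R)$. If the index $n$ only satisfies $n\ge 1/\delta^2$, then $$\frac{\|\nabla\mathbf u\|_{L^2(\mathcal M_-^{1-\gamma_1}(\partial D))^3}}{\|\mathbf u^i\|_{L^2(D)^3}}\ge\frac{n\delta}{4\sqrt\pi}\gg1,\qquad \frac{\|\nabla\mathbf u^s\|_{L^2(\mathcal M_+^{\gamma_2-1}(\partial D))^3}}{\|\mathbf u^i\|_{L^2(D)^3}}\ge\frac{n}{9\sqrt\pi}\gg1,$$ i.e. surface resonance occurs.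
   Context: Scattering problem. $\omega>0$ is the angular frequency. $\mathcal L_{\lambda,\mu}=\mu\Delta+(\lambda+\mu)\nabla\nabla\cdot$ is the Lamé operator; $\lambda,\mu$ are real with $\mu>0$, $3\lambda+2\mu>0$, likewise $\tilde\mu>0$, $3\tilde\lambda+2\tilde\mu>0$; the densities $\rho,\tilde\rho$ are positive. The incident field $\mathbf u^i$ is an entire solution of $\mathcal L_{\lambda,\mu}\mathbf u^i+\omega^2\rho\mathbf u^i=0$ in $\mathbb R^3$. The total field $\mathbf u$ (with $\mathbf u=\mathbf u^i+\mathbf u^s$ outside $D$) satisfies $\mathcal L_{\tilde\lambda,\tilde\mu}\mathbf u+\omega^2\tilde\rho\mathbf u=0$ in $D$; $\mathcal L_{\lambda,\mu}\mathbf u+\omega^2\rho\mathbf u=0$ in $\mathbb R^3\setminus\overline D$; $\mathbf u|_-=\mathbf u|_+$ and $\partial_{\nu,\tilde\lambda,\tilde\mu}\mathbf u|_-=\partial_{\nu,\lambda,\mu}\mathbf u|_+$ on $\partial D$ ($\pm$ = limits from outside/inside $D$), where $\partial_{\nu,\lambda,\mu}\mathbf u=\lambda(\nabla\cdot\mathbf u)\nu+\mu(\nabla\mathbf u+\nabla\mathbf u^\top)\nu$ and $\nu$ is the outward unit normal; and $\mathbf u^s$ satisfies the radiation condition, as $|\mathbf x|\to\infty$, $(\nabla\times\nabla\times\mathbf u^s)\times\frac{\mathbf x}{|\mathbf x|}-\mathrm i k_s\nabla\times\mathbf u^s=\mathcal O(|\mathbf x|^{-2})$ and $\frac{\mathbf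 x}{|\mathbf x|}\cdot\nabla(\nabla\cdot\mathbf u^s)-\mathrm i k_p\nabla\cdot\mathbf u^s=\mathcal O(|\mathbf x|^{-2})$. Here $k_s=\omega\sqrt{\rho/\mu}$, $k_p=\omega\sqrt{\rho/(\lambda+2\mu)}$. Special functions. $n\ge1$ is an integer; $(\theta,\varphi)$ are the spherical angles of $\mathbf x$; $j_n$ is the spherical Bessel function of order $n$; $Y_n^m(\theta,\varphi)=C_n^mP_n^{|m|}(\cos\theta)e^{\mathrm i m\varphi}$ with $C_n^m=\sqrt{\frac{2n+1}{4\pi}\frac{(n-|m|)!}{(n+|m|)!}}$ and $P_n^{|m|}$ the associated Legendre functions; $\mathcal T_n^m=\nabla_{\mathbb S^2}Y_n^m\wedge\nu$ ($\wedge$ the cross product, $\nu=\mathbf x/|\mathbf x|$, $\nabla_{\mathbb S^2}$ the surface gradient). Boundary layers. $\mathcal M_-^{\xi}(\partial D)=\{\mathbf x\in D:\ d_{\partial D}(\mathbf x)<\xi\}$ and $\mathcal M_+^{\xi}(\partial D)=\{\mathbf x\in B_R\setminus\overline D:\ d_{\partial D}(\mathbf x)<\xi\}$, with $d_{\partial D}$ the Euclidean distance to $\partial D$. The $L^2$ norm of the matrix field $\nabla\mathbf u$ uses the Frobenius norm. Surface resonance means that both ratios of gradient norm in the boundary layer to $\|\mathbf u^i\|_{L^2(D)^3}$ are $\gg1$. Asymptotics. $o(\cdot)$ refers to the regime $\omega\to0$; $a\ll1$ (resp. $a\gg1$) means $a$ is sufficiently small (resp. large). $\delta$ is the Lamé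 (bulk/shear modulus) contrast and $\epsilon$ the density contrast. *)

theory Defs
  imports
    "HOL-Analysis.Analysis"
    "HOL-Computational_Algebra.Polynomial"
    "HOL-Library.Landau_Symbols"
begin

section \<open>Differential operators on fields over three-dimensional space\<close>

definition partial :: "3 \<Rightarrow> (real^3 \<Rightarrow> 'a::real_normed_vector) \<Rightarrow> real^3 \<Rightarrow> 'a" where
  "partial j g x = frechet_derivative g (at x) (axis j 1)"

text \<open>For open \<open>S\<close>: the classes \<open>C\<^sup>1(S)\<close> and \<open>C\<^sup>2(S)\<close>.\<close>

definition C1_on :: "(real^3) set \<Rightarrow> (real^3 \<Rightarrow> 'a::real_normed_vector) \<Rightarrow> bool" where
  "C1_on S g \<longleftrightarrow> (\<forall>x\<in>S. g differentiable (at x)) \<and> (\<forall>j. continuous_on S (partial j g))"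

definition C2_on :: "(real^3) set \<Rightarrow> (real^3 \<Rightarrow> 'a::real_normed_vector) \<Rightarrow> bool" where
  "C2_on S g \<longleftrightarrow> C1_on S g \<and> (\<forall>j. C1_on S (partial j g))"

definition grad :: "(real^3 \<Rightarrow> complex) \<Rightarrow> real^3 \<Rightarrow> complex^3" where
  "grad g x = (\<chi> i. partial i g x)"

text \<open>\<open>(\<nabla>u)\<^sub>i\<^sub>j = \<partial>\<^sub>j u\<^sub>i\<close>. The norm of the type \<^typ>\<open>complex^3^3\<close> is the Frobenius norm.\<close>

definition gradv :: "(real^3 \<Rightarrow> complex^3) \<Rightarrow> real^3 \<Rightarrow> complex^3^3" where
  "gradv u x = (\<chi> i j. partial j u x $ i)"

definition divergence :: "(real^3 \<Rightarrow> complex^3) \<Rightarrow> real^3 \<Rightarrow> complex" where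
  "divergence u x = (\<Sum>i\<in>UNIV. partial i u x $ i)"

definition curl :: "(real^3 \<Rightarrow> complex^3) \<Rightarrow> real^3 \<Rightarrow> complex^3" where
  "curl u x = vector [partial 2 u x $ 3 - partial 3 u x $ 2,
                      partial 3 u x $ 1 - partial 1 u x $ 3,
                      partial 1 u x $ 2 - partial 2 u x $ 1]"

definition laplacian :: "(real^3 \<Rightarrow> complex^3) \<Rightarrow> real^3 \<Rightarrow> complex^3" where
  "laplacian u x = (\<Sum>j\<in>UNIV. partial j (partial j u) x)"

definition lame :: "real \<Rightarrow> real \<Rightarrow> (real^3 \<Rightarrow> complex^3) \<Rightarrow> real^3 \<Rightarrow> complex^3" where
  "lame lam mu u x = mu *\<^sub>R laplacian u x + (lam + mu) *\<^sub>R grad (divergence u) x"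

definition cvec :: "real^3 \<Rightarrow> complex^3" where
  "cvec x = (\<chi> i. complex_of_real (x $ i))"

text \<open>The library cross product \<^const>\<open>cross3\<close> is restricted to real vectors.\<close>

definition ccross :: "complex^3 \<Rightarrow> complex^3 \<Rightarrow> complex^3" where
  "ccross a b = vector [a$2 * b$3 - a$3 * b$2,
                        a$3 * b$1 - a$1 * b$3,
                        a$1 * b$2 - a$2 * b$1]"

text \<open>The conormal derivative \<open>\<lambda> (\<nabla>\<cdot>u) \<nu> + \<mu> (\<nabla>u + \<nabla>u\<^sup>T) \<nu>\<close>, as a function of \<open>A = \<nabla>u\<close>.\<close>

definition traction :: "real \<Rightarrow> real \<Rightarrow> complex^3^3 \<Rightarrow> real^3 \<Rightarrow> complex^3" where
  "traction lam mu A nu =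
     lam *\<^sub>R (trace A *s cvec nu) + mu *\<^sub>R ((A + transpose A) *v cvec nu)"


section \<open>Spherical Bessel functions and vector spherical harmonics\<close>

text \<open>The power series of \<open>j\<^sub>n\<close>; the product is the double factorial \<open>(2n+2k+1)!!\<close>.\<close>

definition sph_bessel_j :: "nat \<Rightarrow> real \<Rightarrow> real" where
  "sph_bessel_j n z =
     (\<Sum>k. (-1)^k * z^(n + 2*k) / (2^k * fact k * (\<Prod>i\<le>n + k. real (2*i + 1))))"

definition legendre_poly :: "nat \<Rightarrow> real poly" where
  "legendre_poly n = smult (1 / (2^n * fact n)) ((pderiv ^^ n) ([:-1, 0, 1:] ^ n))"

text \<open>No Condon-Shortley phase; including it would only multiply the harmonics by a sign.\<close>

definition assoc_legendre :: "nat \<Rightarrow> nat \<Rightarrow> real \<Rightarrow> real" where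
  "assoc_legendre n m t = sqrt (1 - t\<^sup>2) ^ m * poly ((pderiv ^^ m) (legendre_poly n)) t"

definition sph_harm :: "nat \<Rightarrow> int \<Rightarrow> real \<Rightarrow> real \<Rightarrow> complex" where
  "sph_harm n m \<theta> \<phi> =
     complex_of_real
       (sqrt ((2 * real n + 1) / (4 * pi) * (fact (n - nat \<bar>m\<bar>) / fact (n + nat \<bar>m\<bar>)))
        * assoc_legendre n (nat \<bar>m\<bar>) (cos \<theta>))
     * exp (\<i> * of_int m * of_real \<phi>)"

definition polar_angle :: "real^3 \<Rightarrow> real" where
  "polar_angle x = arccos (x $ 3 / norm x)"

text \<open>On the polar axis the value is \<open>0\<close>; this is immaterial, since there the harmonics of
  order \<open>m \<noteq> 0\<close> vanish and those of order \<open>0\<close> do not depend on \<open>\<phi>\<close>.\<close>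

definition azimuth :: "real^3 \<Rightarrow> real" where
  "azimuth x = Arg (Complex (x $ 1) (x $ 2))"

text \<open>The surface gradient on the unit sphere of \<open>g\<close> at the point \<open>p\<close> of the sphere is the
  Euclidean gradient of the extension of \<open>g\<close> that is constant along rays. Unlike the formula in
  the coordinates \<open>(\<theta>, \<phi>)\<close>, it makes sense at the poles too.\<close>

definition surface_grad :: "(real^3 \<Rightarrow> complex) \<Rightarrow> real^3 \<Rightarrow> complex^3" where
  "surface_grad g p = grad (\<lambda>y. g (y /\<^sub>R norm y)) p"

definition vsh_T :: "nat \<Rightarrow> int \<Rightarrow> real^3 \<Rightarrow> complex^3" where
  "vsh_T n m x =
     ccross (surface_grad (\<lambda>y. sph_harm n m (polar_angle y) (azimuth y)) (x /\<^sub>R norm x))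
            (cvec (x /\<^sub>R norm x))"


section \<open>The elastic scattering problem\<close>

definition k_s :: "real \<Rightarrow> real \<Rightarrow> real \<Rightarrow> real" where
  "k_s mu rho \<omega> = \<omega> * sqrt (rho / mu)"

definition k_p :: "real \<Rightarrow> real \<Rightarrow> real \<Rightarrow> real \<Rightarrow> real" where
  "k_p lam mu rho \<omega> = \<omega> * sqrt (rho / (lam + 2 * mu))"

definition lame_solution ::
  "real \<Rightarrow> real \<Rightarrow> real \<Rightarrow> real \<Rightarrow> (real^3) set \<Rightarrow> (real^3 \<Rightarrow> complex^3) \<Rightarrow> bool" where
  "lame_solution lam mu rho \<omega> S u \<longleftrightarrow>
     C2_on S u \<and> (\<forall>x\<in>S. lame lam mu u x + (\<omega>\<^sup>2 * rho) *\<^sub>R u x = 0)"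

definition radiating ::
  "real \<Rightarrow> real \<Rightarrow> real \<Rightarrow> real \<Rightarrow> (real^3 \<Rightarrow> complex^3) \<Rightarrow> bool" where
  "radiating lam mu rho \<omega> us \<longleftrightarrow>
     (\<lambda>x. norm (ccross (curl (curl us) x) (cvec (x /\<^sub>R norm x))
                 - (\<i> * of_real (k_s mu rho \<omega>)) *s curl us x))
       \<in> O[at_infinity](\<lambda>x. 1 / norm x ^ 2) \<and>
     (\<lambda>x. norm ((\<Sum>i\<in>UNIV. cvec (x /\<^sub>R norm x) $ i * grad (divergence us) x $ i)
                 - \<i> * of_real (k_p lam mu rho \<omega>) * divergence us x))
       \<in> O[at_infinity](\<lambda>x. 1 / norm x ^ 2)"

text \<open>The interface conditions for classical solutions: the one-sided limits of \<open>u\<close> and of \<open>\<nabla>u\<close>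
  exist at every boundary point, and displacement and traction are continuous across it.\<close>

definition transmission ::
  "(real^3) set \<Rightarrow> (real^3 \<Rightarrow> real^3) \<Rightarrow> real \<Rightarrow> real \<Rightarrow> real \<Rightarrow> real \<Rightarrow> (real^3 \<Rightarrow> complex^3) \<Rightarrow> bool"
  where
  "transmission D nu lam mu lam' mu' u \<longleftrightarrow>
     (\<forall>x\<in>frontier D.
        (\<exists>v. (u \<longlongrightarrow> v) (at x within D) \<and> (u \<longlongrightarrow> v) (at x within - closure D)) \<and>
        (\<exists>A B. (gradv u \<longlongrightarrow> A) (at x within D) \<and> (gradv u \<longlongrightarrow> B) (at x within - closure D) \<and>
               traction lam' mu' A (nu x) = traction lam mu B (nu x)))"

text \<open>\<open>elastic_scattering D \<nu> \<lambda> \<mu> \<rho> \<lambda>' \<mu>' \<rho>' \<omega> ui u us\<close>: for the inclusion \<open>D\<close> with outward unit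
  normal \<open>\<nu>\<close>, parameters \<open>\<lambda>', \<mu>', \<rho>'\<close> inside and \<open>\<lambda>, \<mu>, \<rho>\<close> outside, \<open>u\<close> is a total field and \<open>us\<close>
  the scattered field for the incident field \<open>ui\<close>. The values of \<open>us\<close> on the closure of \<open>D\<close> and of
  \<open>u\<close> on the boundary play no role.\<close>

definition elastic_scattering ::
  "(real^3) set \<Rightarrow> (real^3 \<Rightarrow> real^3) \<Rightarrow> real \<Rightarrow> real \<Rightarrow> real \<Rightarrow> real \<Rightarrow> real \<Rightarrow> real \<Rightarrow> real
   \<Rightarrow> (real^3 \<Rightarrow> complex^3) \<Rightarrow> (real^3 \<Rightarrow> complex^3) \<Rightarrow> (real^3 \<Rightarrow> complex^3) \<Rightarrow> bool" where
  "elastic_scattering D nu lam mu rho lam' mu' rho' \<omega> ui u us \<longleftrightarrow>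
     lame_solution lam mu rho \<omega> UNIV ui \<and>
     lame_solution lam' mu' rho' \<omega> D u \<and>
     lame_solution lam mu rho \<omega> (- closure D) u \<and>
     (\<forall>x\<in>- closure D. u x = ui x + us x) \<and>
     transmission D nu lam mu lam' mu' u \<and>
     radiating lam mu rho \<omega> us"


section \<open>Boundary layers and surface resonance\<close>

definition layer_in :: "(real^3) set \<Rightarrow> real \<Rightarrow> (real^3) set" where
  "layer_in D \<xi> = {x \<in> D. infdist x (frontier D) < \<xi>}"

definition layer_out :: "(real^3) set \<Rightarrow> real \<Rightarrow> real \<Rightarrow> (real^3) set" where
  "layer_out D R \<xi> = {x \<in> ball 0 R - closure D. infdist x (frontier D) < \<xi>}"

definition L2_norm_on :: "(real^3) set \<Rightarrow> (real^3 \<Rightarrow> 'a::real_normed_vector) \<Rightarrow> real" where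
  "L2_norm_on S g = sqrt (LINT x:S|lborel. (norm (g x))\<^sup>2)"

definition ratio_in ::
  "(real^3) set \<Rightarrow> real \<Rightarrow> (real^3 \<Rightarrow> complex^3) \<Rightarrow> (real^3 \<Rightarrow> complex^3) \<Rightarrow> real" where
  "ratio_in D \<xi> ui u = L2_norm_on (layer_in D \<xi>) (gradv u) / L2_norm_on D ui"

definition ratio_out ::
  "(real^3) set \<Rightarrow> real \<Rightarrow> real \<Rightarrow> (real^3 \<Rightarrow> complex^3) \<Rightarrow> (real^3 \<Rightarrow> complex^3) \<Rightarrow> real" where
  "ratio_out D R \<xi> ui us = L2_norm_on (layer_out D R \<xi>) (gradv us) / L2_norm_on D ui"

text \<open>Surface resonance with \<open>\<gg> 1\<close> quantified as ``at least \<open>K\<close>''.\<close>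

definition surface_resonance ::
  "real \<Rightarrow> (real^3) set \<Rightarrow> real \<Rightarrow> real \<Rightarrow> real
   \<Rightarrow> (real^3 \<Rightarrow> complex^3) \<Rightarrow> (real^3 \<Rightarrow> complex^3) \<Rightarrow> (real^3 \<Rightarrow> complex^3) \<Rightarrow> bool" where
  "surface_resonance K D R \<xi>1 \<xi>2 ui u us \<longleftrightarrow> K \<le> ratio_in D \<xi>1 ui u \<and> K \<le> ratio_out D R \<xi>2 ui us"

end

theory Submission
  imports Defs
begin

text \<open>
The incident field is a multiple of \<open>j\<^sub>n(k\<^sub>sr) T\<^sub>n\<^sup>n\<close>. Nothing is known about the total field except the
equations, so it is projected: let \<open>b(r)\<close> be the integral of \<open>u(r\<omega>)\<close> against the conjugate of \<open>T\<^sub>n\<^sup>n(\<omega>)\<close>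
over the unit sphere. As \<open>T\<^sub>n\<^sup>n\<close> is tangential and solenoidal, the gradient part of the Lame operator
drops out, \<open>b\<close> solves the spherical Bessel equation, and the traction projects to
\<open>\<mu> (b' - b)\<close> at \<open>r = 1\<close>.

For small \<open>k\<close>, a solution that is bounded at the origin satisfies \<open>b(r) \<approx> r\<^sup>n b(1)\<close>, uniformly in \<open>n\<close>. Outside,
the radiation condition forces the Wronskian of \<open>b\<close> with the outgoing Hankel solution to vanish, so
\<open>b(r) \<approx> r\<^sup>-\<^sup>n\<^sup>-\<^sup>1 b(1)\<close>. If \<open>y\<close>, \<open>m\<close> and \<open>d = m - y\<close> are the values at \<open>r = 1\<close> for the incident, total and
scattered field, the traction condition becomes
\<open>(n - 1) m \<approx> \<delta> ((n - 1) y - (n + 2) d)\<close>, whence \<open>\<bar>m\<bar> \<ge> \<delta> \<bar>y\<bar>\<close> and \<open>\<bar>d\<bar> \<approx> \<bar>y\<bar>\<close>.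
By Cauchy-Schwarz on spheres, \<open>b'\<close> bounds the gradient norm from below, and the factors \<open>n\<close> come from
\<open>\<integral> \<bar>b'\<bar>\<^sup>2 \<approx> n \<bar>b(1)\<bar>\<^sup>2 / 2\<close> against \<open>\<integral> \<bar>b\<bar>\<^sup>2 \<approx> \<bar>b(1)\<bar>\<^sup>2 / (2n)\<close>.
\<close>

section \<open>Averages over directions\<close>

text \<open>Neither uniqueness nor a series expansion of \<open>u\<close> is at hand, and its
  boundary values exist only as pointwise limits. One projection suffices because the claims are
  lower bounds on gradients, which a single mode already bounds, while the incident field consists
  of that mode alone and its norm is read off from its projection. The obstacle is uniformity:
  \<open>n\<close> is unbounded and the threshold for \<omega> must not depend on it. Hence every
  error is measured relative to the boundary value of its own mode, with constants free of
  \<open>n\<close>. The test field \<open>vb n\<close> is a homogeneous harmonic polynomial of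
  degree \<open>n\<close> rather than a function on the sphere. Thus
  \<open>M = smean (proj n u)\<close> and \<open>K = smean (radproj n u)\<close> stand for r^n b and
  r^(n+1) b' of the overview, and the Bessel equation becomes the system M' = (K + n M)/r, (r (K - n
  M))' = - k^2 r^2 M. For k = 0 the inner solution has K = n M and the decaying outer one K = - (n +
  1) M; the proof bounds the defects from these two relations. The factor 7/3 and the mass of
  \<open>vb\<close> cancel in both ratios.\<close>

definition ann :: "(real^3) set" where
  "ann = {x. 1 \<le> norm x \<and> norm x \<le> 2}"

text \<open>The library has no surface measure. Averaging over the directions \<open>sgn x\<close> of the points of an
  annulus gives the integral over the unit sphere up to the factor \<open>7/3\<close>.\<close>

definition smean :: "(real^3 \<Rightarrow> 'a::{banach,second_countable_topology}) \<Rightarrow> real \<Rightarrow> 'a" where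
  "smean F r = (LINT x:ann|lborel. F (r *\<^sub>R sgn x))"

definition shell :: "real set \<Rightarrow> (real^3) set" where
  "shell I = {x. norm x \<in> I}"

lemma mem_shell [simp]: "x \<in> shell I \<longleftrightarrow> norm x \<in> I"
  by (simp add: shell_def)

lemma open_shell: "open I \<Longrightarrow> open (shell I)"
  using open_vimage[of I norm] by (simp add: continuous_on_norm_id vimage_def shell_def)

lemma compact_ann: "compact ann"
proof -
  have "ann = cball 0 2 \<inter> - ball 0 1" by (auto simp: ann_def)
  then show ?thesis by (metis compact_Int_closed compact_cball closed_Compl open_ball)
qed

lemma ann_nz: "x \<in> ann \<Longrightarrow> x \<noteq> 0"
  by (auto simp: ann_def)

lemma norm_sgn_ann: "x \<in> ann \<Longrightarrow> norm (sgn x) = 1"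
  by (auto simp: ann_def norm_sgn)

lemma continuous_on_sgn_ann: "continuous_on ann sgn"
  by (intro continuous_on_sgn continuous_on_id) (auto dest: ann_nz)

lemma continuous_on_smean_integrand:
  assumes "continuous_on (shell I) F" "r \<in> I" "r > 0"
  shows "continuous_on ann (\<lambda>x. F (r *\<^sub>R sgn x))"
  by (rule continuous_on_compose2[OF assms(1)])
     (use assms in \<open>auto intro!: continuous_intros continuous_on_sgn_ann simp: norm_sgn_ann\<close>)

lemma integrable_ann:
  fixes g :: "real^3 \<Rightarrow> 'a::{banach,second_countable_topology}"
  shows "continuous_on ann g \<Longrightarrow> set_integrable lborel ann g"
  unfolding set_integrable_def by (rule borel_integrable_compact[OF compact_ann])

lemma smean_integrable:
  fixes F :: "real^3 \<Rightarrow> 'a::{banach,second_countable_topology}"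
  assumes "continuous_on (shell I) F" "r \<in> I" "r > 0"
  shows "set_integrable lborel ann (\<lambda>x. F (r *\<^sub>R sgn x))"
  by (rule integrable_ann[OF continuous_on_smean_integrand[OF assms]])

lemma smean_cong:
  assumes "\<And>x. norm x = r \<Longrightarrow> F x = G x" "r > 0"
  shows "smean F r = smean G r"
  unfolding smean_def
  by (rule set_lebesgue_integral_cong) (use assms in \<open>auto simp: norm_sgn_ann compact_ann compact_imp_closed\<close>)

lemma smean_add:
  fixes F G :: "real^3 \<Rightarrow> 'a::{banach,second_countable_topology}"
  assumes "continuous_on (shell I) F" "continuous_on (shell I) G" "r \<in> I" "r > 0"
  shows "smean (\<lambda>x. F x + G x) r = smean F r + smean G r"
  unfolding smean_def
  by (rule set_integral_add) (use assms in \<open>auto intro: smean_integrable\<close>)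

lemma smean_diff:
  fixes F G :: "real^3 \<Rightarrow> 'a::{banach,second_countable_topology}"
  assumes "continuous_on (shell I) F" "continuous_on (shell I) G" "r \<in> I" "r > 0"
  shows "smean (\<lambda>x. F x - G x) r = smean F r - smean G r"
  unfolding smean_def
  by (rule set_integral_diff) (use assms in \<open>auto intro: smean_integrable\<close>)

lemma smean_cmult:
  fixes F :: "real^3 \<Rightarrow> 'a::{real_normed_field,banach,second_countable_topology}"
  shows "smean (\<lambda>x. c * F x) r = c * smean F r"
  unfolding smean_def by simp

lemma smean_scaleR:
  fixes F :: "real^3 \<Rightarrow> 'a::{banach,second_countable_topology}"
  shows "smean (\<lambda>x. c *\<^sub>R F x) r = c *\<^sub>R smean F r"
  unfolding smean_def by simp

lemma smean_zero [simp]: "smean (\<lambda>x. 0) r = 0"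
  unfolding smean_def set_lebesgue_integral_def by simp

lemma smean_sum:
  fixes F :: "'i \<Rightarrow> real^3 \<Rightarrow> 'a::{banach,second_countable_topology}"
  assumes "finite A" "\<And>i. i \<in> A \<Longrightarrow> continuous_on (shell I) (F i)" "r \<in> I" "r > 0"
  shows "smean (\<lambda>x. \<Sum>i\<in>A. F i x) r = (\<Sum>i\<in>A. smean (F i) r)"
  using assms(1,2)
proof (induction A rule: finite_induct)
  case empty
  then show ?case by simp
next
  case (insert i A)
  have "smean (\<lambda>x. F i x + (\<Sum>i\<in>A. F i x)) r = smean (F i) r + smean (\<lambda>x. (\<Sum>i\<in>A. F i x)) r"
    by (rule smean_add[where I=I]) (use insert assms(3,4) in \<open>auto intro!: continuous_on_sum\<close>)
  with insert show ?case by simp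
qed

lemma set_integral_const_compact:
  fixes K :: "'b::euclidean_space set" and c :: real
  assumes "compact K"
  shows "(LINT x:K|lborel. c) = c * measure lborel K"
proof -
  have "emeasure lborel K < top" using emeasure_compact_finite[OF assms] by (simp add: less_top)
  moreover have "K \<in> sets lborel" using assms by (simp add: compact_imp_closed)
  ultimately show ?thesis
    unfolding set_lebesgue_integral_def by simp
qed

definition ann_vol :: real where "ann_vol = measure lborel ann"

lemma ann_vol_nonneg: "ann_vol \<ge> 0" by (simp add: ann_vol_def)

text \<open>A non-integrable integrand has Bochner integral 0 by convention, so the bound persists
  as soon as \<open>B\<close> is nonnegative; that sign is read off from one point of the
  sphere.\<close>

lemma smean_norm_le:
  fixes F :: "real^3 \<Rightarrow> 'a::{banach,second_countable_topology}"
  assumes "\<And>x. norm x = r \<Longrightarrow> norm (F x) \<le> B" "r > 0"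
  shows "norm (smean F r) \<le> B * ann_vol"
proof -
  have "norm (F (r *\<^sub>R axis 1 1)) \<le> B"
    by (rule assms(1)) (use assms(2) in \<open>simp add: norm_axis_1\<close>)
  then have B: "0 \<le> B" using norm_ge_zero order_trans by blast
  show ?thesis
  proof (cases "set_integrable lborel ann (\<lambda>x. F (r *\<^sub>R sgn x))")
    case True
    have "norm (smean F r) \<le> (LINT x:ann|lborel. norm (F (r *\<^sub>R sgn x)))"
      unfolding smean_def by (rule set_integral_norm_bound[OF True])
    also have "\<dots> \<le> (LINT x:ann|lborel. B)"
      by (rule set_integral_mono)
         (use assms True in \<open>auto simp: norm_sgn_ann set_integrable_norm intro!: integrable_ann\<close>)
    also have "\<dots> = B * ann_vol"
      by (simp add: ann_vol_def compact_ann set_integral_const_compact)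
    finally show ?thesis .
  next
    case False
    then have "smean F r = 0"
      unfolding smean_def set_lebesgue_integral_def set_integrable_def
      by (simp add: not_integrable_integral_eq)
    then show ?thesis using B ann_vol_nonneg by simp
  qed
qed

section \<open>Differentiation under the integral sign\<close>

lemma compact_prod_uniform:
  fixes G :: "real \<Rightarrow> 'b::euclidean_space \<Rightarrow> complex"
  assumes K: "compact K" and I: "open I" "t0 \<in> I"
    and cont: "continuous_on (I \<times> K) (\<lambda>(t,x). G t x)" and e: "e > 0"
  obtains d where "d > 0" "ball t0 d \<subseteq> I"
    "\<And>t x. \<bar>t - t0\<bar> < d \<Longrightarrow> x \<in> K \<Longrightarrow> norm (G t x - G t0 x) < e"
proof -
  obtain a where a: "a > 0" "cball t0 a \<subseteq> I"
    using I open_contains_cball by metis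
  have "compact (cball t0 a \<times> K)" by (intro compact_Times K) auto
  moreover have "continuous_on (cball t0 a \<times> K) (\<lambda>(t,x). G t x)"
    by (rule continuous_on_subset[OF cont]) (use a in auto)
  ultimately have "uniformly_continuous_on (cball t0 a \<times> K) (\<lambda>(t,x). G t x)"
    by (rule compact_uniformly_continuous[rotated])
  then obtain d where d: "d > 0" "\<And>p q. p \<in> cball t0 a \<times> K \<Longrightarrow> q \<in> cball t0 a \<times> K \<Longrightarrow> dist q p < d
      \<Longrightarrow> dist ((\<lambda>(t,x). G t x) q) ((\<lambda>(t,x). G t x) p) < e"
    using e unfolding uniformly_continuous_on_def by metis
  show ?thesis
  proof (rule that[of "min a d"])
    show "min a d > 0" using a d by auto
    show "ball t0 (min a d) \<subseteq> I" using a(2) by (meson ball_subset_cball min.cobounded1 order_trans subset_ball)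
    fix t x assume t: "\<bar>t - t0\<bar> < min a d" and x: "x \<in> K"
    have "dist (G t x) (G t0 x) < e"
      using d(2)[of "(t0,x)" "(t,x)"] a t x by (auto simp: dist_Pair_Pair dist_real_def abs_minus_commute)
    then show "norm (G t x - G t0 x) < e" by (simp add: dist_norm)
  qed
qed

text \<open>The remainder is estimated pointwise by the mean value inequality: near
  \<open>t0\<close> the derivative \<open>G'\<close> varies by less than \<eta>, uniformly in
  \<open>x\<close> because \<open>K\<close> is compact, and integration multiplies this by the
  volume of \<open>K\<close>.\<close>

lemma has_vector_derivative_lint:
  fixes G G' :: "real \<Rightarrow> 'b::euclidean_space \<Rightarrow> complex"
  assumes K: "compact K" and I: "open I" "t0 \<in> I"
    and der: "\<And>t x. t \<in> I \<Longrightarrow> x \<in> K \<Longrightarrow> ((\<lambda>t. G t x) has_vector_derivative G' t x) (at t)"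
    and cont': "continuous_on (I \<times> K) (\<lambda>(t,x). G' t x)"
    and cont: "\<And>t. t \<in> I \<Longrightarrow> continuous_on K (G t)"
  shows "((\<lambda>t. LINT x:K|lborel. G t x) has_vector_derivative (LINT x:K|lborel. G' t0 x)) (at t0)"
  unfolding has_vector_derivative_def has_derivative_at_alt
proof (intro conjI allI impI)
  show "bounded_linear (\<lambda>x. x *\<^sub>R (LINT x:K|lborel. G' t0 x))"
    by (rule bounded_linear_scaleR_left)
  fix e :: real assume e: "e > 0"
  let ?V = "measure lborel K"
  \<comment> \<open>The added 1 keeps the quotient meaningful when \<open>K\<close> is a null
    set.\<close>
  define \<eta> where "\<eta> = e / (?V + 1)"
  have V: "?V \<ge> 0" by simp
  have \<eta>: "\<eta> > 0" using e V unfolding \<eta>_def by (intro divide_pos_pos) linarith+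
  obtain d where d: "d > 0" "ball t0 d \<subseteq> I"
    "\<And>t x. \<bar>t - t0\<bar> < d \<Longrightarrow> x \<in> K \<Longrightarrow> norm (G' t x - G' t0 x) < \<eta>"
    using compact_prod_uniform[OF K I cont' \<eta>] by blast
  have "continuous_on K (\<lambda>x. (t0, x))" by (intro continuous_intros)
  from continuous_on_compose2[OF cont' this] have cG': "continuous_on K (G' t0)"
    using I by auto
  have int: "set_integrable lborel K g" if "continuous_on K g" for g :: "'b \<Rightarrow> complex"
    unfolding set_integrable_def by (rule borel_integrable_compact[OF K that])
  show "\<exists>d>0. \<forall>y. norm (y - t0) < d \<longrightarrow>
      norm ((LINT x:K|lborel. G y x) - (LINT x:K|lborel. G t0 x) - (y - t0) *\<^sub>R (LINT x:K|lborel. G' t0 x))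
      \<le> e * norm (y - t0)"
  proof (intro exI[of _ d] conjI d(1) allI impI)
    fix y assume "norm (y - t0) < d"
    then have y: "\<bar>y - t0\<bar> < d" by simp
    have yI: "y \<in> I" using y d(2) by (auto simp: dist_real_def abs_minus_commute)
    have seg: "t \<in> I \<and> \<bar>t - t0\<bar> < d" if "t \<in> closed_segment t0 y" for t
    proof -
      have "\<bar>t - t0\<bar> \<le> \<bar>y - t0\<bar>" using that
        by (metis abs_minus_commute dist_in_closed_segment dist_real_def)
      then show ?thesis using y d(2) by (auto simp: dist_real_def abs_minus_commute)
    qed
    have pt: "norm (G y x - G t0 x - (y - t0) *\<^sub>R G' t0 x) \<le> \<bar>y - t0\<bar> * \<eta>" if x: "x \<in> K" for x
    proof (rule vector_differentiable_bound_linearization[where S="closed_segment t0 y" and f="\<lambda>t. G t x" and f'="\<lambda>t. G' t x", simplified real_norm_def])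
      show "((\<lambda>t. G t x) has_vector_derivative G' t x) (at t within closed_segment t0 y)"
        if "t \<in> closed_segment t0 y" for t
        using der[of t x] seg[OF that] x by (simp add: has_vector_derivative_at_within)
      show "norm (G' t x - G' t0 x) \<le> \<eta>" if "t \<in> closed_segment t0 y" for t
        using d(3)[of t x] seg[OF that] x by simp
    qed auto
    let ?E = "\<lambda>x. G y x - G t0 x - (y - t0) *\<^sub>R G' t0 x"
    have cE: "continuous_on K ?E" by (intro continuous_intros cont cG' yI I)
    have "(LINT x:K|lborel. G y x) - (LINT x:K|lborel. G t0 x) - (y - t0) *\<^sub>R (LINT x:K|lborel. G' t0 x)
        = (LINT x:K|lborel. ?E x)"
      by (subst set_integral_diff | simp add: int cont cG' yI I continuous_intros)+
    also have "norm \<dots> \<le> (LINT x:K|lborel. norm (?E x))"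
      by (rule set_integral_norm_bound[OF int[OF cE]])
    also have "\<dots> \<le> (LINT x:K|lborel. \<bar>y - t0\<bar> * \<eta>)"
    proof (rule set_integral_mono)
      show "set_integrable lborel K (\<lambda>x. norm (?E x))" by (rule set_integrable_norm[OF int[OF cE]])
      show "set_integrable lborel K (\<lambda>x. \<bar>y - t0\<bar> * \<eta>)"
        unfolding set_integrable_def by (rule borel_integrable_compact[OF K]) (intro continuous_intros)
    qed (rule pt)
    also have "\<dots> = \<bar>y - t0\<bar> * (\<eta> * ?V)"
      by (simp add: K set_integral_const_compact)
    finally have 1: "norm ((LINT x:K|lborel. G y x) - (LINT x:K|lborel. G t0 x) - (y - t0) *\<^sub>R (LINT x:K|lborel. G' t0 x))
      \<le> \<bar>y - t0\<bar> * (\<eta> * ?V)" .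
    have "\<eta> * ?V \<le> \<eta> * (?V + 1)" using \<eta> by (intro mult_left_mono) auto
    also have "\<dots> = e" unfolding \<eta>_def using V by (simp add: add_nonneg_eq_0_iff)
    finally have "\<eta> * ?V \<le> e" .
    then have "\<bar>y - t0\<bar> * (\<eta> * ?V) \<le> \<bar>y - t0\<bar> * e" by (intro mult_left_mono) auto
    with 1 show "norm ((LINT x:K|lborel. G y x) - (LINT x:K|lborel. G t0 x) - (y - t0) *\<^sub>R (LINT x:K|lborel. G' t0 x))
      \<le> e * norm (y - t0)" by (simp add: mult.commute)
  qed
qed

section \<open>Rotation invariance and polar coordinates\<close>

text \<open>Boxes determine \<open>lborel\<close>. The preimage of a box is its image under the
  inverse transformation, and an orthogonal linear image keeps the Lebesgue measure.\<close>

lemma lborel_distr_orthogonal: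
  fixes f :: "real^'n::{finite,wellorder} \<Rightarrow> real^'n::_"
  assumes f: "orthogonal_transformation f"
  shows "distr lborel borel f = lborel"
proof (rule lborel_eqI[symmetric])
  have lf: "linear f" using f by (rule orthogonal_transformation_linear)
  then have cf: "continuous_on UNIV f" by (rule linear_continuous_on_compose[OF continuous_on_id, simplified])
  have mf [measurable]: "f \<in> borel_measurable borel" by (rule borel_measurable_continuous_onI[OF cf])
  fix l u :: "real^'n::_" assume lu: "\<And>b. b \<in> Basis \<Longrightarrow> l \<bullet> b \<le> u \<bullet> b"
  obtain g where g: "orthogonal_transformation g" "g \<circ> f = id" "f \<circ> g = id"
    using f orthogonal_transformation_bij[OF f] orthogonal_transformation_inv[OF f]
    by (metis bij_is_inj bij_is_surj inv_o_cancel surj_iff)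
  have lg: "linear g" using g(1) by (rule orthogonal_transformation_linear)
  have gf: "g (f x) = x" and fg: "f (g x) = x" for x
    using g(2,3) by (metis comp_apply id_apply)+
  have eq: "f -` box l u = g ` box l u"
  proof (intro equalityI subsetI)
    fix x assume "x \<in> f -` box l u"
    then show "x \<in> g ` box l u" using gf[of x] by (metis image_eqI vimageE)
  qed (auto simp: fg)
  have bd: "bounded (g ` box l u)"
    by (rule bounded_linear_image) (use lg in \<open>auto simp: linear_conv_bounded_linear\<close>)
  have "f -` box l u \<in> sets borel"
    using measurable_sets[OF mf, of "box l u"] by simp
  then have S: "g ` box l u \<in> sets borel" by (simp add: eq)
  have "emeasure (distr lborel borel f) (box l u) = emeasure lborel (g ` box l u)"
    by (simp add: emeasure_distr eq)
  also have "\<dots> = ennreal (measure lborel (g ` box l u))"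
    using emeasure_bounded_finite[OF bd] by (simp add: emeasure_eq_ennreal_measure less_top)
  also have "measure lborel (g ` box l u) = measure lebesgue (g ` box l u)"
    using S by simp
  also have "\<dots> = measure lebesgue (box l u)"
    by (subst measure_linear_image[OF lg]) (use g(1) in auto)
  also have "\<dots> = (\<Prod>b\<in>Basis. (u - l) \<bullet> b)"
    using lu by (simp add: measure_lborel_box_eq)
  finally show "emeasure (distr lborel borel f) (box l u) = (\<Prod>b\<in>Basis. (u - l) \<bullet> b)" .
qed simp

text \<open>The annulus is invariant under \<open>f\<close>, and \<open>f\<close> commutes with
  \<open>sgn\<close>, so the invariance of Lebesgue measure passes to the directions.\<close>

lemma smean_orthogonal:
  fixes F :: "real^3 \<Rightarrow> 'a::{banach,second_countable_topology}"
  assumes f: "orthogonal_transformation f"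
    and F: "continuous_on (shell I) F" "r \<in> I" "r > 0"
  shows "smean (\<lambda>x. F (f x)) r = smean F r"
proof -
  have lf: "linear f" using f by (rule orthogonal_transformation_linear)
  then have cf: "continuous_on UNIV f" by (rule linear_continuous_on_compose[OF continuous_on_id, simplified])
  have mf: "f \<in> borel_measurable lborel" using borel_measurable_continuous_onI[OF cf] by simp
  have nf: "norm (f x) = norm x" for x using f by (simp add: orthogonal_transformation_norm)
  let ?h = "\<lambda>x. indicator ann x *\<^sub>R F (r *\<^sub>R sgn x)"
  have mh: "?h \<in> borel_measurable borel"
    by (rule borel_measurable_continuous_on_indicator[OF _ continuous_on_smean_integrand[OF F]])
      (simp add: compact_ann compact_imp_closed)
  have "smean F r = integral\<^sup>L (distr lborel borel f) ?h"
    by (simp add: smean_def set_lebesgue_integral_def lborel_distr_orthogonal[OF f])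
  also have "\<dots> = (LINT x|lborel. ?h (f x))"
    by (rule integral_distr) (use mf mh in auto)
  also have "(\<lambda>x. ?h (f x)) = (\<lambda>x. indicator ann x *\<^sub>R F (f (r *\<^sub>R sgn x)))"
    by (auto simp: fun_eq_iff indicator_def ann_def nf sgn_div_norm linear_scale[OF lf])
  finally show ?thesis by (simp add: smean_def set_lebesgue_integral_def)
qed

section \<open>Polar coordinates for averages over directions\<close>

lemma nn_integral_lborel_scale:
  fixes f :: "real^3 \<Rightarrow> ennreal"
  assumes [measurable]: "f \<in> borel_measurable borel" and s: "s > 0"
  shows "(\<integral>\<^sup>+x. f x \<partial>lborel) = (\<integral>\<^sup>+x. ennreal (s^3) * f (s *\<^sub>R x) \<partial>lborel)"
proof -
  have "(\<integral>\<^sup>+x. f x \<partial>lborel) = (\<integral>\<^sup>+x. f x \<partial>density (distr lborel borel (\<lambda>x. 0 + s *\<^sub>R x)) (\<lambda>_. \<bar>s\<bar>^DIM(real^3)))"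
    using lborel_affine[of s "0::real^3"] s by simp
  also have "\<dots> = (\<integral>\<^sup>+x. ennreal (s^3) * f (s *\<^sub>R x) \<partial>lborel)"
    using s by (simp add: nn_integral_density nn_integral_distr)
  finally show ?thesis .
qed

text \<open>After the substitution y = s x the condition 1 \<le> |x| \<le> 2 reads |y|/2 \<le> s
  \<le> |y|, and the Jacobians leave the weight |y|^3 / s^4. The resulting 7/3 is the integral of
  r^2 from 1 to 2.\<close>

lemma nn_integral_inverse_power4:
  assumes p: "p > (0::real)"
  shows "(\<integral>\<^sup>+s. ennreal (1 / s^4) * indicator {p/2..p} s \<partial>lborel) = ennreal (7 / 3 / p^3)"
proof -
  have "(\<integral>\<^sup>+s. ennreal (1 / s^4) * indicator {p/2..p} s \<partial>lborel) = ennreal (- 1 / (3 * p^3) - (- 1 / (3 * (p/2)^3)))"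
  proof (rule nn_integral_FTC_Icc)
    show "((\<lambda>s. - 1 / (3 * s^3)) has_real_derivative 1 / x^4) (at x)" if "x \<in> {p/2..p}" for x
      using that p by (auto intro!: derivative_eq_intros simp: divide_simps power2_eq_square eval_nat_numeral)
  qed (use p in auto)
  also have "- 1 / (3 * p^3) - (- 1 / (3 * (p/2)^3)) = 7 / 3 / p^3"
    using p by (simp add: field_simps power_divide)
  finally show ?thesis .
qed

text \<open>Tonelli and the substitutions \<open>r = s \<bar>x\<bar>\<close>, \<open>y = s x\<close> turn the integral over directions
  taken from the annulus into a full volume integral.\<close>

lemma nn_integral_polar:
  fixes F :: "real^3 \<Rightarrow> ennreal"
  assumes [measurable]: "F \<in> borel_measurable borel"
  shows "(\<integral>\<^sup>+r. ennreal (r^2) * indicator {0<..} r * (\<integral>\<^sup>+x. indicator ann x * F (r *\<^sub>R sgn x) \<partial>lborel) \<partial>lborel)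
       = ennreal (7/3) * (\<integral>\<^sup>+x. F x \<partial>lborel)"
proof -
  have A [measurable]: "ann \<in> sets borel" by (simp add: compact_ann compact_imp_closed)
  have sg [measurable]: "(sgn :: real^3 \<Rightarrow> real^3) \<in> borel_measurable borel"
    unfolding sgn_div_norm[abs_def] by measurable
  have m1: "(\<lambda>(r, x). ennreal (r^2) * indicator {0<..} r * indicator ann x * F (r *\<^sub>R sgn x))
      \<in> borel_measurable (lborel \<Otimes>\<^sub>M (lborel :: (real^3) measure))"
    by measurable
  have m2: "(\<lambda>(s, x). ennreal (s^2 * norm x ^ 3) * indicator {0<..} s * indicator ann x * F (s *\<^sub>R x))
      \<in> borel_measurable (lborel \<Otimes>\<^sub>M (lborel :: (real^3) measure))"
    by measurable
  have ind: "indicator {p/2..p} s = (if p/2 \<le> s \<and> s \<le> p then 1 else 0 :: ennreal)" for p s :: real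
    by (simp add: indicator_def)
  have m3: "(\<lambda>(s, x). ennreal (norm x ^ 3) * (ennreal (1 / s^4) * indicator {norm x / 2..norm x} s) * indicator {0<..} s * F x)
      \<in> borel_measurable (lborel \<Otimes>\<^sub>M (lborel :: (real^3) measure))"
    unfolding ind by measurable
  have "(\<integral>\<^sup>+r. ennreal (r^2) * indicator {0<..} r * (\<integral>\<^sup>+x. indicator ann x * F (r *\<^sub>R sgn x) \<partial>lborel) \<partial>lborel)
     = (\<integral>\<^sup>+r. \<integral>\<^sup>+x. ennreal (r^2) * indicator {0<..} r * indicator ann x * F (r *\<^sub>R sgn x) \<partial>lborel \<partial>lborel)"
    by (simp add: nn_integral_cmult mult.assoc)
  also have "\<dots> = (\<integral>\<^sup>+x. \<integral>\<^sup>+r. ennreal (r^2) * indicator {0<..} r * indicator ann x * F (r *\<^sub>R sgn x) \<partial>lborel \<partial>lborel)"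
    using lborel_pair.Fubini'[OF m1] by simp
  also have "\<dots> = (\<integral>\<^sup>+x. \<integral>\<^sup>+s. ennreal (s^2 * norm x ^ 3) * indicator {0<..} s * indicator ann x * F (s *\<^sub>R x) \<partial>lborel \<partial>lborel)"
  proof (rule nn_integral_cong)
    fix x :: "real^3"
    show "(\<integral>\<^sup>+r. ennreal (r^2) * indicator {0<..} r * indicator ann x * F (r *\<^sub>R sgn x) \<partial>lborel)
      = (\<integral>\<^sup>+s. ennreal (s^2 * norm x ^ 3) * indicator {0<..} s * indicator ann x * F (s *\<^sub>R x) \<partial>lborel)"
    proof (cases "x \<in> ann")
      case True
      then have nx: "norm x > 0" by (auto dest: ann_nz)
      have "(\<integral>\<^sup>+r. ennreal (r^2) * indicator {0<..} r * indicator ann x * F (r *\<^sub>R sgn x) \<partial>lborel)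
        = ennreal \<bar>norm x\<bar> * (\<integral>\<^sup>+s. ennreal ((0 + norm x * s)^2) * indicator {0<..} (0 + norm x * s) * indicator ann x * F ((0 + norm x * s) *\<^sub>R sgn x) \<partial>lborel)"
        by (rule nn_integral_real_affine) (use nx in auto)
      also have "\<dots> = (\<integral>\<^sup>+s. ennreal \<bar>norm x\<bar> * (ennreal ((0 + norm x * s)^2) * indicator {0<..} (0 + norm x * s) * indicator ann x * F ((0 + norm x * s) *\<^sub>R sgn x)) \<partial>lborel)"
        by (rule nn_integral_cmult[symmetric]) measurable
      also have "\<dots> = (\<integral>\<^sup>+s. ennreal (s^2 * norm x ^ 3) * indicator {0<..} s * indicator ann x * F (s *\<^sub>R x) \<partial>lborel)"
      proof (rule nn_integral_cong)
        fix s :: real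
        have "(norm x * s) *\<^sub>R sgn x = s *\<^sub>R x" using nx by (simp add: sgn_div_norm)
        moreover have "indicator {0<..} (norm x * s) = (indicator {0<..} s :: ennreal)"
          using nx by (auto simp: indicator_def zero_less_mult_iff)
        moreover have "ennreal \<bar>norm x\<bar> * ennreal ((norm x * s)^2) = ennreal (s^2 * norm x ^ 3)"
          by (subst ennreal_mult[symmetric], simp, simp, simp add: power2_eq_square power3_eq_cube mult_ac)
        ultimately show "ennreal \<bar>norm x\<bar> * (ennreal ((0 + norm x * s)^2) * indicator {0<..} (0 + norm x * s) * indicator ann x * F ((0 + norm x * s) *\<^sub>R sgn x))
          = ennreal (s^2 * norm x ^ 3) * indicator {0<..} s * indicator ann x * F (s *\<^sub>R x)"
          by (simp only: mult.assoc[symmetric] add_0_left)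
      qed
      finally show ?thesis .
    qed simp
  qed
  also have "\<dots> = (\<integral>\<^sup>+s. \<integral>\<^sup>+x. ennreal (s^2 * norm x ^ 3) * indicator {0<..} s * indicator ann x * F (s *\<^sub>R x) \<partial>lborel \<partial>lborel)"
    using lborel_pair.Fubini'[OF m2] by simp
  also have "\<dots> = (\<integral>\<^sup>+s. \<integral>\<^sup>+x. ennreal (norm x ^ 3) * (ennreal (1 / s^4) * indicator {norm x / 2..norm x} s) * indicator {0<..} s * F x \<partial>lborel \<partial>lborel)"
  proof (rule nn_integral_cong)
    fix s :: real
    show "(\<integral>\<^sup>+x. ennreal (s^2 * norm x ^ 3) * indicator {0<..} s * indicator ann x * F (s *\<^sub>R x) \<partial>lborel)
      = (\<integral>\<^sup>+x. ennreal (norm x ^ 3) * (ennreal (1 / s^4) * indicator {norm x / 2..norm x} s) * indicator {0<..} s * F x \<partial>lborel)"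
    proof (cases "s > 0")
      case True
      have "(\<integral>\<^sup>+x. ennreal (norm x ^ 3) * (ennreal (1 / s^4) * indicator {norm x / 2..norm x} s) * indicator {0<..} s * F x \<partial>lborel)
        = (\<integral>\<^sup>+x. ennreal (s^3) * (ennreal (norm (s *\<^sub>R x) ^ 3) * (ennreal (1 / s^4) * indicator {norm (s *\<^sub>R x) / 2..norm (s *\<^sub>R x)} s) * indicator {0<..} s * F (s *\<^sub>R x)) \<partial>lborel)"
        by (rule nn_integral_lborel_scale[OF _ True], unfold ind, measurable)
      also have "\<dots> = (\<integral>\<^sup>+x. ennreal (s^2 * norm x ^ 3) * indicator {0<..} s * indicator ann x * F (s *\<^sub>R x) \<partial>lborel)"
      proof (rule nn_integral_cong)
        fix x :: "real^3"
        have 1: "indicator {norm (s *\<^sub>R x) / 2..norm (s *\<^sub>R x)} s = (indicator ann x :: ennreal)"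
          using True by (auto simp: indicator_def ann_def)
        have "ennreal (s^3) * ennreal (norm (s *\<^sub>R x) ^ 3) * ennreal (1 / s^4) = ennreal (s^3 * norm (s *\<^sub>R x) ^ 3 * (1 / s^4))"
          using True by (simp add: ennreal_mult[symmetric])
        also have "s^3 * norm (s *\<^sub>R x) ^ 3 * (1 / s^4) = s^2 * norm x ^ 3"
          using True by (simp add: power_mult_distrib field_simps eval_nat_numeral)
        finally have 2: "ennreal (s^3) * ennreal (norm (s *\<^sub>R x) ^ 3) * ennreal (1 / s^4) = ennreal (s^2 * norm x ^ 3)" .
        show "ennreal (s^3) * (ennreal (norm (s *\<^sub>R x) ^ 3) * (ennreal (1 / s^4) * indicator {norm (s *\<^sub>R x) / 2..norm (s *\<^sub>R x)} s) * indicator {0<..} s * F (s *\<^sub>R x))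
          = ennreal (s^2 * norm x ^ 3) * indicator {0<..} s * indicator ann x * F (s *\<^sub>R x)"
          unfolding 1 2[symmetric] by (simp only: mult_ac)
      qed
      finally show ?thesis by simp
    qed simp
  qed
  also have "\<dots> = (\<integral>\<^sup>+x. \<integral>\<^sup>+s. ennreal (norm x ^ 3) * (ennreal (1 / s^4) * indicator {norm x / 2..norm x} s) * indicator {0<..} s * F x \<partial>lborel \<partial>lborel)"
    using lborel_pair.Fubini'[OF m3] by simp
  also have "\<dots> = (\<integral>\<^sup>+x. ennreal (7/3) * F x \<partial>lborel)"
  proof (rule nn_integral_cong_AE)
    \<comment> \<open>At the origin the weight |x|^3 vanishes while \<open>F 0\<close> may not, so
      the identity holds only almost everywhere.\<close>
    have "AE x in lborel. x \<noteq> (0::real^3)" by (rule AE_lborel_singleton)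
    then show "AE x in lborel. (\<integral>\<^sup>+s. ennreal (norm x ^ 3) * (ennreal (1 / s^4) * indicator {norm x / 2..norm x} s) * indicator {0<..} s * F x \<partial>lborel) = ennreal (7/3) * F x"
    proof eventually_elim
      case (elim x)
      then have p: "norm x > 0" by simp
      have "(\<integral>\<^sup>+s. ennreal (norm x ^ 3) * (ennreal (1 / s^4) * indicator {norm x / 2..norm x} s) * indicator {0<..} s * F x \<partial>lborel)
        = (\<integral>\<^sup>+s. (ennreal (norm x ^ 3) * F x) * (ennreal (1 / s^4) * indicator {norm x / 2..norm x} s) \<partial>lborel)"
        using p by (intro nn_integral_cong) (auto simp: indicator_def mult_ac)
      also have "\<dots> = ennreal (norm x ^ 3) * F x * ennreal (7 / 3 / norm x ^ 3)"
        by (subst nn_integral_cmult) (auto simp: nn_integral_inverse_power4[OF p])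
      also have "\<dots> = ennreal (norm x ^ 3) * ennreal (7 / 3 / norm x ^ 3) * F x" by (simp only: mult_ac)
      also have "ennreal (norm x ^ 3) * ennreal (7 / 3 / norm x ^ 3) = ennreal (7/3)"
        using p by (subst ennreal_mult[symmetric]) auto
      finally show ?case .
    qed
  qed
  also have "\<dots> = ennreal (7/3) * (\<integral>\<^sup>+x. F x \<partial>lborel)" by (rule nn_integral_cmult) measurable
  finally show ?thesis .
qed

lemma set_integrable_shell:
  fixes G :: "real^3 \<Rightarrow> real"
  assumes G: "continuous_on (shell {a<..<b}) G" "\<And>x. norm x \<in> {a<..<b} \<Longrightarrow> 0 \<le> G x \<and> G x \<le> B"
  shows "set_integrable lborel (shell {a<..<b}) G"
proof -
  have S: "shell {a<..<b} \<in> sets borel" using open_shell[of "{a<..<b}"] by simp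
  have fin: "emeasure lborel (shell {a<..<b}) < \<infinity>"
    by (rule emeasure_bounded_finite) (auto simp: bounded_iff intro!: exI[of _ b])
  show ?thesis unfolding set_integrable_def
  proof (rule integrableI_bounded_set[where A="shell {a<..<b}" and B=B])
    show "(\<lambda>x. indicator (shell {a<..<b}) x *\<^sub>R G x) \<in> borel_measurable lborel"
      unfolding measurable_lborel1 measurable_lborel2 by (rule borel_measurable_continuous_on_indicator[OF S G(1)])
  qed (use S fin G(2) in auto)
qed

text \<open>Working with nonnegative integrals on the radial side avoids the question whether r^2
  \<open>smean G\<close> is integrable; boundedness of \<open>G\<close> on the bounded shell makes
  the volume integral a genuine one.\<close>

lemma smean_polar:
  fixes G :: "real^3 \<Rightarrow> real"
  assumes a: "0 \<le> a" and G: "continuous_on (shell {a<..<b}) G" "\<And>x. norm x \<in> {a<..<b} \<Longrightarrow> 0 \<le> G x \<and> G x \<le> B"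
  shows "(\<integral>\<^sup>+r. ennreal (r^2 * smean G r) * indicator {a<..<b} r \<partial>lborel)
       = ennreal (7/3 * (LINT x:shell {a<..<b}|lborel. G x))"
proof -
  have S: "shell {a<..<b} \<in> sets borel" using open_shell[of "{a<..<b}"] by simp
  let ?F = "\<lambda>x. indicator (shell {a<..<b}) x *\<^sub>R G x"
  have mF: "?F \<in> borel_measurable borel"
    by (rule borel_measurable_continuous_on_indicator[OF S G(1)])
  have F0: "?F x \<ge> 0" for x using G(2)[of x] by (auto simp: indicator_def)
  have "(\<integral>\<^sup>+x. ennreal (?F x) \<partial>lborel) = ennreal (LINT x:shell {a<..<b}|lborel. G x)"
    unfolding set_lebesgue_integral_def
    by (rule nn_integral_eq_integral) (use set_integrable_shell[OF G] F0 in \<open>auto simp: set_integrable_def\<close>)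
  then have "ennreal (7/3 * (LINT x:shell {a<..<b}|lborel. G x)) = ennreal (7/3) * (\<integral>\<^sup>+x. ennreal (?F x) \<partial>lborel)"
    by (simp only:) (rule ennreal_mult', simp)
  also have "\<dots> = (\<integral>\<^sup>+r. ennreal (r^2) * indicator {0<..} r * (\<integral>\<^sup>+x. indicator ann x * ennreal (?F (r *\<^sub>R sgn x)) \<partial>lborel) \<partial>lborel)"
    by (rule nn_integral_polar[symmetric]) (use mF in measurable)
  also have "\<dots> = (\<integral>\<^sup>+r. ennreal (r^2 * smean G r) * indicator {a<..<b} r \<partial>lborel)"
  proof (rule nn_integral_cong)
    fix r :: real
    show "ennreal (r^2) * indicator {0<..} r * (\<integral>\<^sup>+x. indicator ann x * ennreal (?F (r *\<^sub>R sgn x)) \<partial>lborel)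
      = ennreal (r^2 * smean G r) * indicator {a<..<b} r"
    proof (cases "r \<in> {a<..<b}")
      case True
      then have r: "r > 0" using a by auto
      have "(\<integral>\<^sup>+x. indicator ann x * ennreal (?F (r *\<^sub>R sgn x)) \<partial>lborel)
        = (\<integral>\<^sup>+x. ennreal (indicator ann x *\<^sub>R G (r *\<^sub>R sgn x)) \<partial>lborel)"
        using True r by (intro nn_integral_cong) (auto simp: indicator_def norm_sgn_ann)
      also have "\<dots> = ennreal (smean G r)"
        unfolding smean_def set_lebesgue_integral_def
      proof (rule nn_integral_eq_integral)
        show "integrable lborel (\<lambda>x. indicat_real ann x *\<^sub>R G (r *\<^sub>R sgn x))"
          using smean_integrable[OF G(1) True r] by (simp add: set_integrable_def)
        show "AE x in lborel. 0 \<le> indicat_real ann x *\<^sub>R G (r *\<^sub>R sgn x)"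
          using True r G(2) by (intro AE_I2) (auto simp: indicator_def norm_sgn_ann)
      qed
      finally show ?thesis using True r by (simp add: ennreal_mult')
    next
      case False
      have "(\<integral>\<^sup>+x. indicator ann x * ennreal (?F (r *\<^sub>R sgn x)) \<partial>lborel) = 0 \<or> r \<le> 0"
      proof (cases "r \<le> 0")
        case False
        then have "(\<integral>\<^sup>+x. indicator ann x * ennreal (?F (r *\<^sub>R sgn x)) \<partial>lborel) = (\<integral>\<^sup>+(x::real^3). 0 \<partial>lborel)"
          using \<open>r \<notin> {a<..<b}\<close> by (intro nn_integral_cong) (auto simp: indicator_def norm_sgn_ann)
        then show ?thesis by simp
      qed simp
      then show ?thesis using False by (auto simp: indicator_def)
    qed
  qed
  finally show ?thesis by simp
qed

text \<open>The minorant \<phi> comes with an explicit antiderivative \<Phi>. Lower-order errors are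
  moved into the constant \<open>c\<close>, so that \<phi> can remain a nonnegative monomial; they
  cost only \<open>c * (b - a)\<close>.\<close>

lemma shell_integral_lower:
  fixes G :: "real^3 \<Rightarrow> real"
  assumes ab: "0 \<le> a" "a \<le> b" and G: "continuous_on (shell {a<..<b}) G" "\<And>x. norm x \<in> {a<..<b} \<Longrightarrow> 0 \<le> G x \<and> G x \<le> B"
    and c: "c \<ge> 0" and d: "\<And>r. r \<in> {a<..<b} \<Longrightarrow> \<phi> r \<le> r^2 * smean G r + c"
    and \<Phi>: "\<And>r. r \<in> {a..b} \<Longrightarrow> DERIV \<Phi> r :> \<phi> r" "\<And>r. r \<in> {a..b} \<Longrightarrow> 0 \<le> \<phi> r" "\<phi> \<in> borel_measurable borel"
  shows "\<Phi> b - \<Phi> a \<le> 7/3 * (LINT x:shell {a<..<b}|lborel. G x) + c * (b - a)"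
proof -
  have s0: "smean G r \<ge> 0" if "r \<in> {a<..<b}" for r
    unfolding smean_def set_lebesgue_integral_def
    using that G(2) ab by (intro integral_nonneg_AE AE_I2) (auto simp: indicator_def norm_sgn_ann)
  have L0: "(LINT x:shell {a<..<b}|lborel. G x) \<ge> 0"
    unfolding set_lebesgue_integral_def
    using G(2) by (intro integral_nonneg_AE AE_I2) (auto simp: indicator_def)
  have sp: "(\<integral>\<^sup>+r. ennreal (r^2 * smean G r) * indicator {a<..<b} r \<partial>lborel)
       = ennreal (7/3 * (LINT x:shell {a<..<b}|lborel. G x))"
    by (rule smean_polar[OF ab(1) G])
  have "ennreal (\<Phi> b - \<Phi> a) = (\<integral>\<^sup>+r. ennreal (\<phi> r) * indicator {a..b} r \<partial>lborel)"
    by (rule nn_integral_FTC_Icc[symmetric]) (use \<Phi> ab in auto)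
  also have "\<dots> \<le> (\<integral>\<^sup>+r. ennreal (r^2 * smean G r) * indicator {a<..<b} r + ennreal c * indicator {a..b} r \<partial>lborel)"
  proof (rule nn_integral_mono_AE)
    \<comment> \<open>The antiderivative lives on the closed interval, the shell over the open one;
      the endpoints are a null set.\<close>
    have "AE r in lborel. r \<noteq> a" "AE r in lborel. r \<noteq> b" by (rule AE_lborel_singleton)+
    then show "AE r in lborel. ennreal (\<phi> r) * indicator {a..b} r \<le> ennreal (r^2 * smean G r) * indicator {a<..<b} r + ennreal c * indicator {a..b} r"
    proof eventually_elim
      case (elim r)
      show ?case
      proof (cases "r \<in> {a<..<b}")
        case True
        then show ?thesis using d[OF True] s0[OF True] c
          by (simp add: ennreal_plus[symmetric] ennreal_leI del: ennreal_plus)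
      qed (use elim in \<open>auto simp: indicator_def\<close>)
    qed
  qed
  also have "\<dots> = (\<integral>\<^sup>+r. ennreal (r^2 * smean G r) * indicator {a<..<b} r \<partial>lborel) + (\<integral>\<^sup>+r. ennreal c * indicator {a..b} r \<partial>lborel)"
  proof (rule nn_integral_add)
    have A [measurable]: "ann \<in> sets borel" by (simp add: compact_ann compact_imp_closed)
    have sg [measurable]: "(sgn :: real^3 \<Rightarrow> real^3) \<in> borel_measurable borel"
      unfolding sgn_div_norm[abs_def] by measurable
    have S: "shell {a<..<b} \<in> sets borel" using open_shell[of "{a<..<b}"] by simp
    \<comment> \<open>Extended by zero, \<open>G\<close> is Borel on the whole space and Fubini
      gives measurability in \<open>r\<close>. Outside the interval nothing is known about
      \<open>smean G\<close>, but there the indicator removes it.\<close>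
    define F where "F = (\<lambda>x. indicator (shell {a<..<b}) x *\<^sub>R G x)"
    have [measurable]: "F \<in> borel_measurable borel"
      unfolding F_def by (rule borel_measurable_continuous_on_indicator[OF S G(1)])
    have "(\<lambda>r. LINT x|lborel. indicator ann x *\<^sub>R F (r *\<^sub>R sgn x)) \<in> borel_measurable (lborel :: real measure)"
      by (rule lborel.borel_measurable_lebesgue_integral) measurable
    then have "(\<lambda>r. ennreal (r^2 * (LINT x|lborel. indicator ann x *\<^sub>R F (r *\<^sub>R sgn x))) * indicator {a<..<b} r) \<in> borel_measurable lborel"
      by measurable
    also have "(\<lambda>r. ennreal (r^2 * (LINT x|lborel. indicator ann x *\<^sub>R F (r *\<^sub>R sgn x))) * indicator {a<..<b} r)
      = (\<lambda>r. ennreal (r^2 * smean G r) * indicator {a<..<b} r)"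
    proof
      fix r
      show "ennreal (r^2 * (LINT x|lborel. indicator ann x *\<^sub>R F (r *\<^sub>R sgn x))) * indicator {a<..<b} r
        = ennreal (r^2 * smean G r) * indicator {a<..<b} r"
      proof (cases "r \<in> {a<..<b}")
        case True
        then have "(LINT x|lborel. indicator ann x *\<^sub>R F (r *\<^sub>R sgn x)) = smean G r"
          unfolding smean_def set_lebesgue_integral_def F_def
          using ab by (intro Bochner_Integration.integral_cong) (auto simp: indicator_def norm_sgn_ann)
        then show ?thesis by simp
      qed simp
    qed
    finally show "(\<lambda>r. ennreal (r^2 * smean G r) * indicator {a<..<b} r) \<in> borel_measurable lborel" .
  qed measurable
  also have "\<dots> = ennreal (7/3 * (LINT x:shell {a<..<b}|lborel. G x) + c * (b - a))"
  proof -
    have "(\<integral>\<^sup>+r. ennreal c * indicator {a..b} r \<partial>lborel) = ennreal (c * (b - a))"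
      using ab c by (subst nn_integral_cmult_indicator) (auto simp: ennreal_mult')
    then show ?thesis
      unfolding sp using ab c L0 by (simp only:) (subst ennreal_plus, auto)
  qed
  finally show ?thesis
    using ab c L0 by (subst (asm) ennreal_le_iff) auto
qed

lemma shell_integral_upper:
  fixes G :: "real^3 \<Rightarrow> real"
  assumes ab: "0 \<le> a" "a \<le> b" and G: "continuous_on (shell {a<..<b}) G" "\<And>x. norm x \<in> {a<..<b} \<Longrightarrow> 0 \<le> G x \<and> G x \<le> B"
    and d: "\<And>r. r \<in> {a<..<b} \<Longrightarrow> r^2 * smean G r \<le> \<phi> r"
    and \<Phi>: "\<And>r. r \<in> {a..b} \<Longrightarrow> DERIV \<Phi> r :> \<phi> r" "\<And>r. r \<in> {a..b} \<Longrightarrow> 0 \<le> \<phi> r" "\<phi> \<in> borel_measurable borel"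
  shows "7/3 * (LINT x:shell {a<..<b}|lborel. G x) \<le> \<Phi> b - \<Phi> a"
proof -
  have sp: "(\<integral>\<^sup>+r. ennreal (r^2 * smean G r) * indicator {a<..<b} r \<partial>lborel)
       = ennreal (7/3 * (LINT x:shell {a<..<b}|lborel. G x))"
    by (rule smean_polar[OF ab(1) G])
  have mono: "\<Phi> a \<le> \<Phi> b" using DERIV_nonneg_imp_nondecreasing[of a b \<Phi>] ab(2) \<Phi>(1,2) by force
  have "ennreal (7/3 * (LINT x:shell {a<..<b}|lborel. G x)) \<le> (\<integral>\<^sup>+r. ennreal (\<phi> r) * indicator {a..b} r \<partial>lborel)"
    unfolding sp[symmetric]
    by (rule nn_integral_mono) (use d in \<open>auto simp: indicator_def ennreal_leI\<close>)
  also have "\<dots> = ennreal (\<Phi> b - \<Phi> a)"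
    by (rule nn_integral_FTC_Icc) (use \<Phi> ab in auto)
  finally show ?thesis using mono by (subst (asm) ennreal_le_iff) auto
qed

section \<open>Partial derivatives and the divergence theorem on spheres\<close>

lemma partial_eq: "(g has_derivative g') (at x) \<Longrightarrow> partial j g x = g' (axis j 1)"
  unfolding partial_def using frechet_derivative_at by metis

lemma has_derivative_partial:
  fixes g :: "real^3 \<Rightarrow> 'a::real_normed_vector"
  assumes "g differentiable (at x)"
  shows "(g has_derivative (\<lambda>h. \<Sum>j\<in>UNIV. h$j *\<^sub>R partial j g x)) (at x)"
proof -
  let ?f = "frechet_derivative g (at x)"
  have d: "(g has_derivative ?f) (at x)" using assms by (simp add: frechet_derivative_works)
  then have l: "linear ?f" by (rule has_derivative_linear)
  have "?f h = (\<Sum>j\<in>UNIV. h$j *\<^sub>R partial j g x)" for h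
  proof -
    have "h = (\<Sum>j\<in>UNIV. h$j *\<^sub>R axis j 1)"
      using basis_expansion[of h] by (simp add: scalar_mult_eq_scaleR)
    then have "?f h = ?f (\<Sum>j\<in>UNIV. h$j *\<^sub>R axis j 1)" by simp
    also have "\<dots> = (\<Sum>j\<in>UNIV. h$j *\<^sub>R partial j g x)"
      by (simp add: linear_sum[OF l] linear_scale[OF l] partial_def)
    finally show ?thesis .
  qed
  then have "?f = (\<lambda>h. \<Sum>j\<in>UNIV. h$j *\<^sub>R partial j g x)" by (rule ext)
  with d show ?thesis by simp
qed

text \<open>\<open>frechet_derivative\<close> is a choice among the derivatives at a point, so two
  functions with the same derivatives there get the same value, differentiable or not.\<close>

lemma partial_cong:
  assumes "open S" "x \<in> S" "\<And>y. y \<in> S \<Longrightarrow> f y = g y"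
  shows "partial j f x = partial j g x"
proof -
  have "(f has_derivative D) (at x) \<longleftrightarrow> (g has_derivative D) (at x)" for D
    using has_derivative_transform_within_open[OF _ assms(1,2)] assms(3) by metis
  then show ?thesis by (simp add: partial_def frechet_derivative_def)
qed

lemma C1_on_cong:
  assumes "open S" "\<And>y. y \<in> S \<Longrightarrow> f y = g y" "C1_on S f"
  shows "C1_on S g"
  unfolding C1_on_def
proof (intro conjI ballI allI)
  fix x assume x: "x \<in> S"
  then have "(f has_derivative frechet_derivative f (at x)) (at x)"
    using assms(3) by (simp add: C1_on_def frechet_derivative_works)
  then have "(g has_derivative frechet_derivative f (at x)) (at x)"
    using has_derivative_transform_within_open[OF _ assms(1) x] assms(2) by metis
  then show "g differentiable (at x)" by (auto simp: differentiable_def)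
next
  fix j
  have "continuous_on S (partial j f)" using assms(3) by (simp add: C1_on_def)
  then show "continuous_on S (partial j g)"
    by (rule continuous_on_eq) (use partial_cong[OF assms(1) _ assms(2)] in auto)
qed

lemma C1_on_partial_continuous: "C1_on S f \<Longrightarrow> continuous_on S (partial j f)"
  by (simp add: C1_on_def)

lemma C1_on_continuous: "C1_on S f \<Longrightarrow> continuous_on S f"
  by (intro continuous_at_imp_continuous_on ballI differentiable_imp_continuous_within)
     (auto simp: C1_on_def)

lemma C1_on_subset: "C1_on S f \<Longrightarrow> T \<subseteq> S \<Longrightarrow> C1_on T f"
  by (auto simp: C1_on_def intro: continuous_on_subset)

lemma C1_onI:
  assumes "\<And>x. x \<in> S \<Longrightarrow> (f has_derivative (\<lambda>h. \<Sum>j\<in>UNIV. h$j *\<^sub>R f' j x)) (at x)"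
    and "\<And>j. continuous_on S (f' j)"
  shows "C1_on S f" "\<And>x j. x \<in> S \<Longrightarrow> partial j f x = f' j x"
proof -
  show p: "partial j f x = f' j x" if "x \<in> S" for x j
  proof -
    have "partial j f x = (\<Sum>i\<in>UNIV. axis j 1 $ i *\<^sub>R f' i x)"
      by (rule partial_eq[OF assms(1)[OF that]])
    also have "\<dots> = (\<Sum>i\<in>UNIV. if i = j then f' i x else 0)"
      by (rule sum.cong) (auto simp: axis_def)
    finally show ?thesis by simp
  qed
  show "C1_on S f" unfolding C1_on_def
  proof (intro conjI ballI allI)
    show "continuous_on S (partial j f)" for j
      by (rule continuous_on_eq[OF assms(2)[of j]]) (simp add: p)
  qed (use assms(1) in \<open>auto simp: differentiable_def\<close>)
qed

lemma partial_const [simp]: "partial j (\<lambda>x. c) x = 0"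
  by (simp add: partial_def)

lemma C1_on_const [intro, simp]: "C1_on S (\<lambda>x. c)"
  by (simp add: C1_on_def partial_def)

lemma partial_mult:
  fixes f g :: "real^3 \<Rightarrow> complex"
  assumes "f differentiable (at x)" "g differentiable (at x)"
  shows "partial j (\<lambda>x. f x * g x) x = partial j f x * g x + f x * partial j g x"
proof -
  have "((\<lambda>x. f x * g x) has_derivative (\<lambda>h. f x * frechet_derivative g (at x) h + frechet_derivative f (at x) h * g x)) (at x)"
    by (rule has_derivative_mult) (use assms in \<open>simp_all add: frechet_derivative_works\<close>)
  from partial_eq[OF this] show ?thesis by (simp add: partial_def)
qed

lemma C1_on_mult [intro]:
  fixes f g :: "real^3 \<Rightarrow> complex"
  assumes "C1_on S f" "C1_on S g"
  shows "C1_on S (\<lambda>x. f x * g x)"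
  unfolding C1_on_def
proof (intro conjI ballI allI)
  show "(\<lambda>x. f x * g x) differentiable at x" if "x \<in> S" for x
    using assms that by (auto intro!: differentiable_mult simp: C1_on_def)
  have "continuous_on S (\<lambda>x. partial j f x * g x + f x * partial j g x)" for j
    by (intro continuous_intros C1_on_continuous C1_on_partial_continuous assms)
  then show "continuous_on S (partial j (\<lambda>x. f x * g x))" for j
    by (rule continuous_on_eq) (use assms in \<open>simp add: partial_mult C1_on_def\<close>)
qed

lemma partial_add:
  fixes f g :: "real^3 \<Rightarrow> 'a::real_normed_vector"
  assumes "f differentiable (at x)" "g differentiable (at x)"
  shows "partial j (\<lambda>x. f x + g x) x = partial j f x + partial j g x"
proof -
  have "((\<lambda>x. f x + g x) has_derivative (\<lambda>h. frechet_derivative f (at x) h + frechet_derivative g (at x) h)) (at x)"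
    by (rule has_derivative_add) (use assms in \<open>simp_all add: frechet_derivative_works\<close>)
  from partial_eq[OF this] show ?thesis by (simp add: partial_def)
qed

lemma partial_diff:
  fixes f g :: "real^3 \<Rightarrow> 'a::real_normed_vector"
  assumes "f differentiable (at x)" "g differentiable (at x)"
  shows "partial j (\<lambda>x. f x - g x) x = partial j f x - partial j g x"
proof -
  have "((\<lambda>x. f x - g x) has_derivative (\<lambda>h. frechet_derivative f (at x) h - frechet_derivative g (at x) h)) (at x)"
    by (rule has_derivative_diff) (use assms in \<open>simp_all add: frechet_derivative_works\<close>)
  from partial_eq[OF this] show ?thesis by (simp add: partial_def)
qed

lemma C1_on_add [intro]:
  assumes "C1_on S f" "C1_on S g"
  shows "C1_on S (\<lambda>x. f x + g x)"
  unfolding C1_on_def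
proof (intro conjI ballI allI)
  show "(\<lambda>x. f x + g x) differentiable at x" if "x \<in> S" for x
    using assms that by (auto intro!: differentiable_add simp: C1_on_def)
  have "continuous_on S (\<lambda>x. partial j f x + partial j g x)" for j
    by (intro continuous_intros C1_on_partial_continuous assms)
  then show "continuous_on S (partial j (\<lambda>x. f x + g x))" for j
    by (rule continuous_on_eq) (use assms in \<open>simp add: partial_add C1_on_def\<close>)
qed

lemma C1_on_diff [intro]:
  assumes "C1_on S f" "C1_on S g"
  shows "C1_on S (\<lambda>x. f x - g x)"
  unfolding C1_on_def
proof (intro conjI ballI allI)
  show "(\<lambda>x. f x - g x) differentiable at x" if "x \<in> S" for x
    using assms that by (auto intro!: differentiable_diff simp: C1_on_def)
  have "continuous_on S (\<lambda>x. partial j f x - partial j g x)" for j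
    by (intro continuous_intros C1_on_partial_continuous assms)
  then show "continuous_on S (partial j (\<lambda>x. f x - g x))" for j
    by (rule continuous_on_eq) (use assms in \<open>simp add: partial_diff C1_on_def\<close>)
qed

lemma C1_on_sum [intro]:
  assumes "finite A" "\<And>i. i \<in> A \<Longrightarrow> C1_on S (f i)"
  shows "C1_on S (\<lambda>x. \<Sum>i\<in>A. f i x)"
  using assms by (induction A rule: finite_induct) auto

lemma partial_sum:
  assumes "finite A" "\<And>i. i \<in> A \<Longrightarrow> f i differentiable (at x)"
  shows "partial j (\<lambda>x. \<Sum>i\<in>A. f i x) x = (\<Sum>i\<in>A. partial j (f i) x)"
  using assms
proof (induction A rule: finite_induct)
  case (insert a A)
  then show ?case by (simp add: partial_add differentiable_sum)
qed simp

lemma partial_nth: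
  fixes u :: "real^3 \<Rightarrow> complex^3"
  assumes "u differentiable (at x)"
  shows "partial j (\<lambda>x. u x $ i) x = partial j u x $ i"
    and "(\<lambda>x. u x $ i) differentiable (at x)"
proof -
  have d: "((\<lambda>x. u x $ i) has_derivative (\<lambda>h. frechet_derivative u (at x) h $ i)) (at x)"
    by (rule bounded_linear.has_derivative[OF bounded_linear_vec_nth])
       (use assms in \<open>simp add: frechet_derivative_works\<close>)
  from partial_eq[OF d] show "partial j (\<lambda>x. u x $ i) x = partial j u x $ i" by (simp add: partial_def)
  from d show "(\<lambda>x. u x $ i) differentiable (at x)" by (auto simp: differentiable_def)
qed

lemma C1_on_nth:
  fixes u :: "real^3 \<Rightarrow> complex^3"
  assumes "C1_on S u"
  shows "C1_on S (\<lambda>x. u x $ i)"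
  unfolding C1_on_def
proof (intro conjI ballI allI)
  have "continuous_on S (\<lambda>x. partial j u x $ i)" for j
    by (intro continuous_intros C1_on_partial_continuous assms)
  then show "continuous_on S (partial j (\<lambda>x. u x $ i))" for j
    by (rule continuous_on_eq) (use assms in \<open>simp add: partial_nth C1_on_def\<close>)
qed (use assms in \<open>auto intro!: partial_nth simp: C1_on_def\<close>)

definition cx :: "3 \<Rightarrow> real^3 \<Rightarrow> complex" where
  "cx i x = of_real (x $ i)"

lemma has_derivative_cx: "(cx i has_derivative (\<lambda>h. of_real (h $ i))) (at x)"
  unfolding cx_def[abs_def]
  by (rule bounded_linear_imp_has_derivative)
     (rule bounded_linear_compose[OF bounded_linear_of_real bounded_linear_vec_nth])

lemma partial_cx [simp]: "partial j (cx i) x = (if i = j then 1 else 0)"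
  using partial_eq[OF has_derivative_cx, of j i x] by (auto simp: axis_def)

lemma cx_differentiable [simp, intro]: "cx i differentiable (at x)"
  using has_derivative_cx by (auto simp: differentiable_def)

lemma C1_on_cx [intro, simp]: "C1_on S (cx i)"
proof -
  have "partial j (cx i) = (\<lambda>x. if i = j then 1 else 0)" for j by (rule ext) simp
  then show ?thesis by (simp add: C1_on_def)
qed

lemma continuous_on_cx [continuous_intros]: "continuous_on S (cx i)"
  by (rule C1_on_continuous) simp

text \<open>The Euler operator r d/dr: its coefficients are polynomial, and it multiplies a
  homogeneous function by its degree.\<close>

definition rad :: "(real^3 \<Rightarrow> complex) \<Rightarrow> real^3 \<Rightarrow> complex" where
  "rad F x = (\<Sum>j\<in>UNIV. cx j x * partial j F x)"

lemma continuous_on_rad: "C1_on S F \<Longrightarrow> continuous_on S (rad F)"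
  unfolding rad_def[abs_def] by (intro continuous_intros C1_on_partial_continuous)

lemma smean_deriv:
  assumes F: "C1_on (shell I) F" and I: "open I" "I \<subseteq> {0<..}" "r \<in> I"
  shows "(smean F has_vector_derivative smean (rad F) r / of_real r) (at r)"
proof -
  have "((\<lambda>t. LINT x:ann|lborel. F (t *\<^sub>R sgn x)) has_vector_derivative
      (LINT x:ann|lborel. rad F (r *\<^sub>R sgn x) / of_real r)) (at r)"
  proof (rule has_vector_derivative_lint[where I=I, OF compact_ann I(1,3)])
    fix t x assume t: "t \<in> I" and x: "x \<in> ann"
    have t0: "t > 0" using t I(2) by auto
    have 1: "(F has_derivative (\<lambda>h. \<Sum>j\<in>UNIV. h$j *\<^sub>R partial j F (t *\<^sub>R sgn x))) (at (t *\<^sub>R sgn x))"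
      by (rule has_derivative_partial) (use F t t0 x in \<open>auto simp: C1_on_def norm_sgn_ann\<close>)
    have 2: "((\<lambda>t. t *\<^sub>R sgn x) has_derivative (\<lambda>h. h *\<^sub>R sgn x)) (at t)"
      by (auto intro!: derivative_eq_intros)
    have "((\<lambda>t. F (t *\<^sub>R sgn x)) has_derivative (\<lambda>h. \<Sum>j\<in>UNIV. (h *\<^sub>R sgn x)$j *\<^sub>R partial j F (t *\<^sub>R sgn x))) (at t)"
      by (rule has_derivative_compose[OF 2 1])
    moreover have "(\<lambda>h. \<Sum>j\<in>UNIV. (h *\<^sub>R sgn x)$j *\<^sub>R partial j F (t *\<^sub>R sgn x)) = (\<lambda>h. h *\<^sub>R (rad F (t *\<^sub>R sgn x) / of_real t))"
      using t0 by (auto simp: fun_eq_iff rad_def sum_distrib_left sum_divide_distrib cx_def scaleR_conv_of_real[where 'a=complex] mult.assoc)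
    ultimately show "((\<lambda>t. F (t *\<^sub>R sgn x)) has_vector_derivative rad F (t *\<^sub>R sgn x) / of_real t) (at t)"
      by (simp add: has_vector_derivative_def)
  next
    have "continuous_on (I \<times> ann) (\<lambda>p. rad F (fst p *\<^sub>R sgn (snd p)) / of_real (fst p))"
    proof (intro continuous_intros)
      show "continuous_on (I \<times> ann) (\<lambda>p. rad F (fst p *\<^sub>R sgn (snd p)))"
      proof (rule continuous_on_compose2[OF continuous_on_rad[OF F]])
        show "continuous_on (I \<times> ann) (\<lambda>p. fst p *\<^sub>R sgn (snd p))"
          by (intro continuous_intros continuous_on_compose2[OF continuous_on_sgn_ann]) auto
        show "(\<lambda>p. fst p *\<^sub>R sgn (snd p)) ` (I \<times> ann) \<subseteq> shell I"
          using I(2) by (auto simp: norm_sgn_ann)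
      qed
    qed (use I(2) in auto)
    then show "continuous_on (I \<times> ann) (\<lambda>(t, x). rad F (t *\<^sub>R sgn x) / of_real t)"
      by (simp add: split_beta')
  next
    fix t assume "t \<in> I"
    then show "continuous_on ann (\<lambda>x. F (t *\<^sub>R sgn x))"
      using I(2) by (intro continuous_on_smean_integrand[OF C1_on_continuous[OF F]]) auto
  qed
  then show ?thesis by (simp add: smean_def[abs_def])
qed

section \<open>Coordinate rotations and the divergence theorem\<close>

definition rotp :: "3 \<Rightarrow> 3 \<Rightarrow> real \<Rightarrow> real^3 \<Rightarrow> real^3" where
  "rotp i j t x = x + ((cos t - 1) * x$i - sin t * x$j) *\<^sub>R axis i 1 + ((cos t - 1) * x$j + sin t * x$i) *\<^sub>R axis j 1"

lemma orthogonal_rotp: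
  assumes "i \<noteq> j"
  shows "orthogonal_transformation (rotp i j t)"
  unfolding orthogonal_transformation
proof (intro conjI allI)
  show "linear (rotp i j t)"
    by (rule linearI) (auto simp: rotp_def vec_eq_iff algebra_simps)
  fix x :: "real^3"
  have axn: "axis p (1::real) $ q = (if q = p then 1 else 0)" for p q :: 3
    by (simp add: axis_def)
  define a b where ab: "a = (cos t - 1) * x$i - sin t * x$j" "b = (cos t - 1) * x$j + sin t * x$i"
  have "rotp i j t x \<bullet> rotp i j t x = x \<bullet> x + 2 * a * x$i + 2 * b * x$j + a^2 + b^2"
    using assms unfolding rotp_def ab[symmetric]
    by (simp add: inner_add_left inner_add_right inner_axis inner_axis' axn power2_eq_square algebra_simps)
  also have "2 * a * x$i + 2 * b * x$j + a^2 + b^2 = 0"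
  proof -
    have "2 * a * x$i + 2 * b * x$j + a^2 + b^2 = ((sin t)^2 + (cos t)^2 - 1) * ((x$i)^2 + (x$j)^2)"
      unfolding ab by algebra
    then show ?thesis by simp
  qed
  then have "x \<bullet> x + 2 * a * x$i + 2 * b * x$j + a^2 + b^2 = x \<bullet> x" by simp
  finally show "norm (rotp i j t x) = norm x" by (simp add: norm_eq_sqrt_inner)
qed

text \<open>The average of \<open>F\<close> composed with a rotation in the plane of the axes
  \<open>i\<close> and \<open>j\<close> does not depend on the angle, and its derivative at angle 0
  is the average of the generator applied to \<open>F\<close>.\<close>

lemma smean_rot:
  assumes F: "C1_on (shell I) F" and I: "open I" "I \<subseteq> {0<..}" "r \<in> I" and ij: "i \<noteq> j"
  shows "smean (\<lambda>x. cx i x * partial j F x - cx j x * partial i F x) r = 0"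
proof -
  let ?L = "\<lambda>x. cx i x * partial j F x - cx j x * partial i F x"
  have r: "r > 0" using I by auto
  have cL: "continuous_on (shell I) ?L"
    by (intro continuous_intros C1_on_partial_continuous[OF F])
  have nr: "norm (rotp i j t x) = norm x" for t x
    using orthogonal_rotp[OF ij] by (simp add: orthogonal_transformation_norm)
  have crot: "continuous_on UNIV (\<lambda>p. rotp i j (fst p) (snd p))"
    unfolding rotp_def by (intro continuous_intros)
  have "((\<lambda>t. LINT x:ann|lborel. F (rotp i j t (r *\<^sub>R sgn x))) has_vector_derivative
      (LINT x:ann|lborel. ?L (rotp i j 0 (r *\<^sub>R sgn x)))) (at 0)"
  proof (rule has_vector_derivative_lint[where I=UNIV, OF compact_ann])
    fix t x assume x: "x \<in> ann"
    let ?y = "r *\<^sub>R sgn x"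
    let ?z = "rotp i j t ?y"
    have nz: "norm ?z = r" using r x by (simp add: nr norm_sgn_ann)
    have 1: "(F has_derivative (\<lambda>h. \<Sum>k\<in>UNIV. h$k *\<^sub>R partial k F ?z)) (at ?z)"
      by (rule has_derivative_partial) (use F I nz in \<open>auto simp: C1_on_def\<close>)
    have zi: "?z$i = cos t * ?y$i - sin t * ?y$j" and zj: "?z$j = cos t * ?y$j + sin t * ?y$i"
      using ij by (simp_all add: rotp_def axis_def algebra_simps)
    have "((\<lambda>t. (cos t - 1) * ?y$i - sin t * ?y$j) has_real_derivative - ?z$j) (at t)"
      unfolding zj by (auto intro!: derivative_eq_intros)
    moreover have "((\<lambda>t. (cos t - 1) * ?y$j + sin t * ?y$i) has_real_derivative ?z$i) (at t)"
      unfolding zi by (auto intro!: derivative_eq_intros)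
    ultimately have "((\<lambda>t. rotp i j t ?y) has_vector_derivative 0 + - ?z$j *\<^sub>R axis i 1 + ?z$i *\<^sub>R axis j 1) (at t)"
      unfolding rotp_def
      by (intro has_vector_derivative_add has_vector_derivative_const
          bounded_linear.has_vector_derivative[OF bounded_linear_scaleR_left])
         (simp_all add: has_real_derivative_iff_has_vector_derivative)
    then have 2: "((\<lambda>t. rotp i j t ?y) has_derivative (\<lambda>h. h *\<^sub>R (?z$i *\<^sub>R axis j 1 - ?z$j *\<^sub>R axis i 1))) (at t)"
      by (simp add: has_vector_derivative_def)
    have "((\<lambda>t. F (rotp i j t ?y)) has_derivative (\<lambda>h. \<Sum>k\<in>UNIV. (h *\<^sub>R (?z$i *\<^sub>R axis j 1 - ?z$j *\<^sub>R axis i 1))$k *\<^sub>R partial k F ?z)) (at t)"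
      using has_derivative_compose[OF 2 1] .
    moreover have "(\<Sum>k\<in>UNIV. (h *\<^sub>R (?z$i *\<^sub>R axis j 1 - ?z$j *\<^sub>R axis i 1))$k *\<^sub>R partial k F ?z) = h *\<^sub>R ?L ?z" for h
    proof -
      have "(\<Sum>k\<in>UNIV. (h *\<^sub>R (?z$i *\<^sub>R axis j 1 - ?z$j *\<^sub>R axis i 1))$k *\<^sub>R partial k F ?z)
        = (\<Sum>k\<in>UNIV. (if k = j then (h * ?z$i) *\<^sub>R partial k F ?z else 0) - (if k = i then (h * ?z$j) *\<^sub>R partial k F ?z else 0))"
        using ij by (intro sum.cong) (auto simp: axis_def)
      also have "\<dots> = h *\<^sub>R ?L ?z"
        by (simp add: sum_subtractf cx_def scaleR_conv_of_real algebra_simps)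
      finally show ?thesis .
    qed
    ultimately show "((\<lambda>t. F (rotp i j t ?y)) has_vector_derivative ?L ?z) (at t)"
      by (simp add: has_vector_derivative_def)
  next
    have "continuous_on (UNIV \<times> ann) (\<lambda>p. ?L (rotp i j (fst p) (r *\<^sub>R sgn (snd p))))"
    proof (rule continuous_on_compose2[OF cL])
      show "continuous_on (UNIV \<times> ann) (\<lambda>p. rotp i j (fst p) (r *\<^sub>R sgn (snd p)))"
      proof -
        have "continuous_on (UNIV \<times> ann) (\<lambda>p. (fst p, r *\<^sub>R sgn (snd p)))"
          by (intro continuous_intros continuous_on_compose2[OF continuous_on_sgn_ann]) auto
        from continuous_on_compose2[OF crot this] show ?thesis by simp
      qed
    qed (use I r in \<open>auto simp: nr norm_sgn_ann\<close>)
    then show "continuous_on (UNIV \<times> ann) (\<lambda>(t, x). ?L (rotp i j t (r *\<^sub>R sgn x)))"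
      by (simp add: split_beta')
  next
    fix t :: real
    show "continuous_on ann (\<lambda>x. F (rotp i j t (r *\<^sub>R sgn x)))"
    proof (rule continuous_on_compose2[OF C1_on_continuous[OF F]])
      have "continuous_on ann (\<lambda>x. (t, r *\<^sub>R sgn x))" by (intro continuous_intros continuous_on_sgn_ann)
      from continuous_on_compose2[OF crot this] show "continuous_on ann (\<lambda>x. rotp i j t (r *\<^sub>R sgn x))" by simp
    qed (use I r in \<open>auto simp: nr norm_sgn_ann\<close>)
  qed auto
  moreover have "(\<lambda>t. LINT x:ann|lborel. F (rotp i j t (r *\<^sub>R sgn x))) = (\<lambda>t. smean F r)"
    using smean_orthogonal[OF orthogonal_rotp[OF ij] C1_on_continuous[OF F] I(3) r]
    by (simp add: smean_def)
  moreover have "(LINT x:ann|lborel. ?L (rotp i j 0 (r *\<^sub>R sgn x))) = smean ?L r"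
    by (simp add: smean_def rotp_def)
  ultimately have "((\<lambda>t::real. smean F r) has_vector_derivative smean ?L r) (at 0)" by simp
  moreover have "((\<lambda>t::real. smean F r) has_vector_derivative 0) (at 0)" by simp
  ultimately show ?thesis by (rule vector_derivative_unique_at)
qed

text \<open>Up to radial derivatives, \<open>r\<^sup>2 div w\<close> is a sum of infinitesimal rotations, whose averages vanish.\<close>

lemma smean_div:
  fixes w :: "3 \<Rightarrow> real^3 \<Rightarrow> complex"
  assumes w: "\<And>j. C1_on (shell I) (w j)" and I: "open I" "I \<subseteq> {0<..}" "r \<in> I"
  shows "((\<lambda>r. of_real r * smean (\<lambda>x. \<Sum>j\<in>UNIV. cx j x * w j x) r) has_vector_derivative
     of_real (r^2) * smean (\<lambda>x. \<Sum>j\<in>UNIV. partial j (w j) x) r) (at r)"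
proof -
  let ?X = "\<lambda>x. \<Sum>j\<in>UNIV. cx j x * w j x"
  let ?D = "\<lambda>x. \<Sum>j\<in>UNIV. partial j (w j) x"
  have r: "r > 0" using I by auto
  have cw: "continuous_on (shell I) (w j)" for j by (rule C1_on_continuous[OF w])
  have cp: "continuous_on (shell I) (partial k (w j))" for j k by (rule C1_on_partial_continuous[OF w])
  have wd: "w j differentiable (at x)" if "norm x = r" for j x
    using w[of j] I that by (auto simp: C1_on_def)
  have CX: "C1_on (shell I) ?X" by (intro C1_on_sum C1_on_mult w) auto
  \<comment> \<open>Applied to \<open>cx i * w j\<close> and summed, the generators give r^2 div w
    minus \<open>rad ?X + ?X\<close>. The averages of the generators vanish, and that of
    \<open>rad ?X + ?X\<close> is the derivative of r times the average of
    \<open>?X\<close>.\<close>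
  let ?R = "\<lambda>i j x. cx i x * partial j (\<lambda>y. cx i y * w j y) x - cx j x * partial i (\<lambda>y. cx i y * w j y) x"
  have R0: "smean (?R i j) r = 0" for i j
  proof (cases "i = j")
    case False
    show ?thesis by (rule smean_rot[OF _ I False]) (intro C1_on_mult w C1_on_cx)
  qed simp
  have cR: "continuous_on (shell I) (?R i j)" for i j
    by (intro continuous_intros C1_on_partial_continuous[where S="shell I"] C1_on_mult w C1_on_cx)
  have pt: "of_real (r^2) * ?D x = (\<Sum>i\<in>UNIV. \<Sum>j\<in>UNIV. ?R i j x) + (rad ?X x + ?X x)"
    if "norm x = r" for x
  proof -
    have "r^2 = x$1 * x$1 + x$2 * x$2 + x$3 * x$3"
      using that by (auto simp: power2_norm_eq_inner inner_vec_def sum_3)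
    then have n: "of_real (r^2) = cx 1 x * cx 1 x + cx 2 x * cx 2 x + cx 3 x * cx 3 x"
      by (simp add: cx_def)
    have pm: "partial k (\<lambda>y. cx i y * w j y) x = (if i = k then w j x else 0) + cx i x * partial k (w j) x" for i j k
      using that by (simp add: partial_mult wd)
    have rX: "rad ?X x = (\<Sum>k\<in>UNIV. cx k x * (\<Sum>j\<in>UNIV. (if j = k then w j x else 0) + cx j x * partial k (w j) x))"
      unfolding rad_def using that by (subst partial_sum) (auto simp: pm wd intro!: differentiable_mult)
    show ?thesis
      unfolding n rX pm by (simp add: sum_3 algebra_simps)
  qed
  have "of_real (r^2) * smean ?D r = smean (\<lambda>x. of_real (r^2) * ?D x) r"
    by (rule smean_cmult[symmetric])
  also have "\<dots> = smean (\<lambda>x. (\<Sum>i\<in>UNIV. \<Sum>j\<in>UNIV. ?R i j x) + (rad ?X x + ?X x)) r"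
    by (rule smean_cong[OF pt r])
  also have "\<dots> = smean (\<lambda>x. \<Sum>i\<in>UNIV. \<Sum>j\<in>UNIV. ?R i j x) r + smean (\<lambda>x. rad ?X x + ?X x) r"
    by (rule smean_add[OF _ _ I(3) r]) (intro continuous_intros cR continuous_on_rad CX cw)+
  also have "smean (\<lambda>x. rad ?X x + ?X x) r = smean (rad ?X) r + smean ?X r"
    by (rule smean_add[OF _ _ I(3) r]) (intro continuous_intros continuous_on_rad CX cw)+
  also have "smean (\<lambda>x. \<Sum>i\<in>UNIV. \<Sum>j\<in>UNIV. ?R i j x) r = (\<Sum>i\<in>UNIV. smean (\<lambda>x. \<Sum>j\<in>UNIV. ?R i j x) r)"
    by (rule smean_sum[OF _ _ I(3) r]) (auto intro!: continuous_on_sum cR)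
  also have "\<dots> = (\<Sum>i\<in>UNIV. \<Sum>j\<in>UNIV. smean (?R i j) r)"
    by (rule sum.cong[OF refl], rule smean_sum[OF _ _ I(3) r]) (auto intro!: cR)
  also have "\<dots> = 0" by (simp only: R0 sum.neutral_const)
  finally have eq: "of_real (r^2) * smean ?D r = smean (rad ?X) r + smean ?X r" by simp
  have "((\<lambda>r. of_real r * smean ?X r) has_vector_derivative (of_real r * (smean (rad ?X) r / of_real r) + 1 * smean ?X r)) (at r)"
    by (rule has_vector_derivative_mult[OF _ smean_deriv[OF CX I]])
       (rule has_vector_derivative_of_real[OF DERIV_ident, unfolded of_real_1])
  then show ?thesis unfolding eq using r by simp
qed

section \<open>Projection onto the toroidal mode\<close>

definition zb :: "real^3 \<Rightarrow> complex" where
  "zb x = cx 1 x - \<i> * cx 2 x"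

definition vlin :: "3 \<Rightarrow> real^3 \<Rightarrow> complex" where
  "vlin i x = (if i = 1 then cx 3 x else if i = 2 then - \<i> * cx 3 x else - zb x)"

text \<open>The complex conjugate of the solid extension of \<open>T\<^sub>n\<^sup>n\<close>, up to a constant: with
  \<open>\<zeta> = x\<^sub>1 + \<i> x\<^sub>2\<close> one has \<open>\<nabla>\<zeta>\<^sup>n \<times> x = \<i> n \<zeta>\<^sup>n\<^sup>-\<^sup>1 (x\<^sub>3, \<i> x\<^sub>3, - \<zeta>)\<close>.\<close>

definition vb :: "nat \<Rightarrow> 3 \<Rightarrow> real^3 \<Rightarrow> complex" where
  "vb n i x = zb x ^ (n - 1) * vlin i x"

text \<open>Together with \<open>lc\<close>: the constant gradients of the linear functions
  \<open>zb\<close> and \<open>vlin i\<close>.\<close>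

definition zc :: "3 \<Rightarrow> complex" where
  "zc j = (if j = 1 then 1 else if j = 2 then - \<i> else 0)"

definition lc :: "3 \<Rightarrow> 3 \<Rightarrow> complex" where
  "lc i j = (if i = 1 then (if j = 3 then 1 else 0) else if i = 2 then (if j = 3 then - \<i> else 0) else - zc j)"

lemma has_derivative_zb: "(zb has_derivative (\<lambda>h. \<Sum>j\<in>UNIV. h$j *\<^sub>R zc j)) (at x)"
  unfolding zb_def[abs_def]
  by (auto intro!: derivative_eq_intros has_derivative_cx simp: zc_def sum_3 scaleR_conv_of_real fun_eq_iff)

lemma has_derivative_vlin: "(vlin i has_derivative (\<lambda>h. \<Sum>j\<in>UNIV. h$j *\<^sub>R lc i j)) (at x)"
  unfolding vlin_def[abs_def] using exhaust_3[of i]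
  by (auto intro!: derivative_eq_intros has_derivative_cx has_derivative_zb simp: lc_def zc_def sum_3 scaleR_conv_of_real fun_eq_iff)

lemma C1_on_zb [intro, simp]: "C1_on S zb" and partial_zb [simp]: "partial j zb x = zc j"
  using C1_onI[of UNIV zb "\<lambda>j x. zc j"] has_derivative_zb by (auto intro: C1_on_subset)

lemma C1_on_vlin [intro, simp]: "C1_on S (vlin i)" and partial_vlin [simp]: "partial j (vlin i) x = lc i j"
  using C1_onI[of UNIV "vlin i" "\<lambda>j x. lc i j"] has_derivative_vlin by (auto intro: C1_on_subset)

lemma zb_differentiable [simp]: "zb differentiable (at x)" and vlin_differentiable [simp]: "vlin i differentiable (at x)"
  using has_derivative_zb has_derivative_vlin by (auto simp: differentiable_def)

lemma C1_on_power:
  fixes f :: "real^3 \<Rightarrow> complex"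
  shows "C1_on S f \<Longrightarrow> C1_on S (\<lambda>x. f x ^ m)"
  by (induction m) auto

lemma partial_power:
  fixes f :: "real^3 \<Rightarrow> complex"
  assumes "f differentiable (at x)"
  shows "partial j (\<lambda>x. f x ^ m) x = of_nat m * f x ^ (m - 1) * partial j f x"
proof (induction m)
  case (Suc m)
  have "partial j (\<lambda>x. f x ^ Suc m) x = partial j f x * f x ^ m + f x * (of_nat m * f x ^ (m - 1) * partial j f x)"
    using assms by (simp add: partial_mult differentiable_power Suc)
  also have "\<dots> = of_nat (Suc m) * f x ^ (Suc m - 1) * partial j f x"
    by (cases m) (auto simp: algebra_simps)
  finally show ?case .
qed simp

lemma zb_power_differentiable [simp]: "(\<lambda>x. zb x ^ m) differentiable (at x)"
  by (simp add: differentiable_power)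

lemma C1_on_vb [intro, simp]: "C1_on S (vb n i)"
  unfolding vb_def[abs_def] by (intro C1_on_mult C1_on_power) auto

lemma vb_differentiable [simp]: "vb n i differentiable (at x)"
  using C1_on_vb[of UNIV] by (simp add: C1_on_def)

lemma partial_vb: "partial j (vb n i) = (\<lambda>x. of_nat (n - 1) * zb x ^ (n - 2) * zc j * vlin i x + zb x ^ (n - 1) * lc i j)"
proof
  fix x
  have "n - 1 - 1 = n - 2" by simp
  then show "partial j (vb n i) x = of_nat (n - 1) * zb x ^ (n - 2) * zc j * vlin i x + zb x ^ (n - 1) * lc i j"
    unfolding vb_def[abs_def] by (simp add: partial_mult partial_power)
qed

lemma C1_on_partial_vb [intro, simp]: "C1_on S (partial j (vb n i))"
  unfolding partial_vb by (intro C1_on_mult C1_on_power C1_on_add) auto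

text \<open>The gradient of \<open>zb\<close> is isotropic and orthogonal to the gradient of each
  \<open>vlin i\<close>. No other products occur in the Laplacian of
  \<open>zb x ^ (n - 1) * vlin i x\<close>, whence its harmonicity.\<close>

lemma zc_sq: "(\<Sum>j\<in>UNIV. zc j * zc j) = 0" and zc_lc: "(\<Sum>j\<in>UNIV. zc j * lc i j) = 0"
  by (auto simp: zc_def lc_def sum_3)

lemma vb_harmonic: "(\<Sum>j\<in>UNIV. partial j (partial j (vb n i)) x) = 0"
proof -
  have 1: "partial j (partial j (vb n i)) x
     = of_nat (n - 1) * of_nat (n - 2) * zb x ^ (n - 2 - 1) * vlin i x * (zc j * zc j)
       + 2 * of_nat (n - 1) * zb x ^ (n - 2) * (zc j * lc i j)" for j
  proof -
    have "partial j (partial j (vb n i)) x = partial j (\<lambda>x. of_nat (n - 1) * zb x ^ (n - 2) * zc j * vlin i x) x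
        + partial j (\<lambda>x. zb x ^ (n - 1) * lc i j) x"
      unfolding partial_vb by (rule partial_add) (auto intro!: differentiable_mult)
    also have "partial j (\<lambda>x. zb x ^ (n - 1) * lc i j) x = of_nat (n - 1) * zb x ^ (n - 2) * zc j * lc i j"
      by (subst partial_mult) (auto simp: partial_power numeral_2_eq_2)
    also have "partial j (\<lambda>x. of_nat (n - 1) * zb x ^ (n - 2) * zc j * vlin i x) x
        = of_nat (n - 1) * (of_nat (n - 2) * zb x ^ (n - 2 - 1) * zc j) * zc j * vlin i x
          + of_nat (n - 1) * zb x ^ (n - 2) * zc j * lc i j"
      by (subst partial_mult | force intro!: differentiable_mult simp: partial_power)+
    finally show ?thesis by (simp add: algebra_simps)
  qed
  have "(\<Sum>j\<in>UNIV. partial j (partial j (vb n i)) x)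
     = of_nat (n - 1) * of_nat (n - 2) * zb x ^ (n - 2 - 1) * vlin i x * (\<Sum>j\<in>UNIV. zc j * zc j)
       + 2 * of_nat (n - 1) * zb x ^ (n - 2) * (\<Sum>j\<in>UNIV. zc j * lc i j)"
    unfolding 1 sum.distrib sum_distrib_left by simp
  then show ?thesis by (simp only: zc_sq zc_lc mult_zero_right add_0)
qed

text \<open>This absorbs the truncated subtraction: at \<open>n = 1\<close> the exponent
  \<open>n - 2\<close> is not the predecessor of \<open>n - 1\<close>, but the factor
  \<open>n - 1\<close> vanishes.\<close>

lemma zb_power_pred: "of_nat (n - 1) * zb x ^ (n - 2) * zb x = of_nat (n - 1) * zb x ^ (n - 1)"
proof (cases "n - 1")
  case (Suc m)
  then have "n - 2 = m" by simp
  with Suc show ?thesis by simp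
qed simp

lemma rad_vb:
  assumes "n \<ge> 1"
  shows "rad (vb n i) x = of_nat n * vb n i x"
proof -
  have z: "(\<Sum>j\<in>UNIV. cx j x * zc j) = zb x" by (simp add: sum_3 zc_def zb_def)
  have l: "(\<Sum>j\<in>UNIV. cx j x * lc i j) = vlin i x"
    using exhaust_3[of i] by (auto simp: sum_3 lc_def vlin_def zc_def zb_def)
  have "rad (vb n i) x = of_nat (n - 1) * zb x ^ (n - 2) * (\<Sum>j\<in>UNIV. cx j x * zc j) * vlin i x
      + zb x ^ (n - 1) * (\<Sum>j\<in>UNIV. cx j x * lc i j)"
    unfolding rad_def partial_vb sum_distrib_left sum_distrib_right sum.distrib[symmetric]
    by (rule sum.cong) (auto simp: algebra_simps)
  also have "\<dots> = (of_nat (n - 1) + 1) * vb n i x"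
    unfolding z l zb_power_pred by (simp add: vb_def algebra_simps)
  also have "of_nat (n - 1) + (1::complex) = of_nat n" using assms by (simp add: of_nat_diff)
  finally show ?thesis .
qed

text \<open>With \<open>x_vb\<close> this makes \<open>vb\<close> solenoidal and tangential, the two
  properties that hide gradients from it.\<close>

lemma div_vb: "(\<Sum>i\<in>UNIV. partial i (vb n i) x) = 0"
proof -
  have "(\<Sum>i\<in>UNIV. partial i (vb n i) x) = of_nat (n - 1) * zb x ^ (n - 2) * (\<Sum>i\<in>UNIV. zc i * vlin i x)
      + zb x ^ (n - 1) * (\<Sum>i\<in>UNIV. lc i i)"
    unfolding partial_vb sum_distrib_left sum.distrib[symmetric]
    by (rule sum.cong) (auto simp: algebra_simps)
  also have "(\<Sum>i\<in>UNIV. zc i * vlin i x) = 0" by (simp add: sum_3 zc_def vlin_def algebra_simps)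
  also have "(\<Sum>i\<in>UNIV. lc i i) = 0" by (simp add: sum_3 zc_def lc_def)
  finally show ?thesis by simp
qed

lemma x_vb: "(\<Sum>i\<in>UNIV. cx i x * vb n i x) = 0"
proof -
  have "(\<Sum>i\<in>UNIV. cx i x * vlin i x) = 0"
    by (simp add: sum_3 vlin_def zb_def algebra_simps)
  then have "zb x ^ (n - 1) * (\<Sum>i\<in>UNIV. cx i x * vlin i x) = 0" by simp
  then show ?thesis by (simp add: vb_def sum_distrib_left mult_ac)
qed

lemma norm_cx: "norm (cx i x) \<le> norm x"
  by (simp add: cx_def component_le_norm_cart)

lemma norm_zb: "norm (zb x) \<le> norm x"
proof -
  have "norm (zb x) ^ 2 = (x$1)^2 + (x$2)^2"
    by (simp add: zb_def cx_def cmod_power2)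
  also have "\<dots> \<le> norm x ^ 2"
    unfolding power2_norm_eq_inner by (simp add: inner_vec_def sum_3 power2_eq_square)
  finally show ?thesis by (rule power2_le_imp_le) simp
qed

lemma norm_vb:
  assumes "n \<ge> 1"
  shows "norm (vb n i x) \<le> norm x ^ n"
proof -
  have "norm (vlin i x) \<le> norm x"
    using exhaust_3[of i] norm_cx[of 3 x] norm_zb[of x] by (auto simp: vlin_def norm_mult)
  then have "norm (zb x) ^ (n - 1) * norm (vlin i x) \<le> norm x ^ (n - 1) * norm x"
    by (intro mult_mono power_mono norm_zb) auto
  also have "norm x ^ (n - 1) * norm x = norm x ^ n" using assms by (metis power_minus_mult zero_less_one order_less_le_trans)
  finally show ?thesis by (simp add: vb_def norm_mult norm_power)
qed

lemma zb_scale: "zb (r *\<^sub>R x) = of_real r * zb x"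
  by (simp add: zb_def cx_def algebra_simps)

lemma vb_scale:
  assumes "n \<ge> 1"
  shows "vb n i (r *\<^sub>R x) = of_real r ^ n * vb n i x"
proof -
  have "vlin i (r *\<^sub>R x) = of_real r * vlin i x"
    by (simp add: vlin_def zb_scale) (simp add: cx_def)
  then have "vb n i (r *\<^sub>R x) = (of_real r ^ (n - 1) * of_real r) * vb n i x"
    by (simp add: vb_def zb_scale power_mult_distrib mult_ac)
  also have "of_real r ^ (n - 1) * of_real r = (of_real r ^ n :: complex)"
    using assms by (metis power_minus_mult zero_less_one order_less_le_trans)
  finally show ?thesis .
qed

text \<open>The pairing is bilinear, since \<open>vb\<close> already carries the conjugation. By
  homogeneity its average at radius r is r^n times the coefficient of the mode, up to a
  constant.\<close>

definition proj :: "nat \<Rightarrow> (real^3 \<Rightarrow> complex^3) \<Rightarrow> real^3 \<Rightarrow> complex" where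
  "proj n u x = (\<Sum>i\<in>UNIV. u x $ i * vb n i x)"

text \<open>Here r d/dr acts on \<open>u\<close> alone: if the average of \<open>proj n u\<close> is
  r^n b, that of \<open>radproj n u\<close> is r^(n+1) b'.\<close>

definition radproj :: "nat \<Rightarrow> (real^3 \<Rightarrow> complex^3) \<Rightarrow> real^3 \<Rightarrow> complex" where
  "radproj n u x = (\<Sum>i\<in>UNIV. rad (\<lambda>y. u y $ i) x * vb n i x)"

lemma continuous_on_vb [continuous_intros]: "continuous_on S (vb n i)"
  by (rule C1_on_continuous) simp

lemma C1_on_proj: "C1_on S u \<Longrightarrow> C1_on S (proj n u)"
  unfolding proj_def[abs_def] by (intro C1_on_sum C1_on_mult C1_on_nth) auto

lemma continuous_on_proj: "continuous_on S u \<Longrightarrow> continuous_on S (proj n u)"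
  unfolding proj_def[abs_def] by (intro continuous_intros)

lemma continuous_on_radproj: "C1_on S u \<Longrightarrow> continuous_on S (radproj n u)"
  unfolding radproj_def[abs_def] by (intro continuous_intros continuous_on_rad C1_on_nth)

text \<open>The field \<open>vb\<close> times \<psi> has no radial component, so its flux through
  spheres is zero and its divergence averages to 0; as \<open>vb\<close> is solenoidal, that
  divergence is \<open>vb\<close> paired with the gradient of \<psi>. This is what removes the
  grad-div part of the Lame operator.\<close>

lemma smean_tangential:
  assumes \<psi>: "C1_on (shell I) \<psi>" and I: "open I" "I \<subseteq> {0<..}" "r \<in> I"
  shows "smean (\<lambda>x. \<Sum>j\<in>UNIV. vb n j x * partial j \<psi> x) r = 0"
proof -
  have r: "r > 0" using I by auto
  have d: "((\<lambda>r. of_real r * smean (\<lambda>x. \<Sum>j\<in>UNIV. cx j x * (vb n j x * \<psi> x)) r) has_vector_derivative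
     of_real (r^2) * smean (\<lambda>x. \<Sum>j\<in>UNIV. partial j (\<lambda>x. vb n j x * \<psi> x) x) r) (at r)"
    by (rule smean_div[OF _ I]) (intro C1_on_mult \<psi> C1_on_vb)
  have "(\<Sum>j\<in>UNIV. cx j x * (vb n j x * \<psi> x)) = (\<Sum>j\<in>UNIV. cx j x * vb n j x) * \<psi> x" for x
    by (simp add: sum_distrib_right mult.assoc)
  then have 0: "(\<lambda>x. \<Sum>j\<in>UNIV. cx j x * (vb n j x * \<psi> x)) = (\<lambda>x. 0)" by (simp add: x_vb)
  have "((\<lambda>r::real. 0) has_vector_derivative
     of_real (r^2) * smean (\<lambda>x. \<Sum>j\<in>UNIV. partial j (\<lambda>x. vb n j x * \<psi> x) x) r) (at r)"
    using d unfolding 0 by simp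
  moreover have "((\<lambda>r::real. 0) has_vector_derivative (0::complex)) (at r)" by simp
  ultimately have "of_real (r^2) * smean (\<lambda>x. \<Sum>j\<in>UNIV. partial j (\<lambda>x. vb n j x * \<psi> x) x) r = 0"
    by (rule vector_derivative_unique_at)
  then have "smean (\<lambda>x. \<Sum>j\<in>UNIV. partial j (\<lambda>x. vb n j x * \<psi> x) x) r = 0" using r by simp
  moreover have "smean (\<lambda>x. \<Sum>j\<in>UNIV. partial j (\<lambda>x. vb n j x * \<psi> x) x) r = smean (\<lambda>x. \<Sum>j\<in>UNIV. vb n j x * partial j \<psi> x) r"
  proof (rule smean_cong[OF _ r])
    fix x :: "real^3" assume "norm x = r"
    then have "\<psi> differentiable (at x)" using \<psi> I by (auto simp: C1_on_def)
    then have "(\<Sum>j\<in>UNIV. partial j (\<lambda>x. vb n j x * \<psi> x) x) = (\<Sum>j\<in>UNIV. partial j (vb n j) x) * \<psi> x + (\<Sum>j\<in>UNIV. vb n j x * partial j \<psi> x)"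
      by (simp add: partial_mult sum.distrib sum_distrib_right)
    then show "(\<Sum>j\<in>UNIV. partial j (\<lambda>x. vb n j x * \<psi> x) x) = (\<Sum>j\<in>UNIV. vb n j x * partial j \<psi> x)"
      by (simp add: div_vb)
  qed
  ultimately show ?thesis by simp
qed

section \<open>Radial equations for the projected field\<close>

context
  fixes I :: "real set" and n :: nat
  assumes I: "open I" "I \<subseteq> {0<..}" and n: "n \<ge> 1"
begin

lemma rad_proj:
  assumes u: "C1_on (shell I) u" and x: "norm x \<in> I"
  shows "rad (proj n u) x = radproj n u x + of_nat n * proj n u x"
proof -
  have ud: "u differentiable (at x)" using u x by (auto simp: C1_on_def)
  have "partial j (proj n u) x = (\<Sum>i\<in>UNIV. partial j (\<lambda>y. u y $ i) x * vb n i x + u x $ i * partial j (vb n i) x)" for j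
    unfolding proj_def[abs_def] using partial_nth(2)[OF ud]
    by (simp add: partial_sum differentiable_mult partial_mult)
  then have "rad (proj n u) x = (\<Sum>j\<in>UNIV. \<Sum>i\<in>UNIV. cx j x * (partial j (\<lambda>y. u y $ i) x * vb n i x + u x $ i * partial j (vb n i) x))"
    by (simp add: rad_def sum_distrib_left)
  also have "\<dots> = (\<Sum>i\<in>UNIV. \<Sum>j\<in>UNIV. cx j x * (partial j (\<lambda>y. u y $ i) x * vb n i x + u x $ i * partial j (vb n i) x))"
    by (rule sum.swap)
  also have "\<dots> = (\<Sum>i\<in>UNIV. rad (\<lambda>y. u y $ i) x * vb n i x + u x $ i * rad (vb n i) x)"
    by (simp add: rad_def sum_distrib_left sum_distrib_right sum.distrib algebra_simps)
  also have "\<dots> = radproj n u x + of_nat n * proj n u x"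
    by (simp add: radproj_def proj_def rad_vb[OF n] sum.distrib sum_distrib_left mult_ac)
  finally show ?thesis .
qed

lemma smean_proj_deriv:
  assumes u: "C1_on (shell I) u" and r: "r \<in> I"
  shows "(smean (proj n u) has_vector_derivative (smean (radproj n u) r + of_nat n * smean (proj n u) r) / of_real r) (at r)"
proof -
  have r0: "r > 0" using I r by auto
  have "smean (rad (proj n u)) r = smean (\<lambda>x. radproj n u x + of_nat n * proj n u x) r"
    by (rule smean_cong[OF _ r0]) (use rad_proj[OF u] r in auto)
  also have "\<dots> = smean (radproj n u) r + smean (\<lambda>x. of_nat n * proj n u x) r"
    by (rule smean_add[OF _ _ r r0]) (intro continuous_intros continuous_on_radproj continuous_on_proj C1_on_continuous u)+
  finally show ?thesis
    using smean_deriv[OF C1_on_proj[OF u, of n] I r] by (simp add: smean_cmult)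
qed

text \<open>Green's second identity for \<open>u\<close> and the harmonic field \<open>vb\<close>:
  the flux of \<open>w\<close> is the difference of the two normal derivatives, and by Euler's
  relation that of \<open>vb\<close> contributes the factor n.\<close>

lemma smean_proj_deriv2:
  assumes u: "C2_on (shell I) u" and r: "r \<in> I"
  shows "((\<lambda>r. of_real r * (smean (radproj n u) r - of_nat n * smean (proj n u) r)) has_vector_derivative
     of_real (r^2) * smean (proj n (laplacian u)) r) (at r)"
proof -
  have r0: "r > 0" using I r by auto
  have u1: "C1_on (shell I) u" and u2: "C1_on (shell I) (partial j u)" for j
    using u by (auto simp: C2_on_def)
  have ud: "u differentiable (at x)" and ud2: "partial j u differentiable (at x)" if "norm x \<in> I" for x j
    using u1 u2[of j] that by (auto simp: C1_on_def)
  define w where "w j x = (\<Sum>i\<in>UNIV. partial j u x $ i * vb n i x - u x $ i * partial j (vb n i) x)" for j x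
  have "((\<lambda>r. of_real r * smean (\<lambda>x. \<Sum>j\<in>UNIV. cx j x * w j x) r) has_vector_derivative
     of_real (r^2) * smean (\<lambda>x. \<Sum>j\<in>UNIV. partial j (w j) x) r) (at r)"
    unfolding w_def
    by (rule smean_div[OF _ I r]) (intro C1_on_sum C1_on_diff C1_on_mult C1_on_nth u1 u2 C1_on_vb C1_on_partial_vb finite)
  moreover have "smean (\<lambda>x. \<Sum>j\<in>UNIV. partial j (w j) x) r = smean (proj n (laplacian u)) r"
  proof (rule smean_cong[OF _ r0])
    fix x :: "real^3" assume "norm x = r"
    then have x: "norm x \<in> I" using r by simp
    have vd2: "partial j (vb n i) differentiable (at x)" for i j
      using C1_on_partial_vb[of UNIV] by (simp add: C1_on_def)
    have 1: "partial j (w j) x = (\<Sum>i\<in>UNIV. partial j (partial j u) x $ i * vb n i x - u x $ i * partial j (partial j (vb n i)) x)" for j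
    proof -
      have "partial j (w j) x = (\<Sum>i\<in>UNIV. partial j (\<lambda>x. partial j u x $ i * vb n i x - u x $ i * partial j (vb n i) x) x)"
        unfolding w_def[abs_def] by (rule partial_sum)
          (auto intro!: differentiable_diff differentiable_mult partial_nth ud[OF x] ud2[OF x] vd2)
      also have "\<dots> = (\<Sum>i\<in>UNIV. (partial j (partial j u) x $ i * vb n i x + partial j u x $ i * partial j (vb n i) x)
         - (partial j u x $ i * partial j (vb n i) x + u x $ i * partial j (partial j (vb n i)) x))"
      proof (rule sum.cong[OF refl])
        fix i :: 3
        show "partial j (\<lambda>x. partial j u x $ i * vb n i x - u x $ i * partial j (vb n i) x) x
          = (partial j (partial j u) x $ i * vb n i x + partial j u x $ i * partial j (vb n i) x)
         - (partial j u x $ i * partial j (vb n i) x + u x $ i * partial j (partial j (vb n i)) x)"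
          using partial_nth(1)[OF ud[OF x], of j i] partial_nth(2)[OF ud[OF x], of i] partial_nth(1)[OF ud2[OF x], of j j i] partial_nth(2)[OF ud2[OF x], of j i]
          by (simp add: partial_diff partial_mult differentiable_mult vd2)
      qed
      finally show ?thesis by (simp add: algebra_simps)
    qed
    have "(\<Sum>j\<in>UNIV. partial j (w j) x) = (\<Sum>i\<in>UNIV. (\<Sum>j\<in>UNIV. partial j (partial j u) x $ i) * vb n i x - u x $ i * (\<Sum>j\<in>UNIV. partial j (partial j (vb n i)) x))"
      unfolding 1 by (subst sum.swap) (simp add: sum_subtractf sum_distrib_left sum_distrib_right)
    also have "\<dots> = proj n (laplacian u) x"
      by (simp add: vb_harmonic proj_def laplacian_def)
    finally show "(\<Sum>j\<in>UNIV. partial j (w j) x) = proj n (laplacian u) x" .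
  qed
  moreover have "smean (\<lambda>x. \<Sum>j\<in>UNIV. cx j x * w j x) s = smean (radproj n u) s - of_nat n * smean (proj n u) s" if s: "s \<in> I" for s
  proof -
    have s0: "s > 0" using I s by auto
    have "smean (\<lambda>x. \<Sum>j\<in>UNIV. cx j x * w j x) s = smean (\<lambda>x. radproj n u x - of_nat n * proj n u x) s"
    proof (rule smean_cong[OF _ s0])
      fix x :: "real^3" assume "norm x = s"
      then have x: "norm x \<in> I" using s by simp
      have "(\<Sum>j\<in>UNIV. cx j x * w j x) = (\<Sum>j\<in>UNIV. \<Sum>i\<in>UNIV. cx j x * partial j (\<lambda>y. u y $ i) x * vb n i x - u x $ i * (cx j x * partial j (vb n i) x))"
        using partial_nth(1)[OF ud[OF x]] by (simp add: w_def sum_distrib_left algebra_simps)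
      also have "\<dots> = (\<Sum>i\<in>UNIV. \<Sum>j\<in>UNIV. cx j x * partial j (\<lambda>y. u y $ i) x * vb n i x - u x $ i * (cx j x * partial j (vb n i) x))"
        by (rule sum.swap)
      also have "\<dots> = (\<Sum>i\<in>UNIV. rad (\<lambda>y. u y $ i) x * vb n i x - u x $ i * rad (vb n i) x)"
        by (simp add: rad_def sum_subtractf sum_distrib_left sum_distrib_right)
      also have "\<dots> = radproj n u x - of_nat n * proj n u x"
        by (simp add: rad_vb[OF n] radproj_def proj_def sum_subtractf sum_distrib_left mult_ac)
      finally show "(\<Sum>j\<in>UNIV. cx j x * w j x) = radproj n u x - of_nat n * proj n u x" .
    qed
    also have "\<dots> = smean (radproj n u) s - smean (\<lambda>x. of_nat n * proj n u x) s"
      by (rule smean_diff[OF _ _ s s0]) (intro continuous_intros continuous_on_radproj continuous_on_proj C1_on_continuous u1)+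
    finally show ?thesis by (simp add: smean_cmult)
  qed
  ultimately show ?thesis
    using I(1) r by (auto elim!: has_vector_derivative_transform_within_open)
qed

text \<open>Solving the equation for the Laplacian leaves a multiple of \<open>u\<close> and a
  gradient, and the gradient averages to 0 against \<open>vb\<close>. Hence only the shear wave
  number appears.\<close>

lemma smean_proj_laplacian:
  assumes u: "lame_solution lam mu rho \<omega> (shell I) u" and mu: "mu > 0" and r: "r \<in> I"
  shows "smean (proj n (laplacian u)) r = - of_real (\<omega>^2 * rho / mu) * smean (proj n u) r"
proof -
  have r0: "r > 0" using I r by auto
  have C2: "C2_on (shell I) u" using u by (simp add: lame_solution_def)
  then have u1: "C1_on (shell I) u" and u2: "C1_on (shell I) (partial j u)" for j
    by (auto simp: C2_on_def)
  have dv: "C1_on (shell I) (divergence u)"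
    unfolding divergence_def[abs_def] by (intro C1_on_sum C1_on_nth u2 finite)
  have pt: "proj n (laplacian u) x = - of_real (\<omega>^2 * rho / mu) * proj n u x - of_real ((lam + mu) / mu) * (\<Sum>j\<in>UNIV. vb n j x * partial j (divergence u) x)"
    if "norm x = r" for x
  proof -
    have "lame lam mu u x + (\<omega>^2 * rho) *\<^sub>R u x = 0" using u r that by (simp add: lame_solution_def)
    then have "(lame lam mu u x + (\<omega>^2 * rho) *\<^sub>R u x) $ i = 0" for i by simp
    then have 1: "of_real mu * laplacian u x $ i = - of_real (lam + mu) * partial i (divergence u) x - of_real (\<omega>^2 * rho) * u x $ i" for i
      by (simp add: lame_def grad_def scaleR_conv_of_real[where 'a=complex] eq_neg_iff_add_eq_0 algebra_simps)
    have L: "laplacian u x $ i = - of_real ((lam + mu) / mu) * partial i (divergence u) x - of_real (\<omega>^2 * rho / mu) * u x $ i" for i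
    proof -
      have "laplacian u x $ i = (of_real mu * laplacian u x $ i) / of_real mu" using mu by simp
      also have "\<dots> = - of_real ((lam + mu) / mu) * partial i (divergence u) x - of_real (\<omega>^2 * rho / mu) * u x $ i"
        unfolding 1 using mu by (simp add: field_simps)
      finally show ?thesis .
    qed
    have "proj n (laplacian u) x = - a * proj n u x - b * (\<Sum>j\<in>UNIV. vb n j x * partial j (divergence u) x)"
      if "\<And>i. laplacian u x $ i = - b * partial i (divergence u) x - a * u x $ i" for a b
      unfolding proj_def that
      by (simp add: sum_distrib_left sum_subtractf sum_negf algebra_simps)
    from this[OF L] show ?thesis .
  qed
  have "smean (proj n (laplacian u)) r = smean (\<lambda>x. - of_real (\<omega>^2 * rho / mu) * proj n u x - of_real ((lam + mu) / mu) * (\<Sum>j\<in>UNIV. vb n j x * partial j (divergence u) x)) r"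
    by (rule smean_cong[OF pt r0])
  also have "\<dots> = smean (\<lambda>x. - of_real (\<omega>^2 * rho / mu) * proj n u x) r - smean (\<lambda>x. of_real ((lam + mu) / mu) * (\<Sum>j\<in>UNIV. vb n j x * partial j (divergence u) x)) r"
    by (rule smean_diff[OF _ _ r r0]) (intro continuous_intros continuous_on_proj C1_on_continuous[OF u1] C1_on_partial_continuous dv)+
  also have "smean (\<lambda>x. of_real ((lam + mu) / mu) * (\<Sum>j\<in>UNIV. vb n j x * partial j (divergence u) x)) r = 0"
    by (simp only: smean_cmult smean_tangential[OF dv I r] mult_zero_right)
  finally show ?thesis by (simp only: smean_cmult diff_0_right)
qed

text \<open>The integrand is \<open>vb\<close> paired with the gradient of x . u, minus
  \<open>vb\<close> paired with u, and the gradient averages to 0. It is the contribution of the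
  transposed gradient, which occurs both in the traction and in the curl.\<close>

lemma smean_tangential_transpose:
  assumes u: "C1_on (shell I) u" and r: "r \<in> I"
  shows "smean (\<lambda>x. \<Sum>i\<in>UNIV. \<Sum>j\<in>UNIV. vb n i x * cx j x * partial i u x $ j) r = - smean (proj n u) r"
proof -
  have r0: "r > 0" using I r by auto
  let ?X = "\<lambda>x. \<Sum>j\<in>UNIV. cx j x * u x $ j"
  have CX: "C1_on (shell I) ?X" by (intro C1_on_sum C1_on_mult C1_on_nth u C1_on_cx finite)
  have pt: "(\<Sum>i\<in>UNIV. \<Sum>j\<in>UNIV. vb n i x * cx j x * partial i u x $ j) = (\<Sum>i\<in>UNIV. vb n i x * partial i ?X x) - proj n u x"
    if "norm x = r" for x
  proof -
    have ud: "u differentiable (at x)" using u r that by (auto simp: C1_on_def)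
    have "partial i ?X x = (\<Sum>j\<in>UNIV. (if j = i then u x $ j else 0) + cx j x * partial i u x $ j)" for i
      using partial_nth[OF ud] by (auto simp: partial_sum partial_mult differentiable_mult intro!: sum.cong)
    then have pX: "partial i ?X x = u x $ i + (\<Sum>j\<in>UNIV. cx j x * partial i u x $ j)" for i
      by (simp add: sum.distrib)
    show ?thesis unfolding pX proj_def
      by (simp add: algebra_simps sum.distrib sum_distrib_left sum_subtractf)
  qed
  have "smean (\<lambda>x. \<Sum>i\<in>UNIV. \<Sum>j\<in>UNIV. vb n i x * cx j x * partial i u x $ j) r = smean (\<lambda>x. (\<Sum>i\<in>UNIV. vb n i x * partial i ?X x) - proj n u x) r"
    by (rule smean_cong[OF pt r0])
  also have "\<dots> = smean (\<lambda>x. \<Sum>i\<in>UNIV. vb n i x * partial i ?X x) r - smean (proj n u) r"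
    by (rule smean_diff[OF _ _ r r0]) (intro continuous_intros continuous_on_proj C1_on_continuous[OF u] C1_on_partial_continuous CX)+
  also have "smean (\<lambda>x. \<Sum>i\<in>UNIV. vb n i x * partial i ?X x) r = 0"
    by (rule smean_tangential[OF CX I r])
  finally show ?thesis by simp
qed

end

section \<open>Symmetry of second derivatives\<close>

lemma partial_line:
  fixes f :: "real^3 \<Rightarrow> complex"
  assumes "f differentiable (at (a + s *\<^sub>R axis j 1))"
  shows "((\<lambda>s. f (a + s *\<^sub>R axis j 1)) has_vector_derivative partial j f (a + s *\<^sub>R axis j 1)) (at s within T)"
proof -
  let ?y = "a + s *\<^sub>R axis j 1"
  have 1: "(f has_derivative (\<lambda>h. \<Sum>k\<in>UNIV. h$k *\<^sub>R partial k f ?y)) (at ?y)"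
    by (rule has_derivative_partial[OF assms])
  have 2: "((\<lambda>s. a + s *\<^sub>R axis j 1) has_derivative (\<lambda>h. h *\<^sub>R axis j 1)) (at s within T)"
    by (auto intro!: derivative_eq_intros)
  have "(\<Sum>k\<in>UNIV. (h *\<^sub>R axis j 1)$k *\<^sub>R partial k f ?y) = h *\<^sub>R partial j f ?y" for h :: real
  proof -
    have "(\<Sum>k\<in>UNIV. (h *\<^sub>R axis j 1)$k *\<^sub>R partial k f ?y) = (\<Sum>k\<in>UNIV. if k = j then h *\<^sub>R partial k f ?y else 0)"
      by (rule sum.cong) (auto simp: axis_def)
    then show ?thesis by simp
  qed
  with has_derivative_compose[OF 2 1] show ?thesis by (simp add: has_vector_derivative_def)
qed

lemma onorm_scaleR_le:
  fixes v :: "'a::real_normed_vector"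
  assumes "norm v \<le> e"
  shows "onorm (\<lambda>t::real. t *\<^sub>R v) \<le> e"
proof (rule onorm_bound)
  show "0 \<le> e" using assms norm_ge_zero order_trans by blast
  show "norm (t *\<^sub>R v) \<le> e * norm t" for t :: real
    using mult_left_mono[OF assms abs_ge_zero[of t]] by (simp add: mult.commute)
qed

lemma increment_bound:
  fixes f :: "real^3 \<Rightarrow> complex"
  assumes f: "\<And>y. y \<in> ball x d \<Longrightarrow> f differentiable (at y)"
    and b: "\<And>y. y \<in> ball x d \<Longrightarrow> norm (partial j f y - c) \<le> e"
    and seg: "\<And>s. 0 \<le> s \<Longrightarrow> s \<le> h \<Longrightarrow> a + s *\<^sub>R axis j 1 \<in> ball x d" and h: "h \<ge> 0"
  shows "norm (f (a + h *\<^sub>R axis j 1) - f a - h *\<^sub>R c) \<le> h * e"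
proof -
  let ?g = "\<lambda>s. f (a + s *\<^sub>R axis j 1) - s *\<^sub>R c"
  have "norm (?g h - ?g 0) \<le> e * norm (h - 0)"
  proof (rule differentiable_bound[where S="{0..h}" and f="?g" and f'="\<lambda>s t. t *\<^sub>R (partial j f (a + s *\<^sub>R axis j 1) - c)"])
    fix s assume s: "s \<in> {0..h}"
    have "((\<lambda>s. f (a + s *\<^sub>R axis j 1)) has_vector_derivative partial j f (a + s *\<^sub>R axis j 1)) (at s within {0..h})"
      by (rule partial_line[OF f[OF seg]]) (use s in auto)
    then have "(?g has_vector_derivative partial j f (a + s *\<^sub>R axis j 1) - 1 *\<^sub>R c) (at s within {0..h})"
      by (intro has_vector_derivative_diff bounded_linear.has_vector_derivative[OF bounded_linear_scaleR_left])
         (auto intro: has_vector_derivative_id)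
    then show "(?g has_derivative (\<lambda>t. t *\<^sub>R (partial j f (a + s *\<^sub>R axis j 1) - c))) (at s within {0..h})"
      by (simp add: has_vector_derivative_def)
    have "norm (partial j f (a + s *\<^sub>R axis j 1) - c) \<le> e"
      by (rule b[OF seg]) (use s in auto)
    then show "onorm (\<lambda>t. t *\<^sub>R (partial j f (a + s *\<^sub>R axis j 1) - c)) \<le> e"
      by (rule onorm_scaleR_le)
  qed (use h in auto)
  then show ?thesis using h by (simp add: algebra_simps)
qed

text \<open>The increment of \<open>partial i g\<close> in direction \<open>j\<close> is within
  \<open>h * e\<close> of \<open>h\<close> times \<open>c\<close> by \<open>increment_bound\<close>;
  the mean value inequality in direction \<open>i\<close> contributes the second factor
  \<open>h\<close>.\<close>

lemma mixed_increment:
  fixes g :: "real^3 \<Rightarrow> complex"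
  assumes g: "\<And>y. y \<in> ball x d \<Longrightarrow> g differentiable (at y)"
    and gi: "\<And>y. y \<in> ball x d \<Longrightarrow> partial i g differentiable (at y)"
    and b: "\<And>y. y \<in> ball x d \<Longrightarrow> norm (partial j (partial i g) y - c) \<le> e"
    and h: "0 \<le> h" "2 * h < d"
  shows "norm (g (x + h *\<^sub>R axis i 1 + h *\<^sub>R axis j 1) - g (x + h *\<^sub>R axis i 1) - g (x + h *\<^sub>R axis j 1) + g x - h^2 *\<^sub>R c) \<le> h^2 * e"
proof -
  have inb: "x + s *\<^sub>R axis i 1 + t *\<^sub>R axis j 1 \<in> ball x d" if "0 \<le> s" "s \<le> h" "0 \<le> t" "t \<le> h" for s t
  proof -
    have "norm (s *\<^sub>R axis i (1::real) + t *\<^sub>R axis j 1 :: real^3) \<le> s + t"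
      by (rule norm_triangle_le) (use that in \<open>simp add: norm_axis_1\<close>)
    moreover have "dist x (x + s *\<^sub>R axis i 1 + t *\<^sub>R axis j 1) = norm (s *\<^sub>R axis i (1::real) + t *\<^sub>R axis j 1 :: real^3)"
      by (simp add: dist_norm norm_minus_commute algebra_simps flip: norm_minus_cancel[of "- _ - _"])
    ultimately show ?thesis using that h by (simp del: dist_norm)
  qed
  let ?g = "\<lambda>s. g (x + s *\<^sub>R axis i 1 + h *\<^sub>R axis j 1) - g (x + s *\<^sub>R axis i 1) - s *\<^sub>R (h *\<^sub>R c)"
  let ?g' = "\<lambda>s. partial i g (x + s *\<^sub>R axis i 1 + h *\<^sub>R axis j 1) - partial i g (x + s *\<^sub>R axis i 1) - h *\<^sub>R c"
  have "norm (?g h - ?g 0) \<le> (h * e) * norm (h - 0)"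
  proof (rule differentiable_bound[where S="{0..h}" and f="?g" and f'="\<lambda>s t. t *\<^sub>R ?g' s"])
    fix s assume s: "s \<in> {0..h}"
    have 1: "((\<lambda>s. g (x + h *\<^sub>R axis j 1 + s *\<^sub>R axis i 1)) has_vector_derivative partial i g (x + h *\<^sub>R axis j 1 + s *\<^sub>R axis i 1)) (at s within {0..h})"
      by (rule partial_line[OF g]) (use inb[of s h] s h in \<open>simp add: add_ac\<close>)
    have 2: "((\<lambda>s. g (x + s *\<^sub>R axis i 1)) has_vector_derivative partial i g (x + s *\<^sub>R axis i 1)) (at s within {0..h})"
      by (rule partial_line[OF g]) (use inb[of s 0] s h in \<open>simp add: add_ac\<close>)
    have "(?g has_vector_derivative partial i g (x + s *\<^sub>R axis i 1 + h *\<^sub>R axis j 1) - partial i g (x + s *\<^sub>R axis i 1) - 1 *\<^sub>R (h *\<^sub>R c)) (at s within {0..h})"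
      using 1 2 by (intro has_vector_derivative_diff bounded_linear.has_vector_derivative[OF bounded_linear_scaleR_left])
         (auto intro: has_vector_derivative_id simp: add_ac)
    then show "(?g has_derivative (\<lambda>t. t *\<^sub>R ?g' s)) (at s within {0..h})"
      by (simp add: has_vector_derivative_def)
    have "norm (?g' s) \<le> h * e"
      by (rule increment_bound[where x=x and d=d]) (use inb s h gi b in auto)
    then show "onorm (\<lambda>t. t *\<^sub>R ?g' s) \<le> h * e"
      by (rule onorm_scaleR_le)
  qed (use h in auto)
  moreover have "?g h - ?g 0 = g (x + h *\<^sub>R axis i 1 + h *\<^sub>R axis j 1) - g (x + h *\<^sub>R axis i 1) - g (x + h *\<^sub>R axis j 1) + g x - h^2 *\<^sub>R c"
    by (simp add: power2_eq_square)
  ultimately have "norm (g (x + h *\<^sub>R axis i 1 + h *\<^sub>R axis j 1) - g (x + h *\<^sub>R axis i 1) - g (x + h *\<^sub>R axis j 1) + g x - h^2 *\<^sub>R c) \<le> (h * e) * norm (h - 0)"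
    by (simp only:)
  then show ?thesis using h by (simp add: power2_eq_square mult_ac)
qed

text \<open>The second difference is symmetric in the two directions and, divided by h^2,
  approximates either mixed derivative.\<close>

lemma partial_commute:
  fixes g :: "real^3 \<Rightarrow> complex"
  assumes S: "open S" "x \<in> S" and g: "C1_on S g" "\<And>k. C1_on S (partial k g)"
  shows "partial j (partial i g) x = partial i (partial j g) x"
proof -
  let ?a = "partial j (partial i g)" and ?b = "partial i (partial j g)"
  have "norm (?a x - ?b x) \<le> 0 + e" if e: "e > 0" for e :: real
  proof -
    have ca: "continuous_on S ?a" "continuous_on S ?b"
      using g(2) by (auto simp: C1_on_def)
    then have "isCont ?a x" "isCont ?b x"
      using S by (auto simp: continuous_on_eq_continuous_at)
    then obtain d1 d2 where d1: "d1 > 0" "\<And>y. dist y x < d1 \<Longrightarrow> dist (?a y) (?a x) < e/2"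
      and d2: "d2 > 0" "\<And>y. dist y x < d2 \<Longrightarrow> dist (?b y) (?b x) < e/2"
      unfolding continuous_at_eps_delta using half_gt_zero[OF e] by metis
    obtain d3 where d3: "d3 > 0" "ball x d3 \<subseteq> S" using S open_contains_ball by metis
    define d where "d = min d1 (min d2 d3)"
    have d: "d > 0" "ball x d \<subseteq> S" using d1 d2 d3 by (auto simp: d_def)
    \<comment> \<open>A third of the radius leaves room for two increments inside the ball.\<close>
    define h where "h = d / 3"
    have h: "h > 0" "2 * h < d" using d by (auto simp: h_def)
    let ?D = "g (x + h *\<^sub>R axis i 1 + h *\<^sub>R axis j 1) - g (x + h *\<^sub>R axis i 1) - g (x + h *\<^sub>R axis j 1) + g x"
    have 1: "norm (?D - h^2 *\<^sub>R ?a x) \<le> h^2 * (e/2)"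
    proof (rule mixed_increment[where d=d])
      fix y assume y: "y \<in> ball x d"
      show "g differentiable (at y)" "partial i g differentiable (at y)"
        using g y d by (auto simp: C1_on_def)
      have "dist y x < d1" using y by (simp add: d_def dist_commute)
      then show "norm (?a y - ?a x) \<le> e/2" using d1(2)[of y] by (simp add: dist_norm)
    qed (use h in auto)
    have "norm (g (x + h *\<^sub>R axis j 1 + h *\<^sub>R axis i 1) - g (x + h *\<^sub>R axis j 1) - g (x + h *\<^sub>R axis i 1) + g x - h^2 *\<^sub>R ?b x) \<le> h^2 * (e/2)"
    proof (rule mixed_increment[where d=d])
      fix y assume y: "y \<in> ball x d"
      show "g differentiable (at y)" "partial j g differentiable (at y)"
        using g y d by (auto simp: C1_on_def)
      have "dist y x < d2" using y by (simp add: d_def dist_commute)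
      then show "norm (?b y - ?b x) \<le> e/2" using d2(2)[of y] by (simp add: dist_norm)
    qed (use h in auto)
    then have 2: "norm (?D - h^2 *\<^sub>R ?b x) \<le> h^2 * (e/2)"
      by (simp add: algebra_simps)
    have "norm (h^2 *\<^sub>R (?a x - ?b x)) = norm ((?D - h^2 *\<^sub>R ?b x) - (?D - h^2 *\<^sub>R ?a x))"
      by (simp add: algebra_simps)
    also have "\<dots> \<le> h^2 * (e/2) + h^2 * (e/2)"
      by (rule order_trans[OF norm_triangle_ineq4 add_mono[OF 2 1]])
    finally have "h^2 * norm (?a x - ?b x) \<le> h^2 * e" by (simp add: mult.commute)
    then show ?thesis using h by simp
  qed
  then have "norm (?a x - ?b x) \<le> 0" by (rule field_le_epsilon)
  then show ?thesis by simp
qed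

text \<open>The radiation condition speaks of curl curl, the Lame equation of the Laplacian and grad
  div; this is the bridge.\<close>

lemma curl_curl:
  assumes S: "open S" "x \<in> S" and u: "C2_on S u"
  shows "curl (curl u) x $ i = partial i (divergence u) x - laplacian u x $ i"
proof -
  have u1: "C1_on S u" and u2: "C1_on S (partial j u)" for j using u by (auto simp: C2_on_def)
  have ud2: "partial j u differentiable (at x)" for j using u2[of j] S by (simp add: C1_on_def)
  \<comment> \<open>Symmetry is established for scalar functions and is transferred here to the
    components of \<open>u\<close>.\<close>
  have sw: "partial j (partial k u) x $ l = partial k (partial j u) x $ l" for j k l
  proof -
    have e: "partial k (\<lambda>x. u x $ l) y = partial k u y $ l" if "y \<in> S" for k y
      using u1 that by (intro partial_nth) (simp add: C1_on_def)
    have e2: "partial j (partial k (\<lambda>x. u x $ l)) x = partial j (partial k u) x $ l" for j k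
    proof -
      have "partial j (partial k (\<lambda>x. u x $ l)) x = partial j (\<lambda>x. partial k u x $ l) x"
        by (rule partial_cong[OF S e])
      also have "\<dots> = partial j (partial k u) x $ l" by (rule partial_nth[OF ud2])
      finally show ?thesis .
    qed
    have "C1_on S (partial k (\<lambda>x. u x $ l))" for k
      by (rule C1_on_cong[OF S(1) _ C1_on_nth[OF u2[of k], of l]]) (simp add: e)
    from partial_commute[OF S C1_on_nth[OF u1, of l] this] show ?thesis by (simp add: e2)
  qed
  have c: "(\<lambda>x. curl u x $ 1) = (\<lambda>x. partial 2 u x $ 3 - partial 3 u x $ 2)"
    "(\<lambda>x. curl u x $ 2) = (\<lambda>x. partial 3 u x $ 1 - partial 1 u x $ 3)"
    "(\<lambda>x. curl u x $ 3) = (\<lambda>x. partial 1 u x $ 2 - partial 2 u x $ 1)"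
    by (simp_all add: curl_def)
  have cdiff: "curl u differentiable (at x)"
  proof -
    have "(\<lambda>x. curl u x $ i) differentiable (at x)" for i
      using exhaust_3[of i] c partial_nth(2)[OF ud2] by (auto intro!: differentiable_diff)
    then have "\<forall>i. \<exists>D. ((\<lambda>x. curl u x $ i) has_derivative D) (at x)" by (auto simp: differentiable_def)
    then obtain D where D: "\<And>i. ((\<lambda>x. curl u x $ i) has_derivative D i) (at x)" by metis
    have "((\<lambda>x. \<chi> i. curl u x $ i) has_derivative (\<lambda>h. \<chi> i. D i h)) (at x)"
      by (subst has_derivative_componentwise_within)
         (use D in \<open>auto simp: Basis_vec_def inner_axis intro!: has_derivative_inner_left\<close>)
    then show ?thesis by (auto simp: differentiable_def)
  qed
  have pc: "partial j (curl u) x $ k = partial j (\<lambda>x. curl u x $ k) x" for j k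
    using partial_nth(1)[OF cdiff] by simp
  have pd: "partial j (\<lambda>x. partial k u x $ l - partial k' u x $ l') x = partial j (partial k u) x $ l - partial j (partial k' u) x $ l'"
    for j k l k' l'
    using partial_nth[OF ud2] by (simp add: partial_diff)
  have dv: "partial i (divergence u) x = (\<Sum>k\<in>UNIV. partial i (partial k u) x $ k)" for i
    unfolding divergence_def[abs_def] using partial_nth[OF ud2] by (simp add: partial_sum)
  show ?thesis
    using exhaust_3[of i]
    by (auto simp: curl_def[of "curl u"] pc c pd dv laplacian_def sum_3 sw[of 2 1] sw[of 3 1] sw[of 3 2])
qed

section \<open>Radiation, traction and gradient norm of the projected field\<close>

text \<open>The cross product of x and \<open>vb n\<close>. Since curl u . (x \<times> v) = (curl u
  \<times> x) . v, testing with it turns the curl in the radiation condition into first derivatives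
  of \<open>u\<close> paired with \<open>vb\<close>.\<close>

definition xvb :: "nat \<Rightarrow> real^3 \<Rightarrow> complex^3" where
  "xvb n x = vector [cx 2 x * vb n 3 x - cx 3 x * vb n 2 x,
                     cx 3 x * vb n 1 x - cx 1 x * vb n 3 x,
                     cx 1 x * vb n 2 x - cx 2 x * vb n 1 x]"

lemma norm_xvb:
  assumes "n \<ge> 1"
  shows "norm (xvb n x $ i) \<le> 2 * norm x ^ (n + 1)"
proof -
  have 1: "norm (cx j x * vb n k x) \<le> norm x ^ (n + 1)" for j k
    unfolding norm_mult using mult_mono[OF norm_cx[of j x] norm_vb[OF assms, of k x]] by simp
  have "norm (cx j x * vb n k x - cx j' x * vb n k' x) \<le> 2 * norm x ^ (n + 1)" for j k j' k'
    using norm_triangle_ineq4[of "cx j x * vb n k x" "cx j' x * vb n k' x"] 1[of j k] 1[of j' k'] by linarith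
  then show ?thesis using exhaust_3[of i] by (auto simp: xvb_def)
qed

definition rad_defect :: "real \<Rightarrow> (real^3 \<Rightarrow> complex^3) \<Rightarrow> real^3 \<Rightarrow> complex^3" where
  "rad_defect k u x = ccross (curl (curl u) x) (cvec (x /\<^sub>R norm x)) - (\<i> * of_real k) *s curl u x"

lemma smean_norm_rad_defect:
  assumes n: "n \<ge> 1" and r: "r > 0" and B: "\<And>x. norm x = r \<Longrightarrow> norm (rad_defect k u x) \<le> B"
  shows "norm (smean (\<lambda>x. \<Sum>i\<in>UNIV. rad_defect k u x $ i * xvb n x $ i) r) \<le> B * (6 * r ^ (n + 1)) * ann_vol"
proof (rule smean_norm_le[OF _ r])
  fix x :: "real^3" assume x: "norm x = r"
  have "norm (rad_defect k u x $ i * xvb n x $ i) \<le> B * (2 * r ^ (n + 1))" for i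
    unfolding norm_mult
  proof (rule mult_mono)
    show "norm (rad_defect k u x $ i) \<le> B"
      using B[OF x] Finite_Cartesian_Product.norm_nth_le[of "rad_defect k u x" i] by linarith
    show "0 \<le> B" using B[OF x] norm_ge_zero order_trans by blast
  qed (use norm_xvb[OF n, of x i] x in auto)
  then have "norm (\<Sum>i\<in>UNIV. rad_defect k u x $ i * xvb n x $ i) \<le> (\<Sum>i\<in>(UNIV :: 3 set). B * (2 * r ^ (n + 1)))"
    by (intro sum_norm_le) auto
  then show "norm (\<Sum>i\<in>UNIV. rad_defect k u x $ i * xvb n x $ i) \<le> B * (6 * r ^ (n + 1))" by simp
qed

text \<open>Testing the first radiation condition with \<open>x \<times> vb n\<close> isolates the toroidal mode.\<close>

lemma smean_rad_defect:
  assumes I: "open I" "I \<subseteq> {0<..}" and n: "n \<ge> 1"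
    and u: "lame_solution lam mu rho \<omega> (shell I) u" and mu: "mu > 0" and r: "r \<in> I"
  shows "smean (\<lambda>x. \<Sum>i\<in>UNIV. rad_defect k u x $ i * xvb n x $ i) r
     = - of_real (r * (\<omega>^2 * rho / mu)) * smean (proj n u) r
       - \<i> * of_real k * (smean (radproj n u) r + smean (proj n u) r)"
proof -
  have r0: "r > 0" using I r by auto
  have C2: "C2_on (shell I) u" using u by (simp add: lame_solution_def)
  then have u1: "C1_on (shell I) u" and u2: "C1_on (shell I) (partial j u)" for j
    by (auto simp: C2_on_def)
  have dv: "C1_on (shell I) (divergence u)"
    unfolding divergence_def[abs_def] by (intro C1_on_sum C1_on_nth u2 finite)
  let ?T = "\<lambda>x. \<Sum>i\<in>UNIV. \<Sum>j\<in>UNIV. vb n i x * cx j x * partial i u x $ j"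
  let ?V = "\<lambda>x. \<Sum>j\<in>UNIV. vb n j x * partial j (divergence u) x"
  have pt: "(\<Sum>i\<in>UNIV. rad_defect k u x $ i * xvb n x $ i)
     = of_real r * proj n (laplacian u) x - of_real r * ?V x - \<i> * of_real k * (radproj n u x - ?T x)"
    if x: "norm x = r" for x
  proof -
    have xS: "x \<in> shell I" using x r by simp
    have ud: "u differentiable (at x)" using u1 xS by (auto simp: C1_on_def)
    have cv: "cvec (x /\<^sub>R norm x) $ i = cx i x / of_real r" for i
      using r0 x by (simp add: cvec_def cx_def field_simps)
    have "r^2 = x$1 * x$1 + x$2 * x$2 + x$3 * x$3"
      using x by (auto simp: power2_norm_eq_inner inner_vec_def sum_3)
    then have xx: "cx 1 x * cx 1 x + cx 2 x * cx 2 x + cx 3 x * cx 3 x = of_real r * of_real r"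
      by (simp add: cx_def power2_eq_square flip: of_real_mult of_real_add)
    have xv: "cx 1 x * vb n 1 x + cx 2 x * vb n 2 x + cx 3 x * vb n 3 x = 0"
      using x_vb[of x n] by (simp add: sum_3)
    \<comment> \<open>Lagrange's identity for (a \<times> x) . (x \<times> v), in which the term
      with x . v vanishes because \<open>vb\<close> is tangential.\<close>
    have A: "(\<Sum>i\<in>UNIV. ccross a (cvec (x /\<^sub>R norm x)) $ i * xvb n x $ i) = - of_real r * (\<Sum>i\<in>UNIV. a $ i * vb n i x)" for a
    proof -
      have "of_real r * (\<Sum>i\<in>UNIV. ccross a (cvec (x /\<^sub>R norm x)) $ i * xvb n x $ i)
        = (a$1 * cx 1 x + a$2 * cx 2 x + a$3 * cx 3 x) * (cx 1 x * vb n 1 x + cx 2 x * vb n 2 x + cx 3 x * vb n 3 x)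
          - (cx 1 x * cx 1 x + cx 2 x * cx 2 x + cx 3 x * cx 3 x) * (\<Sum>i\<in>UNIV. a $ i * vb n i x)"
        using r0 by (simp add: ccross_def cv xvb_def sum_3 algebra_simps)
      also have "\<dots> = - (of_real r * of_real r) * (\<Sum>i\<in>UNIV. a $ i * vb n i x)" by (simp add: xv xx)
      finally have eq: "of_real r * (\<Sum>i\<in>UNIV. ccross a (cvec (x /\<^sub>R norm x)) $ i * xvb n x $ i)
        = of_real r * (- of_real r * (\<Sum>i\<in>UNIV. a $ i * vb n i x))" by (simp only: mult.assoc mult_minus_left mult_minus_right)
      show ?thesis by (rule mult_left_cancel[THEN iffD1, OF _ eq]) (use r0 in simp)
    qed
    \<comment> \<open>(curl u \<times> x) is the radial derivative x . grad u minus the contraction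
      of x with the transposed gradient.\<close>
    have B: "(\<Sum>i\<in>UNIV. curl u x $ i * xvb n x $ i) = radproj n u x - ?T x"
      unfolding radproj_def rad_def partial_nth(1)[OF ud]
      by (simp add: curl_def xvb_def sum_3 algebra_simps)
    have "(\<Sum>i\<in>UNIV. rad_defect k u x $ i * xvb n x $ i)
      = (\<Sum>i\<in>UNIV. ccross (curl (curl u) x) (cvec (x /\<^sub>R norm x)) $ i * xvb n x $ i)
        - \<i> * of_real k * (\<Sum>i\<in>UNIV. curl u x $ i * xvb n x $ i)"
      by (simp add: rad_defect_def left_diff_distrib sum_subtractf sum_distrib_left mult.assoc)
    also have "(\<Sum>i\<in>UNIV. ccross (curl (curl u) x) (cvec (x /\<^sub>R norm x)) $ i * xvb n x $ i)
      = of_real r * proj n (laplacian u) x - of_real r * ?V x"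
      unfolding A proj_def curl_curl[OF open_shell[OF I(1)] xS C2]
      by (simp add: sum_3 algebra_simps)
    finally show ?thesis unfolding B .
  qed
  have c1: "continuous_on (shell I) (proj n (laplacian u))"
  proof (rule continuous_on_proj)
    have "continuous_on (shell I) (partial j (partial j u))" for j
      using u2[of j] by (simp add: C1_on_def)
    then show "continuous_on (shell I) (laplacian u)"
      unfolding laplacian_def[abs_def] by (intro continuous_on_sum)
  qed
  have c2: "continuous_on (shell I) ?V"
    by (intro continuous_intros C1_on_partial_continuous dv)
  have c3: "continuous_on (shell I) (radproj n u)" by (rule continuous_on_radproj[OF u1])
  have c4: "continuous_on (shell I) ?T"
    by (intro continuous_intros C1_on_partial_continuous u1)
  have "smean (\<lambda>x. \<Sum>i\<in>UNIV. rad_defect k u x $ i * xvb n x $ i) r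
     = smean (\<lambda>x. of_real r * proj n (laplacian u) x - of_real r * ?V x - \<i> * of_real k * (radproj n u x - ?T x)) r"
    by (rule smean_cong[OF pt r0])
  also have "\<dots> = smean (\<lambda>x. of_real r * proj n (laplacian u) x - of_real r * ?V x) r - smean (\<lambda>x. \<i> * of_real k * (radproj n u x - ?T x)) r"
    by (rule smean_diff[OF _ _ r r0]) (intro continuous_intros c1 c2 c3 c4)+
  also have "smean (\<lambda>x. of_real r * proj n (laplacian u) x - of_real r * ?V x) r = smean (\<lambda>x. of_real r * proj n (laplacian u) x) r - smean (\<lambda>x. of_real r * ?V x) r"
    by (rule smean_diff[OF _ _ r r0]) (intro continuous_intros c1 c2)+
  also have "smean (\<lambda>x. \<i> * of_real k * (radproj n u x - ?T x)) r = \<i> * of_real k * (smean (radproj n u) r - smean ?T r)"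
    unfolding smean_cmult by (subst smean_diff[OF c3 c4 r r0]) (rule refl)
  finally show ?thesis
    unfolding smean_cmult smean_tangential[OF dv I r] smean_proj_laplacian[OF I n u mu r]
      smean_tangential_transpose[OF I n u1 r]
    by (simp add: algebra_simps)
qed

text \<open>On the unit sphere, where x is the normal, this is the projected traction divided by the
  shear modulus. Using x at every radius extends it continuously into both media, so that the
  interface values are limits of averages.\<close>

definition tracproj :: "nat \<Rightarrow> (real^3 \<Rightarrow> complex^3^3) \<Rightarrow> real^3 \<Rightarrow> complex" where
  "tracproj n A x = (\<Sum>i\<in>UNIV. \<Sum>j\<in>UNIV. (A x $ i $ j + A x $ j $ i) * cx j x * vb n i x)"

lemma smean_tracproj:
  assumes I: "open I" "I \<subseteq> {0<..}" and n: "n \<ge> 1" and u1: "C1_on (shell I) u" and r: "r \<in> I"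
  shows "smean (tracproj n (gradv u)) r = smean (radproj n u) r - smean (proj n u) r"
proof -
  have r0: "r > 0" using I r by auto
  let ?T = "\<lambda>x. \<Sum>i\<in>UNIV. \<Sum>j\<in>UNIV. vb n i x * cx j x * partial i u x $ j"
  have pt: "tracproj n (gradv u) x = radproj n u x + ?T x" if "norm x = r" for x
  proof -
    have ud: "u differentiable (at x)" using u1 r that by (auto simp: C1_on_def)
    show ?thesis
      unfolding tracproj_def radproj_def rad_def partial_nth(1)[OF ud] gradv_def
      by (simp add: sum_3 algebra_simps)
  qed
  have "smean (tracproj n (gradv u)) r = smean (\<lambda>x. radproj n u x + ?T x) r"
    by (rule smean_cong[OF pt r0])
  also have "\<dots> = smean (radproj n u) r + smean ?T r"
    by (rule smean_add[OF _ _ r r0])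
       (intro continuous_on_radproj u1, intro continuous_intros C1_on_partial_continuous u1)
  finally show ?thesis by (simp add: smean_tangential_transpose[OF I n u1 r])
qed

text \<open>The term with \<open>lam\<close> is normal to the sphere and disappears against the
  tangential \<open>vb\<close>.\<close>

lemma tracproj_traction:
  "(\<Sum>i\<in>UNIV. traction lam mu A x $ i * vb n i x) = of_real mu * tracproj n (\<lambda>_. A) x"
proof -
  have "(\<Sum>i\<in>UNIV. traction lam mu A x $ i * vb n i x)
    = of_real lam * trace A * (\<Sum>i\<in>UNIV. cx i x * vb n i x)
      + of_real mu * (\<Sum>i\<in>UNIV. (\<Sum>j\<in>UNIV. (A $ i $ j + A $ j $ i) * cx j x) * vb n i x)"
    by (simp add: traction_def cvec_def cx_def[symmetric] matrix_vector_mult_def transpose_def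
        scaleR_conv_of_real[where 'a=complex] sum_3 algebra_simps)
  then show ?thesis by (simp add: x_vb tracproj_def sum_distrib_right)
qed

text \<open>The interface conditions supply pointwise limits only. Dominated convergence along
  sequences of radii turns them into a limit of averages; the limit function \<open>L\<close>
  inherits measurability from the sequence.\<close>

lemma smean_tendsto:
  fixes F L :: "real^3 \<Rightarrow> complex"
  assumes I: "I \<subseteq> {0<..}" and F: "continuous_on (shell I) F"
    and B: "\<And>x. norm x \<in> I \<Longrightarrow> norm (F x) \<le> B"
    and lim: "\<And>x. norm x = 1 \<Longrightarrow> (F \<longlongrightarrow> L x) (at x within shell I)"
  shows "(smean F \<longlongrightarrow> smean L 1) (at 1 within I)"
  unfolding tendsto_at_iff_sequentially
proof (intro allI impI)
  fix X :: "nat \<Rightarrow> real" assume X: "\<forall>i. X i \<in> I - {1}" "X \<longlonglongrightarrow> 1"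
  have S: "ann \<in> sets borel" by (simp add: compact_ann compact_imp_closed)
  let ?s = "\<lambda>i x. indicator ann x *\<^sub>R F (X i *\<^sub>R sgn x)"
  let ?f = "\<lambda>x. indicator ann x *\<^sub>R L (1 *\<^sub>R sgn x)"
  have ms: "?s i \<in> borel_measurable lborel" for i
    unfolding measurable_lborel1 measurable_lborel2
    by (rule borel_measurable_continuous_on_indicator[OF S continuous_on_smean_integrand[OF F]]) (use X I in auto)
  have pl: "(\<lambda>i. ?s i x) \<longlonglongrightarrow> ?f x" for x
  proof (cases "x \<in> ann")
    case True
    have n1: "norm (sgn x) = 1" by (rule norm_sgn_ann[OF True])
    have "(\<lambda>i. X i *\<^sub>R sgn x) \<longlonglongrightarrow> 1 *\<^sub>R sgn x" by (intro tendsto_intros X)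
    moreover have "X i *\<^sub>R sgn x \<in> shell I - {sgn x}" for i
    proof -
      have "X i \<in> I" "X i > 0" "X i \<noteq> 1" using X I by auto
      moreover have "X i *\<^sub>R sgn x \<noteq> sgn x"
      proof
        assume "X i *\<^sub>R sgn x = sgn x"
        then have "norm (X i *\<^sub>R sgn x) = norm (sgn x)" by simp
        then show False using n1 \<open>X i > 0\<close> \<open>X i \<noteq> 1\<close> by simp
      qed
      ultimately show ?thesis using n1 by simp
    qed
    ultimately have "(F \<circ> (\<lambda>i. X i *\<^sub>R sgn x)) \<longlonglongrightarrow> L (sgn x)"
      using lim[OF n1] unfolding tendsto_at_iff_sequentially by simp
    then show ?thesis using True by (simp add: o_def)
  qed simp
  have mf: "?f \<in> borel_measurable lborel"
    by (rule borel_measurable_LIMSEQ_metric[OF ms pl])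
  have "(\<lambda>i. integral\<^sup>L lborel (?s i)) \<longlonglongrightarrow> integral\<^sup>L lborel ?f"
  proof (rule integral_dominated_convergence[where w="\<lambda>x. indicator ann x *\<^sub>R B"])
    show "integrable lborel (\<lambda>x. indicat_real ann x *\<^sub>R B)"
      using integrable_ann[of "\<lambda>_. B"] by (simp add: set_integrable_def)
    show "AE x in lborel. norm (?s i x) \<le> indicat_real ann x *\<^sub>R B" for i
    proof (rule AE_I2)
      fix x :: "real^3"
      have "X i \<in> I" "X i > 0" using X I by auto
      then show "norm (?s i x) \<le> indicat_real ann x *\<^sub>R B"
        using B[of "X i *\<^sub>R sgn x"] by (auto simp: indicator_def norm_sgn_ann)
    qed
  qed (use ms mf pl in auto)
  then show "(smean F \<circ> X) \<longlonglongrightarrow> smean L 1"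
    by (simp add: smean_def set_lebesgue_integral_def o_def)
qed

text \<open>A limit bounds the function near each point, and compactness makes the bound global. It
  provides the dominating constant for fields whose boundary limits are merely known to
  exist.\<close>

lemma bounded_image_limits:
  fixes F :: "'a::metric_space \<Rightarrow> 'b::real_normed_vector"
  assumes K: "compact K" "S \<subseteq> K" and lim: "\<And>x. x \<in> K \<Longrightarrow> \<exists>l. (F \<longlongrightarrow> l) (at x within S)"
  shows "bounded (F ` S)"
proof -
  have "\<forall>x\<in>K. \<exists>d B. d > 0 \<and> (\<forall>y\<in>S \<inter> ball x d. norm (F y) \<le> B)"
  proof
    fix x assume "x \<in> K"
    then obtain l where "(F \<longlongrightarrow> l) (at x within S)" using lim by blast
    then have "eventually (\<lambda>y. dist (F y) l < 1) (at x within S)" using zero_less_one by (rule tendstoD)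
    then obtain d where d: "d > 0" "\<And>y. y \<in> S \<Longrightarrow> y \<noteq> x \<Longrightarrow> dist y x < d \<Longrightarrow> dist (F y) l < 1"
      unfolding eventually_at by blast
    \<comment> \<open>The limit says nothing about the value at \<open>x\<close> itself, hence the
      maximum.\<close>
    have "norm (F y) \<le> max (norm l + 1) (norm (F x))" if y: "y \<in> S \<inter> ball x d" for y
    proof (cases "y = x")
      case False
      then have "dist (F y) l < 1" using d(2)[of y] y by (auto simp: dist_commute)
      then have "norm (F y) \<le> norm l + 1"
        using norm_triangle_sub[of "F y" l] by (simp add: dist_norm)
      then show ?thesis by simp
    qed simp
    then show "\<exists>d B. d > 0 \<and> (\<forall>y\<in>S \<inter> ball x d. norm (F y) \<le> B)" using d(1) by blast
  qed
  then obtain d B where dB: "\<And>x. x \<in> K \<Longrightarrow> d x > 0" "\<And>x y. x \<in> K \<Longrightarrow> y \<in> S \<inter> ball x (d x) \<Longrightarrow> norm (F y) \<le> B x"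
    by metis
  have "K \<subseteq> (\<Union>x\<in>K. ball x (d x))" using dB(1) by auto
  then obtain C where C: "C \<subseteq> K" "finite C" "K \<subseteq> (\<Union>x\<in>C. ball x (d x))"
    using compactE_image[OF K(1), of K "\<lambda>x. ball x (d x)"] by auto
  have "norm z \<le> (\<Sum>x\<in>C. \<bar>B x\<bar>)" if z: "z \<in> F ` S" for z
  proof -
    obtain y where y: "y \<in> S" "z = F y" using z by auto
    then obtain x where x: "x \<in> C" "y \<in> ball x (d x)" using C K by blast
    then have "norm (F y) \<le> B x" using dB(2)[of x y] C y by blast
    also have "\<dots> \<le> \<bar>B x\<bar>" by simp
    also have "\<dots> \<le> (\<Sum>x\<in>C. \<bar>B x\<bar>)" using C x by (intro member_le_sum) auto
    finally show ?thesis using y by simp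
  qed
  then show ?thesis by (auto simp: bounded_iff)
qed

section \<open>Mass of the mode and the Cauchy-Schwarz inequality\<close>

definition vb_sq :: "nat \<Rightarrow> real^3 \<Rightarrow> real" where
  "vb_sq n x = (\<Sum>i\<in>UNIV. (norm (vb n i x))^2)"

definition vb_mass :: "nat \<Rightarrow> real" where
  "vb_mass n = smean (vb_sq n) 1"

lemma vb_sq_scale:
  assumes "n \<ge> 1" "r \<ge> 0"
  shows "vb_sq n (r *\<^sub>R x) = r^(2*n) * vb_sq n x"
  using assms by (simp add: vb_sq_def vb_scale norm_mult norm_power power_mult_distrib sum_distrib_left power_mult[symmetric] mult.commute)

lemma smean_vb_sq:
  assumes "n \<ge> 1" "r \<ge> 0"
  shows "smean (vb_sq n) r = r^(2*n) * vb_mass n"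
  unfolding vb_mass_def smean_def using assms by (simp add: vb_sq_scale)

lemma continuous_on_vb_sq: "continuous_on S (vb_sq n)"
  unfolding vb_sq_def[abs_def] by (intro continuous_intros)

text \<open>With zero mass the third component, which is - \<open>zb\<close> to the power n for
  positive n, would vanish almost everywhere on the annulus, and with it the first coordinate; but
  the points with nonzero first coordinate contain a nonempty open set.\<close>

lemma vb_mass_pos:
  shows "vb_mass n > 0"
proof -
  have int: "set_integrable lborel ann (\<lambda>x. vb_sq n (1 *\<^sub>R sgn x))"
    by (rule smean_integrable[where I=UNIV]) (auto intro: continuous_on_vb_sq)
  have nn: "vb_sq n x \<ge> 0" for x by (simp add: vb_sq_def sum_nonneg)
  have "vb_mass n \<ge> 0"
    unfolding vb_mass_def smean_def set_lebesgue_integral_def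
    by (intro integral_nonneg_AE AE_I2) (simp add: nn)
  moreover have "vb_mass n \<noteq> 0"
  proof
    assume "vb_mass n = 0"
    then have "AE x in lborel. indicator ann x *\<^sub>R vb_sq n (1 *\<^sub>R sgn x) = (0::real)"
      unfolding vb_mass_def smean_def set_lebesgue_integral_def
      by (subst (asm) integral_nonneg_eq_0_iff_AE) (use int nn in \<open>auto simp: set_integrable_def\<close>)
    then have ae: "AE x in lborel. \<not> (x \<in> ann \<and> x$1 \<noteq> 0)"
    proof (rule AE_mp[OF _ AE_I2], intro impI notI)
      fix x assume 0: "indicator ann x *\<^sub>R vb_sq n (1 *\<^sub>R sgn x) = (0::real)" and x: "x \<in> ann \<and> x$1 \<noteq> 0"
      then have "vb_sq n (sgn x) = 0" by simp
      then have "vb n 3 (sgn x) = 0" by (simp add: vb_sq_def sum_nonneg_eq_0_iff)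
      then have "zb (sgn x) = 0" by (auto simp: vb_def vlin_def)
      then have "Re (zb (sgn x)) = 0" by simp
      then have "sgn x $ 1 = 0" by (simp add: zb_def cx_def)
      then have "x $ 1 = 0" using x ann_nz by (auto simp: sgn_div_norm)
      then show False using x by simp
    qed
    let ?U = "shell {1<..<2} \<inter> {x. x$1 \<noteq> 0}"
    have oU: "open ?U"
      by (intro open_Int open_shell open_Collect_neq continuous_intros)
    have "AE x in lborel. x \<notin> ?U" using ae by (rule AE_mp) (auto simp: ann_def)
    then have "?U \<in> null_sets lborel"
      using AE_iff_null_sets[of ?U lborel] oU by (simp add: borel_open)
    then have "negligible ?U" by (simp add: negligible_iff_null_sets null_sets_completionI)
    moreover have "(3/2) *\<^sub>R axis 1 1 \<in> ?U" by (simp add: norm_axis_1)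
    ultimately show False using open_not_negligible[OF oU] by blast
  qed
  ultimately show ?thesis by simp
qed

lemma smean_mono:
  fixes F G :: "real^3 \<Rightarrow> real"
  assumes "continuous_on (shell I) F" "continuous_on (shell I) G" "r \<in> I" "r > 0"
    and "\<And>x. norm x = r \<Longrightarrow> F x \<le> G x"
  shows "smean F r \<le> smean G r"
  unfolding smean_def
  by (rule set_integral_mono) (use assms in \<open>auto intro: smean_integrable simp: norm_sgn_ann\<close>)

lemma smean_of_real:
  fixes F :: "real^3 \<Rightarrow> real"
  shows "smean (\<lambda>x. complex_of_real (F x)) r = of_real (smean F r)"
proof -
  have "(LINT x:ann|lborel. complex_of_real (F (r *\<^sub>R sgn x))) = of_real (LINT x:ann|lborel. F (r *\<^sub>R sgn x))"
    by (rule set_integral_complex_of_real)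
  then show ?thesis by (simp add: smean_def)
qed

lemma smean_cnj: "smean (\<lambda>x. cnj (F x)) r = cnj (smean F r)"
proof -
  have "(LINT x|lborel. indicator ann x *\<^sub>R cnj (F (r *\<^sub>R sgn x))) = (LINT x|lborel. cnj (indicator ann x *\<^sub>R F (r *\<^sub>R sgn x)))"
    by (rule Bochner_Integration.integral_cong) (auto simp: indicator_def)
  then show ?thesis unfolding smean_def set_lebesgue_integral_def by (simp only: Bochner_Integration.integral_cnj)
qed

lemma smean_cauchy_schwarz:
  fixes g :: "3 \<Rightarrow> real^3 \<Rightarrow> complex"
  assumes n: "n \<ge> 1" and g: "\<And>i. continuous_on (shell I) (g i)" and r: "r \<in> I" "r > 0"
  shows "(norm (smean (\<lambda>x. \<Sum>i\<in>UNIV. g i x * vb n i x) r))^2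
     \<le> smean (\<lambda>x. \<Sum>i\<in>UNIV. (norm (g i x))^2) r * (r^(2*n) * vb_mass n)"
proof -
  let ?S = "smean (\<lambda>x. \<Sum>i\<in>UNIV. g i x * vb n i x) r"
  let ?G = "smean (\<lambda>x. \<Sum>i\<in>UNIV. (norm (g i x))^2) r"
  define N where "N = r^(2*n) * vb_mass n"
  have N: "N > 0" using r vb_mass_pos by (simp add: N_def)
  \<comment> \<open>The coefficient of the orthogonal projection onto the mode. Expanding the
    nonnegative average of |g - c cnj vb|^2 with this choice is the inequality.\<close>
  define c where "c = ?S / of_real N"
  let ?q = "\<lambda>x. \<Sum>i\<in>UNIV. (norm (g i x - c * cnj (vb n i x)))^2"
  let ?p = "\<lambda>x. \<Sum>i\<in>UNIV. g i x * vb n i x"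
  have cv: "continuous_on (shell I) (\<lambda>x. cnj (vb n i x))" for i by (intro continuous_intros)
  have "0 \<le> smean ?q r"
    unfolding smean_def set_lebesgue_integral_def
    by (intro integral_nonneg_AE AE_I2) (simp add: sum_nonneg)
  then have 0: "0 \<le> Re (of_real (smean ?q r))" by simp
  have "of_real (smean ?q r) = smean (\<lambda>x. complex_of_real (?q x)) r"
    by (rule smean_of_real[symmetric])
  also have "\<dots> = smean (\<lambda>x. (of_real (\<Sum>i\<in>UNIV. (norm (g i x))^2) - cnj c * ?p x - c * cnj (?p x)) + of_real ((norm c)^2) * of_real (vb_sq n x)) r"
  proof (rule smean_cong[OF _ r(2)])
    fix x :: "real^3"
    have "complex_of_real (?q x) = (\<Sum>i\<in>UNIV. (g i x - c * cnj (vb n i x)) * cnj (g i x - c * cnj (vb n i x)))"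
      by (simp only: of_real_sum complex_norm_square)
    also have "\<dots> = (\<Sum>i\<in>UNIV. g i x * cnj (g i x)) - cnj c * ?p x - c * cnj (?p x) + c * cnj c * (\<Sum>i\<in>UNIV. vb n i x * cnj (vb n i x))"
      by (simp add: sum_3 algebra_simps)
    finally show "complex_of_real (?q x) = (of_real (\<Sum>i\<in>UNIV. (norm (g i x))^2) - cnj c * ?p x - c * cnj (?p x)) + of_real ((norm c)^2) * of_real (vb_sq n x)"
      by (simp only: of_real_sum complex_norm_square vb_sq_def)
  qed
  also have "\<dots> = smean (\<lambda>x. of_real (\<Sum>i\<in>UNIV. (norm (g i x))^2) - cnj c * ?p x - c * cnj (?p x)) r + smean (\<lambda>x. of_real ((norm c)^2) * of_real (vb_sq n x)) r"
    by (rule smean_add[OF _ _ r]) (intro continuous_intros g cv continuous_on_vb_sq)+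
  also have "smean (\<lambda>x. of_real (\<Sum>i\<in>UNIV. (norm (g i x))^2) - cnj c * ?p x - c * cnj (?p x)) r
    = smean (\<lambda>x. of_real (\<Sum>i\<in>UNIV. (norm (g i x))^2) - cnj c * ?p x) r - smean (\<lambda>x. c * cnj (?p x)) r"
    by (rule smean_diff[OF _ _ r]) (intro continuous_intros g cv)+
  also have "smean (\<lambda>x. of_real (\<Sum>i\<in>UNIV. (norm (g i x))^2) - cnj c * ?p x) r = smean (\<lambda>x. of_real (\<Sum>i\<in>UNIV. (norm (g i x))^2)) r - smean (\<lambda>x. cnj c * ?p x) r"
    by (rule smean_diff[OF _ _ r]) (intro continuous_intros g cv)+
  also have "smean (\<lambda>x. c * cnj (?p x)) r = c * cnj ?S"
    unfolding smean_cmult smean_cnj ..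
  also have "smean (\<lambda>x. complex_of_real (\<Sum>i\<in>UNIV. (norm (g i x))^2)) r = of_real ?G" by (rule smean_of_real)
  also have "smean (\<lambda>x. cnj c * ?p x) r = cnj c * ?S" by (rule smean_cmult)
  also have "smean (\<lambda>x. of_real ((norm c)^2) * complex_of_real (vb_sq n x)) r = of_real ((norm c)^2 * N)"
    unfolding smean_cmult smean_of_real using smean_vb_sq[OF n, of r] r by (simp add: N_def)
  finally have "of_real (smean ?q r) = of_real ?G - cnj c * ?S - c * cnj ?S + of_real ((norm c)^2 * N)" .
  with 0 have "0 \<le> Re (of_real ?G - cnj c * ?S - c * cnj ?S + of_real ((norm c)^2 * N))" by (simp only:)
  also have "cnj c * ?S = of_real ((norm ?S)^2 / N)"
    unfolding of_real_divide complex_norm_square by (simp add: c_def mult.commute)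
  also have "c * cnj ?S = of_real ((norm ?S)^2 / N)"
    unfolding of_real_divide complex_norm_square by (simp add: c_def)
  also have "(norm c)^2 * N = (norm ?S)^2 / N" using N
    by (simp add: c_def norm_divide power_divide power2_eq_square)
  finally have "(norm ?S)^2 / N \<le> ?G" by simp
  then show ?thesis unfolding N_def[symmetric] using N by (simp add: pos_divide_le_eq)
qed

text \<open>Keeping only the radial derivative costs a factor of about \<open>\<surd>2\<close> in the gradient norm, which the constants
  of the theorem allow.\<close>

lemma smean_gradv_lower:
  assumes n: "n \<ge> 1" and u: "C1_on (shell I) u" and r: "r \<in> I" "r > 0"
  shows "(norm (smean (radproj n u) r))^2 \<le> r^2 * smean (\<lambda>x. (norm (gradv u x))^2) r * (r^(2*n) * vb_mass n)"
proof -
  have cr: "continuous_on (shell I) (rad (\<lambda>y. u y $ i))" for i by (intro continuous_on_rad C1_on_nth u)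
  have cg: "continuous_on (shell I) (gradv u)"
    unfolding gradv_def[abs_def] by (intro continuous_intros C1_on_partial_continuous u)
  have "(norm (smean (radproj n u) r))^2 \<le> smean (\<lambda>x. \<Sum>i\<in>UNIV. (norm (rad (\<lambda>y. u y $ i) x))^2) r * (r^(2*n) * vb_mass n)"
    using smean_cauchy_schwarz[OF n cr r] by (simp add: radproj_def[abs_def])
  also have "\<dots> \<le> (r^2 * smean (\<lambda>x. (norm (gradv u x))^2) r) * (r^(2*n) * vb_mass n)"
  proof (rule mult_right_mono)
    have "smean (\<lambda>x. \<Sum>i\<in>UNIV. (norm (rad (\<lambda>y. u y $ i) x))^2) r \<le> smean (\<lambda>x. r^2 * (norm (gradv u x))^2) r"
    proof (rule smean_mono[OF _ _ r])
      fix x :: "real^3" assume x: "norm x = r"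
      have ud: "u differentiable (at x)" using u r x by (auto simp: C1_on_def)
      have g: "(norm (gradv u x))^2 = (\<Sum>i\<in>UNIV. \<Sum>j\<in>UNIV. (norm (partial j u x $ i))^2)"
        by (simp add: norm_vec_def L2_set_def sum_nonneg gradv_def)
      have r2: "r^2 = (\<Sum>j\<in>UNIV. (x$j)^2)"
        unfolding x[symmetric] by (simp add: norm_vec_def L2_set_def sum_nonneg)
      have "(norm (rad (\<lambda>y. u y $ i) x))^2 \<le> r^2 * (\<Sum>j\<in>UNIV. (norm (partial j u x $ i))^2)" for i
      proof -
        have "norm (rad (\<lambda>y. u y $ i) x) \<le> (\<Sum>j\<in>UNIV. \<bar>x$j\<bar> * norm (partial j u x $ i))"
          unfolding rad_def partial_nth(1)[OF ud] by (rule sum_norm_le) (simp add: norm_mult cx_def)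
        then have "(norm (rad (\<lambda>y. u y $ i) x))^2 \<le> (\<Sum>j\<in>UNIV. \<bar>x$j\<bar> * norm (partial j u x $ i))^2"
          by (intro power_mono) auto
        also have "\<dots> \<le> (\<Sum>j\<in>UNIV. \<bar>x$j\<bar>^2) * (\<Sum>j\<in>UNIV. (norm (partial j u x $ i))^2)"
          by (rule Cauchy_Schwarz_ineq_sum)
        finally show ?thesis by (simp add: r2)
      qed
      then have "(\<Sum>i\<in>UNIV. (norm (rad (\<lambda>y. u y $ i) x))^2) \<le> (\<Sum>i\<in>UNIV. r^2 * (\<Sum>j\<in>UNIV. (norm (partial j u x $ i))^2))"
        by (intro sum_mono) auto
      then show "(\<Sum>i\<in>UNIV. (norm (rad (\<lambda>y. u y $ i) x))^2) \<le> r^2 * (norm (gradv u x))^2"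
        by (simp add: g sum_distrib_left)
    qed (intro continuous_intros cr cg)+
    then show "smean (\<lambda>x. \<Sum>i\<in>UNIV. (norm (rad (\<lambda>y. u y $ i) x))^2) r \<le> r^2 * smean (\<lambda>x. (norm (gradv u x))^2) r"
      by (simp add: smean_cmult)
    show "0 \<le> r^(2*n) * vb_mass n" using r vb_mass_pos[of n] by simp
  qed
  finally show ?thesis .
qed

section \<open>The radial equation near the origin\<close>

lemma growth_bound:
  fixes f :: "real \<Rightarrow> complex" and g :: "real \<Rightarrow> real"
  assumes ab: "a \<le> b"
    and f: "\<And>x. x \<in> {a..b} \<Longrightarrow> (f has_vector_derivative f' x) (at x)"
    and g: "\<And>x. x \<in> {a..b} \<Longrightarrow> (g has_real_derivative g' x) (at x)"
    and le: "\<And>x. x \<in> {a..b} \<Longrightarrow> norm (f' x) \<le> g' x"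
  shows "norm (f b - f a) \<le> g b - g a"
proof -
  have 1: "(f' has_integral (f b - f a)) {a..b}"
    by (rule fundamental_theorem_of_calculus[OF ab]) (use f in \<open>auto intro: has_vector_derivative_at_within\<close>)
  have 2: "(g' has_integral (g b - g a)) {a..b}"
    by (rule fundamental_theorem_of_calculus[OF ab])
       (use g in \<open>auto simp: has_real_derivative_iff_has_vector_derivative[symmetric] intro: has_field_derivative_at_within\<close>)
  have "norm (integral {a..b} f') \<le> integral {a..b} g'"
    by (rule integral_norm_bound_integral) (use 1 2 le in auto)
  then show ?thesis using 1 2 by (simp add: integral_unique)
qed

lemma DERIV_inverse_power:
  assumes "x > (0::real)"
  shows "((\<lambda>x. inverse (x^N)) has_real_derivative - real N / x^(N+1)) (at x)"
proof (cases N)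
  case (Suc m)
  have "((\<lambda>x. inverse (x^N)) has_real_derivative - (inverse (x^N) * (real N * x^(N - Suc 0)) * inverse (x^N))) (at x)"
    by (rule DERIV_inverse'[OF DERIV_pow]) (use assms in auto)
  also have "- (inverse (x^N) * (real N * x^(N - Suc 0)) * inverse (x^N)) = - real N / x^(N+1)"
    using assms Suc by (simp add: field_simps)
  finally show ?thesis .
qed simp

text \<open>\<open>M\<close> and \<open>K\<close> abstract the averages of \<open>proj\<close> and
  \<open>radproj\<close> in the unit ball, \<open>k2\<close> is the squared wave number and
  \<open>m1\<close> the boundary value of the mode. The crude constant \<open>B\<close> only starts
  the argument and does not enter the final estimates.\<close>

context
  fixes M K :: "real \<Rightarrow> complex" and n :: nat and k2 B :: real and m1 :: complex
  assumes n: "n \<ge> 10" and k2: "0 \<le> k2" "k2 \<le> 1/100"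
    and M': "\<And>r. r \<in> {0<..<1} \<Longrightarrow> (M has_vector_derivative (K r + of_nat n * M r) / of_real r) (at r)"
    and Z': "\<And>r. r \<in> {0<..<1} \<Longrightarrow>
      ((\<lambda>r. of_real r * (K r - of_nat n * M r)) has_vector_derivative - of_real (k2 * r^2) * M r) (at r)"
    and bM: "\<And>r. r \<in> {0<..<1} \<Longrightarrow> norm (M r) \<le> B * r^n"
    and bK: "\<And>r. r \<in> {0<..<1} \<Longrightarrow> norm (K r) \<le> B * r^n"
    and lim: "(M \<longlongrightarrow> m1) (at 1 within {0<..<1})"
begin

text \<open>K - n M is zero for the static mode r^n. Multiplied by r it tends to 0 at the origin,
  and its derivative - k2 r^2 M is integrated from there.\<close>

lemma interior_defect:
  assumes b: "\<And>r. r \<in> {0<..<1} \<Longrightarrow> norm (M r) \<le> b * r^n" and r: "r \<in> {0<..<1}"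
  shows "norm (K r - of_nat n * M r) \<le> k2 * b * r^(n+2) / (n+3)"
proof -
  let ?Z = "\<lambda>r. of_real r * (K r - of_nat n * M r)"
  have r01: "0 < r" "r < 1" using r by auto
  have "norm (M r) \<le> b * r^n" using b r by blast
  then have "0 \<le> b * r^n" using norm_ge_zero order_trans by blast
  then have b0: "b \<ge> 0" using r01(1) by (meson mult_neg_pos not_le zero_less_power)
  have "norm (M r) \<le> B * r^n" using bM r by blast
  then have "0 \<le> B * r^n" using norm_ge_zero order_trans by blast
  then have B0: "B \<ge> 0" using r01(1) by (meson mult_neg_pos not_le zero_less_power)
  let ?g = "\<lambda>x. k2 * b * x^(n+3) / (n+3)"
  \<comment> \<open>Integration has to start at a positive \<open>s\<close>; the crude bounds make
    the initial value of order \<open>s\<close>, so it drops out as \<open>s\<close> tends to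
    0.\<close>
  have step: "norm (?Z r) \<le> (n + 1) * B * s + ?g r" if s: "0 < s" "s < r" for s
  proof -
    have "norm (?Z r - ?Z s) \<le> ?g r - ?g s"
    proof (rule growth_bound)
      fix x assume x: "x \<in> {s..r}"
      then have x01: "x \<in> {0<..<1}" using s r01 by auto
      show "(?Z has_vector_derivative - of_real (k2 * x^2) * M x) (at x)" by (rule Z'[OF x01])
      show "(?g has_real_derivative k2 * b * x^(n+2)) (at x)"
        by (rule DERIV_cong[OF DERIV_cdivide[OF DERIV_cmult[OF DERIV_pow]]]) simp
      have "norm (- of_real (k2 * x^2) * M x) = k2 * x^2 * norm (M x)"
        using k2 by (simp add: norm_mult norm_power)
      also have "\<dots> \<le> k2 * x^2 * (b * x^n)" using b[OF x01] k2 by (intro mult_left_mono) auto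
      finally show "norm (- of_real (k2 * x^2) * M x) \<le> k2 * b * x^(n+2)"
        by (simp add: power_add power2_eq_square mult_ac)
    qed (use s in auto)
    moreover have "?g s \<ge> 0" using s k2 b0 by simp
    moreover have "norm (?Z s) \<le> (n + 1) * B * s"
    proof -
      have s01: "s \<in> {0<..<1}" using s r01 by auto
      have "s^n \<le> 1" using s01 by (intro power_le_one) auto
      then have Bs: "B * s^n \<le> B" using B0 by (simp add: mult_left_le)
      have "norm (K s - of_nat n * M s) \<le> norm (K s) + n * norm (M s)"
        using norm_triangle_ineq4[of "K s" "of_nat n * M s"] by (simp add: norm_mult)
      also have "\<dots> \<le> B + n * B"
        using bM[OF s01] bK[OF s01] Bs by (intro add_mono mult_left_mono) auto
      finally have "s * norm (K s - of_nat n * M s) \<le> s * (B + n * B)"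
        using s by (intro mult_left_mono) auto
      moreover have "norm (?Z s) = s * norm (K s - of_nat n * M s)" using s by (simp add: norm_mult)
      moreover have "(n + 1) * B * s = s * (B + n * B)" by (simp add: algebra_simps)
      ultimately show ?thesis by linarith
    qed
    ultimately show ?thesis using norm_triangle_sub[of "?Z r" "?Z s"] by linarith
  qed
  have "norm (?Z r) \<le> (n + 1) * B * 0 + ?g r"
  proof (rule tendsto_lowerbound)
    show "((\<lambda>s. (n + 1) * B * s + ?g r) \<longlongrightarrow> (n + 1) * B * 0 + ?g r) (at_right 0)"
      by (intro tendsto_intros)
    show "eventually (\<lambda>s. norm (?Z r) \<le> (n + 1) * B * s + ?g r) (at_right 0)"
      using eventually_at_right_less eventually_at_right_real[OF r01(1)]
      by eventually_elim (use step in auto)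
  qed simp
  then have "r * norm (K r - of_nat n * M r) \<le> k2 * b * r^(n+3) / (n+3)"
    using r01 by (simp add: norm_mult)
  also have "\<dots> = r * (k2 * b * r^(n+2) / (n+3))" by (simp add: numeral_eq_Suc)
  finally show ?thesis using r01 by (simp only: mult_le_cancel_left_pos)
qed

text \<open>For the static mode M / r^(2n) is constant. In general its derivative is the defect
  divided by r^(2n+1), and integrating up to the interface brings in \<open>m1\<close> as a
  limit.\<close>

lemma interior_leading:
  assumes b: "\<And>r. r \<in> {0<..<1} \<Longrightarrow> norm (M r) \<le> b * r^n" and r: "r \<in> {0<..<1}"
  shows "norm (M r - of_real (r^(2*n)) * m1) \<le> k2 * b * r^(n+2) / n^2"
proof -
  have r01: "0 < r" "r < 1" using r by auto
  have "n = (n - 2) + 2" using n by simp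
  then obtain m where m: "n = m + 2" by blast
  have m8: "m \<ge> 8" using m n by simp
  have "norm (M r) \<le> b * r^n" using b r by blast
  then have "0 \<le> b * r^n" using norm_ge_zero order_trans by blast
  then have b0: "b \<ge> 0" using r01(1) by (meson mult_neg_pos not_le zero_less_power)
  define C where "C = k2 * b / ((n+3) * m)"
  have C0: "C \<ge> 0" using k2 b0 by (simp add: C_def)
  let ?p = "\<lambda>x. M x / of_real (x^(2*n))"
  let ?g = "\<lambda>x. - C / x^m"
  have step: "norm (?p r - ?p s) \<le> C / r^m" if s: "r < s" "s < 1" for s
  proof -
    have "norm (?p s - ?p r) \<le> ?g s - ?g r"
    proof (rule growth_bound)
      fix x assume x: "x \<in> {r..s}"
      then have x01: "x \<in> {0<..<1}" using s r01 by auto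
      then have x0: "x > 0" by auto
      from x0 have "((\<lambda>x. inverse (x^(2*n))) has_real_derivative - (real (2*n)) / x^(2*n+1)) (at x)"
        by (rule DERIV_inverse_power)
      then have 1: "((\<lambda>x. complex_of_real (inverse (x^(2*n)))) has_vector_derivative of_real (- (real (2*n)) / x^(2*n+1))) (at x)"
        by (rule has_vector_derivative_of_real)
      have "((\<lambda>x. M x * complex_of_real (inverse (x^(2*n)))) has_vector_derivative
          M x * of_real (- (real (2*n)) / x^(2*n+1)) + (K x + of_nat n * M x) / of_real x * of_real (inverse (x^(2*n)))) (at x)"
        by (rule has_vector_derivative_mult[OF M'[OF x01] 1])
      moreover have "M x * of_real (- (real (2*n)) / x^(2*n+1)) + (K x + of_nat n * M x) / of_real x * of_real (inverse (x^(2*n)))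
          = (K x - of_nat n * M x) / of_real (x^(2*n+1))"
        using x0 by (simp add: field_simps)
      ultimately show "(?p has_vector_derivative (K x - of_nat n * M x) / of_real (x^(2*n+1))) (at x)"
        by (simp add: divide_inverse)
      show "(?g has_real_derivative C * m / x^(m+1)) (at x)"
        using DERIV_cmult[OF DERIV_inverse_power[OF x0, of m], of "- C"] by (simp add: divide_inverse mult.assoc)
      have "norm ((K x - of_nat n * M x) / of_real (x^(2*n+1))) = norm (K x - of_nat n * M x) / x^(2*n+1)"
        using x0 by (simp add: norm_divide norm_mult norm_power)
      also have "\<dots> \<le> (k2 * b * x^(n+2) / (n+3)) / x^(2*n+1)"
        using interior_defect[OF b x01] x0 by (intro divide_right_mono) auto
      also have "\<dots> = k2 * b / (n+3) / x^(m+1)"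
      proof -
        have "2*n+1 = (n+2) + (m+1)" using m by simp
          then have "x^(2*n+1) = x^(n+2) * x^(m+1)" by (simp only: power_add)
        then show ?thesis using x0 by simp
      qed
      also have "k2 * b / (n+3) = C * m" using m8 by (simp add: C_def)
      finally show "norm ((K x - of_nat n * M x) / of_real (x^(2*n+1))) \<le> C * m / x^(m+1)" .
    qed (use s in auto)
    also have "\<dots> \<le> C / r^m" using C0 s r01 by simp
    finally show ?thesis by (simp add: norm_minus_commute)
  qed
  have "norm (?p r - m1 / of_real (1^(2*n))) \<le> C / r^m"
  proof (rule tendsto_upperbound)
    have "at_left 1 = at 1 within {0<..<1::real}"
      by (rule at_within_nhd[where S="{0<..}"]) auto
    with lim have "(M \<longlongrightarrow> m1) (at_left 1)" by simp
    then show "((\<lambda>s. norm (?p r - M s / of_real (s^(2*n)))) \<longlongrightarrow> norm (?p r - m1 / of_real (1^(2*n)))) (at_left 1)"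
      by (intro tendsto_intros) auto
    show "eventually (\<lambda>s. norm (?p r - M s / of_real (s^(2*n))) \<le> C / r^m) (at_left 1)"
      using eventually_at_left_real[OF r01(2)] by eventually_elim (use step in auto)
  qed simp
  then have "r^(2*n) * norm (?p r - m1) \<le> r^(2*n) * (C / r^m)"
    using r01 by (intro mult_left_mono) auto
  moreover have "r^(2*n) * norm (?p r - m1) = norm (M r - of_real (r^(2*n)) * m1)"
  proof -
    have "M r - of_real (r^(2*n)) * m1 = of_real (r^(2*n)) * (?p r - m1)"
      using r01 by (simp add: field_simps)
    then show ?thesis using r01 by (simp add: norm_mult norm_power)
  qed
  moreover have "r^(2*n) * (C / r^m) = C * r^(n+2)"
  proof -
    have "2*n = (n+2) + m" using m by simp
    then have "r^(2*n) = r^(n+2) * r^m" by (simp only: power_add)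
    then show ?thesis using r01 by simp
  qed
  moreover have "C \<le> k2 * b / n^2"
  proof -
    \<comment> \<open>With m = n - 2 the product is n^2 + n - 6.\<close>
    have "real n * real n \<le> (real n + 3) * real m" using m8 by (simp add: m algebra_simps)
    then have "k2 * b / ((real n + 3) * real m) \<le> k2 * b / (real n * real n)"
      by (rule divide_left_mono) (use k2 b0 m8 n in auto)
    then show ?thesis by (simp add: C_def power2_eq_square)
  qed
  ultimately show ?thesis
    using mult_right_mono[of C "k2 * b / n^2" "r^(n+2)"] r01 by simp
qed

text \<open>The supremum of \<open>\<bar>M\<bar> / r\<^sup>n\<close> is finite and bounded by \<open>\<bar>m1\<bar>\<close> plus half of itself. This replaces
  power series expansions of the Bessel functions.\<close>

lemma interior_apriori:
  assumes r: "r \<in> {0<..<1}"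
  shows "norm (M r) \<le> 2 * norm m1 * r^n"
proof -
  let ?I = "{0<..<1::real}"
  define b where "b = (SUP r\<in>?I. norm (M r) / r^n)"
  have bdd: "bdd_above ((\<lambda>r. norm (M r) / r^n) ` ?I)"
    by (rule bdd_aboveI2[where M=B]) (use bM in \<open>auto simp: divide_le_eq\<close>)
  have b: "norm (M r) \<le> b * r^n" if "r \<in> ?I" for r
  proof -
    have "norm (M r) / r^n \<le> b" unfolding b_def by (rule cSUP_upper[OF that bdd])
    then show ?thesis using that by (simp add: divide_le_eq)
  qed
  have b0: "b \<ge> 0"
  proof -
    have "norm (M (1/2)) / (1/2)^n \<le> b" unfolding b_def by (rule cSUP_upper[OF _ bdd]) simp
    moreover have "0 \<le> norm (M (1/2)) / (1/2)^n" by simp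
    ultimately show ?thesis by linarith
  qed
  have "norm (M r) / r^n \<le> norm m1 + b / 2" if r: "r \<in> ?I" for r
  proof -
    have r01: "0 < r" "r < 1" using r by auto
    have "r^(2*n) \<le> r^n" using r01 by (intro power_decreasing) auto
    then have 1: "norm (of_real (r^(2*n)) * m1) \<le> r^n * norm m1"
      using r01 by (simp add: norm_mult norm_power mult_right_mono)
    have "k2 * b * r^(n+2) / n^2 \<le> r^n * (b / 2)"
    proof -
      have "r^(n+2) \<le> r^n" using r01 by (intro power_decreasing) auto
      moreover have "k2 * b / n^2 \<le> b / 2"
      proof -
        have "real 10 ^ 2 \<le> real n ^ 2" using n by (intro power_mono) auto
        then have "k2 / n^2 \<le> 1 / 2" using k2 n by (simp add: divide_le_eq)
        from mult_right_mono[OF this b0] show ?thesis by simp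
      qed
      ultimately have "(k2 * b / n^2) * r^(n+2) \<le> (b / 2) * r^n"
        using b0 r01 k2 by (intro mult_mono) auto
      then show ?thesis by (simp add: mult.commute)
    qed
    then have "norm (M r) \<le> r^n * norm m1 + r^n * (b / 2)"
      using interior_leading[OF b r] 1 norm_triangle_sub[of "M r" "of_real (r^(2*n)) * m1"] by linarith
    then show ?thesis using r01 by (simp add: divide_le_eq algebra_simps)
  qed
  then have "b \<le> norm m1 + b / 2" unfolding b_def[symmetric] by (subst b_def, intro cSUP_least) auto
  then have "b * r^n \<le> 2 * norm m1 * r^n" using r by (intro mult_right_mono) auto
  then show ?thesis using b[OF r] by linarith
qed

lemma interior_mode:
  assumes r: "r \<in> {0<..<1}"
  shows "norm (M r - of_real (r^(2*n)) * m1) \<le> norm m1 * r^(n+2) / n^2"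
    and "norm (K r - of_nat n * M r) \<le> norm m1 * r^(n+2) / n"
proof -
  have r01: "0 < r" "r < 1" using r by auto
  \<comment> \<open>The smallness of \<open>k2\<close> absorbs the factor 2 of the a priori
    bound.\<close>
  have kb: "k2 * (2 * norm m1) \<le> norm m1"
    using mult_right_mono[OF k2(2), of "2 * norm m1"] norm_ge_zero[of m1] by linarith
  have "norm (M r - of_real (r^(2*n)) * m1) \<le> k2 * (2 * norm m1) * r^(n+2) / n^2"
    by (rule interior_leading[OF interior_apriori r])
  also have "\<dots> \<le> norm m1 * r^(n+2) / n^2"
    using kb r01 by (intro divide_right_mono mult_right_mono) auto
  finally show "norm (M r - of_real (r^(2*n)) * m1) \<le> norm m1 * r^(n+2) / n^2" .
  have "norm (K r - of_nat n * M r) \<le> k2 * (2 * norm m1) * r^(n+2) / (n+3)"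
    by (rule interior_defect[OF interior_apriori r])
  also have "\<dots> \<le> norm m1 * r^(n+2) / n"
    using kb r01 n by (intro frac_le mult_right_mono) auto
  finally show "norm (K r - of_nat n * M r) \<le> norm m1 * r^(n+2) / n" .
qed

end

section \<open>The radial equation near infinity\<close>

text \<open>With the reverse Bessel polynomial \<open>\<theta>\<^sub>n\<close>, normalised by \<open>\<theta>\<^sub>n(0) = 1\<close>, the outgoing spherical Hankel
  function of \<open>kr\<close> is a constant multiple of \<open>r\<^sup>-\<^sup>n\<^sup>-\<^sup>1 e\<^sup>i\<^sup>k\<^sup>r \<theta>\<^sub>n(-ikr)\<close>.\<close>

fun rbc :: "nat \<Rightarrow> nat \<Rightarrow> real" where
  "rbc n 0 = 1"
| "rbc n (Suc j) = 2 * (real n - real j) / (real (Suc j) * (2 * real n - real j)) * rbc n j"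

definition rbp :: "nat \<Rightarrow> complex poly" where
  "rbp n = (\<Sum>j\<le>n. monom (of_real (rbc n j)) j)"

lemma rbc_zero: "n < j \<Longrightarrow> rbc n j = 0"
proof (induction j)
  case (Suc j)
  then show ?case by (cases "n = j") auto
qed simp

text \<open>The factor 2(n - j)/(2n - j) of the recursion lies between 0 and 1 for j < n, and the
  coefficients vanish beyond \<open>n\<close>. The bounds do not depend on \<open>n\<close>, which
  is what controls the Hankel functions uniformly; the third one concerns the coefficients of the
  derivative.\<close>

lemma rbc_bounds: "0 \<le> rbc n j \<and> rbc n j \<le> 1 \<and> real (Suc j) * rbc n (Suc j) \<le> 1"
proof -
  have step: "0 \<le> real (Suc j) * rbc n (Suc j) \<and> real (Suc j) * rbc n (Suc j) \<le> rbc n j" if "0 \<le> rbc n j" for j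
  proof (cases "j < n")
    case True
    define c where "c = 2 * (real n - real j) / (2 * real n - real j)"
    have "0 \<le> c" "c \<le> 1" unfolding c_def using True by (auto simp: divide_le_eq)
    then have a: "0 \<le> c * rbc n j \<and> c * rbc n j \<le> rbc n j" using that by (auto intro: mult_left_le_one_le)
    have e: "real (Suc j) * rbc n (Suc j) = c * rbc n j"
      using True by (simp add: c_def del: of_nat_Suc)
    show ?thesis by (rule a[folded e])
  next
    case False
    then have "rbc n (Suc j) = 0" by (intro rbc_zero) simp
    then show ?thesis using that by (simp del: rbc.simps(2))
  qed
  have b: "0 \<le> rbc n j \<and> rbc n j \<le> 1" for j
  proof (induction j)
    case (Suc j)
    then have "0 \<le> real (Suc j) * rbc n (Suc j)" and le: "real (Suc j) * rbc n (Suc j) \<le> 1" using step[of j] by auto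
    then have 0: "0 \<le> rbc n (Suc j)" by (simp add: zero_le_mult_iff del: rbc.simps)
    have "1 * rbc n (Suc j) \<le> real (Suc j) * rbc n (Suc j)"
      by (rule mult_right_mono[OF _ 0]) simp
    then have "rbc n (Suc j) \<le> 1" using le by linarith
    then show ?case using 0 by blast
  qed simp
  show ?thesis using b[of j] step[of j] by linarith
qed

lemma coeff_rbp: "coeff (rbp n) j = of_real (rbc n j)"
  by (simp add: rbp_def coeff_sum rbc_zero)

lemma degree_rbp: "degree (rbp n) \<le> n"
  by (rule degree_le) (simp add: coeff_rbp rbc_zero)

text \<open>The equation z \<theta>'' - 2(z + n) \<theta>' + 2n \<theta> = 0 of the reverse Bessel
  polynomials, coefficient by coefficient; \<open>rec\<close> is the recursion cleared of its
  denominators.\<close>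

lemma rbp_ode_poly:
  assumes "n \<ge> 1"
  shows "pCons 0 (pderiv (pderiv (rbp n))) + smult (2 * of_nat n) (rbp n)
       = smult 2 (pCons 0 (pderiv (rbp n))) + smult (2 * of_nat n) (pderiv (rbp n))"
proof (rule poly_eqI)
  fix j
  have rec: "real (Suc j) * (2 * real n - real j) * rbc n (Suc j) = 2 * (real n - real j) * rbc n j"
  proof (cases "j \<le> n")
    case True
    then have "2 * real n - real j \<noteq> 0" using assms by simp
    then show ?thesis by simp
  next
    case False
    then show ?thesis using rbc_zero[of n j] rbc_zero[of n "Suc j"] by (simp del: rbc.simps)
  qed
  have "complex_of_real (real (Suc j) * real j * rbc n (Suc j) + 2 * real n * rbc n j)
    = complex_of_real (2 * real j * rbc n j + 2 * real n * (real (Suc j) * rbc n (Suc j)))"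
    using rec by (simp only: of_real_eq_iff) (simp only: algebra_simps)
  then show "coeff (pCons 0 (pderiv (pderiv (rbp n))) + smult (2 * of_nat n) (rbp n)) j
     = coeff (smult 2 (pCons 0 (pderiv (rbp n))) + smult (2 * of_nat n) (pderiv (rbp n))) j"
    by (cases j) (simp_all add: coeff_pderiv coeff_rbp algebra_simps del: rbc.simps(2))
qed

lemma rbp_ode:
  assumes "n \<ge> 1"
  shows "z * poly (pderiv (pderiv (rbp n))) z + 2 * of_nat n * poly (rbp n) z
       = 2 * z * poly (pderiv (rbp n)) z + 2 * of_nat n * poly (pderiv (rbp n)) z"
  using arg_cong[OF rbp_ode_poly[OF assms], of "\<lambda>p. poly p z"] by (simp add: mult.assoc)

lemma geometric_sum_le:
  fixes x :: real
  assumes "0 \<le> x" "x \<le> 1/100"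
  shows "(\<Sum>j<m. x^j) \<le> 100/99"
proof -
  have "(\<Sum>j<m. x^j) = (1 - x^m) / (1 - x)" using assms by (simp add: sum_gp_strict)
  also have "\<dots> \<le> 1 / (1 - x)" using assms by (intro divide_right_mono) auto
  also have "\<dots> \<le> 100/99" using assms by (simp add: field_simps)
  finally show ?thesis .
qed

text \<open>Coefficients of at most 1 leave a geometric series in \<open>norm z\<close>. The radius
  1/100 is the source of the smallness condition on k r, and it is the same for all
  \<open>n\<close>.\<close>

lemma rbp_near_one:
  assumes "norm z \<le> 1/100"
  shows "norm (poly (rbp n) z - 1) \<le> 2 * norm z" and "norm (poly (pderiv (rbp n)) z) \<le> 2"
proof -
  have "poly (rbp n) z = (\<Sum>j\<le>n. of_real (rbc n j) * z^j)"
    by (simp add: rbp_def poly_sum poly_monom)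
  also have "\<dots> = 1 + (\<Sum>j<n. of_real (rbc n (Suc j)) * z^(Suc j))"
    by (simp add: sum.atMost_shift del: rbc.simps(2) power_Suc)
  finally have "norm (poly (rbp n) z - 1) = norm (\<Sum>j<n. of_real (rbc n (Suc j)) * z^(Suc j))" by simp
  also have "\<dots> \<le> (\<Sum>j<n. norm z * norm z^j)"
  proof (rule sum_norm_le)
    fix j
    have "norm (of_real (rbc n (Suc j)) * z^(Suc j)) = rbc n (Suc j) * norm z^(Suc j)"
      using rbc_bounds[of n "Suc j"] by (simp add: norm_mult norm_power del: rbc.simps(2))
    also have "\<dots> \<le> 1 * norm z^(Suc j)"
      using rbc_bounds[of n "Suc j"] by (intro mult_right_mono) auto
    finally show "norm (of_real (rbc n (Suc j)) * z^(Suc j)) \<le> norm z * norm z^j" by simp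
  qed
  also have "\<dots> = norm z * (\<Sum>j<n. norm z^j)" by (simp add: sum_distrib_left)
  also have "\<dots> \<le> norm z * 2" using geometric_sum_le[OF _ assms, of n] by (intro mult_left_mono) auto
  finally show "norm (poly (rbp n) z - 1) \<le> 2 * norm z" by simp
  have "poly (pderiv (rbp n)) z = (\<Sum>j\<le>degree (pderiv (rbp n)). coeff (pderiv (rbp n)) j * z^j)"
    by (rule poly_altdef)
  also have "norm \<dots> \<le> (\<Sum>j\<le>degree (pderiv (rbp n)). norm z^j)"
  proof (rule sum_norm_le)
    fix j
    have "norm (coeff (pderiv (rbp n)) j) = real (Suc j) * rbc n (Suc j)"
      using rbc_bounds[of n "Suc j"] by (simp add: coeff_pderiv coeff_rbp norm_mult del: rbc.simps(2) of_nat_Suc)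
    also have "\<dots> \<le> 1" using rbc_bounds[of n j] by blast
    finally have "norm (coeff (pderiv (rbp n)) j) * norm z^j \<le> 1 * norm z^j" by (intro mult_right_mono) auto
    then show "norm (coeff (pderiv (rbp n)) j * z^j) \<le> norm z^j" by (simp add: norm_mult norm_power)
  qed
  also have "\<dots> \<le> 2" using geometric_sum_le[OF _ assms, of "Suc (degree (pderiv (rbp n)))"] by (simp add: lessThan_Suc_atMost)
  finally show "norm (poly (pderiv (rbp n)) z) \<le> 2" .
qed

lemma poly_growth:
  fixes p :: "complex poly"
  assumes "degree p \<le> d"
  shows "\<exists>C. \<forall>r\<ge>1. norm (poly p (c * of_real r)) \<le> C * r^d"
proof (intro exI allI impI)
  fix r :: real assume r: "r \<ge> 1"
  have "norm (poly p (c * of_real r)) = norm (\<Sum>j\<le>degree p. coeff p j * (c * of_real r)^j)"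
    by (simp add: poly_altdef)
  also have "\<dots> \<le> (\<Sum>j\<le>degree p. norm (coeff p j) * norm c^j * r^d)"
  proof (rule sum_norm_le)
    fix j assume "j \<in> {..degree p}"
    then have "r^j \<le> r^d" using assms r by (intro power_increasing) auto
    then have "norm (coeff p j) * norm c^j * r^j \<le> norm (coeff p j) * norm c^j * r^d"
      by (intro mult_left_mono) auto
    then show "norm (coeff p j * (c * of_real r)^j) \<le> norm (coeff p j) * norm c^j * r^d"
      using r by (simp add: norm_mult norm_power power_mult_distrib mult.assoc)
  qed
  also have "\<dots> = (\<Sum>j\<le>degree p. norm (coeff p j) * norm c^j) * r^d" by (simp add: sum_distrib_right)
  finally show "norm (poly p (c * of_real r)) \<le> (\<Sum>j\<le>degree p. norm (coeff p j) * norm c^j) * r^d" .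
qed

text \<open>A constant multiple of r^(n+1) h_n(kr), scaled like r times \<open>M\<close>;
  \<open>q1\<close> is its derivative.\<close>

definition q0 :: "nat \<Rightarrow> real \<Rightarrow> real \<Rightarrow> complex" where
  "q0 n k r = exp (\<i> * of_real k * of_real r) * poly (rbp n) (- \<i> * of_real k * of_real r)"

definition q1 :: "nat \<Rightarrow> real \<Rightarrow> real \<Rightarrow> complex" where
  "q1 n k r = \<i> * of_real k * exp (\<i> * of_real k * of_real r)
     * (poly (rbp n) (- \<i> * of_real k * of_real r) - poly (pderiv (rbp n)) (- \<i> * of_real k * of_real r))"

lemma has_vector_derivative_exp_poly:
  "((\<lambda>r. exp (\<i> * of_real k * of_real r) * poly p (- \<i> * of_real k * of_real r)) has_vector_derivative
    \<i> * of_real k * exp (\<i> * of_real k * of_real r)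
     * (poly p (- \<i> * of_real k * of_real r) - poly (pderiv p) (- \<i> * of_real k * of_real r))) (at r)"
proof (rule has_vector_derivative_real_field)
  let ?w = "complex_of_real r"
  have "((\<lambda>w. - \<i> * of_real k * w) has_field_derivative - \<i> * of_real k) (at ?w)"
    by (auto intro!: derivative_eq_intros)
  from DERIV_chain2[OF poly_DERIV this, of p]
  have 1: "((\<lambda>w. poly p (- \<i> * of_real k * w)) has_field_derivative poly (pderiv p) (- \<i> * of_real k * ?w) * (- \<i> * of_real k)) (at ?w)" .
  have 2: "((\<lambda>w. exp (\<i> * of_real k * w)) has_field_derivative exp (\<i> * of_real k * ?w) * (\<i> * of_real k)) (at ?w)"
    by (auto intro!: derivative_eq_intros)
  show "((\<lambda>w. exp (\<i> * of_real k * w) * poly p (- \<i> * of_real k * w)) has_field_derivative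
    \<i> * of_real k * exp (\<i> * of_real k * of_real r)
     * (poly p (- \<i> * of_real k * of_real r) - poly (pderiv p) (- \<i> * of_real k * of_real r))) (at ?w)"
    by (rule DERIV_cong[OF DERIV_mult[OF 2 1]]) (simp add: algebra_simps)
qed

lemma q0_deriv: "(q0 n k has_vector_derivative q1 n k r) (at r)"
  unfolding q0_def[abs_def] q1_def by (rule has_vector_derivative_exp_poly)

text \<open>If b solves the spherical Bessel equation, then q = r^(n+1) b satisfies q'' = (2n/r) q'
  - k^2 q. With z = - i k r this is \<open>rbp_ode\<close>.\<close>

lemma q1_deriv:
  assumes n: "n \<ge> 1" and r: "r > 0"
  shows "(q1 n k has_vector_derivative 2 * of_nat n / of_real r * q1 n k r - of_real (k^2) * q0 n k r) (at r)"
proof (cases "k = 0")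
  case True
  then have "q1 n k = (\<lambda>r. 0)" by (simp add: q1_def fun_eq_iff)
  then show ?thesis using True by simp
next
  case False
  let ?z = "- \<i> * of_real k * of_real r" and ?e = "exp (\<i> * of_real k * of_real r)"
  let ?p = "poly (rbp n) ?z" and ?p1 = "poly (pderiv (rbp n)) ?z" and ?p2 = "poly (pderiv (pderiv (rbp n))) ?z"
  have "((\<lambda>r. \<i> * of_real k * (exp (\<i> * of_real k * of_real r) * poly (rbp n - pderiv (rbp n)) (- \<i> * of_real k * of_real r))) has_vector_derivative
    \<i> * of_real k * (\<i> * of_real k * ?e * (poly (rbp n - pderiv (rbp n)) ?z - poly (pderiv (rbp n - pderiv (rbp n))) ?z))) (at r)"
    by (rule has_vector_derivative_mult_right[OF has_vector_derivative_exp_poly])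
  moreover have "(\<lambda>r. \<i> * of_real k * (exp (\<i> * of_real k * of_real r) * poly (rbp n - pderiv (rbp n)) (- \<i> * of_real k * of_real r))) = q1 n k"
    by (simp add: q1_def fun_eq_iff mult.assoc)
  moreover have "\<i> * of_real k * (\<i> * of_real k * ?e * (poly (rbp n - pderiv (rbp n)) ?z - poly (pderiv (rbp n - pderiv (rbp n))) ?z))
     = 2 * of_nat n / of_real r * q1 n k r - of_real (k^2) * q0 n k r"
  proof -
    have ode: "?z * ?p2 + 2 * of_nat n * ?p = 2 * ?z * ?p1 + 2 * of_nat n * ?p1" by (rule rbp_ode[OF n])
    have "of_real r * (\<i> * of_real k * (\<i> * of_real k * ?e * (?p - ?p1 - (?p1 - ?p2))))
       = \<i> * of_real k * ?e * (2 * of_nat n * (?p - ?p1)) - of_real r * of_real (k^2) * (?e * ?p)"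
    proof -
      have "of_real r * (\<i> * of_real k * (\<i> * of_real k * ?e * (?p - ?p1 - (?p1 - ?p2))))
         - (\<i> * of_real k * ?e * (2 * of_nat n * (?p - ?p1)) - of_real r * of_real (k^2) * (?e * ?p))
         = - \<i> * of_real k * ?e * ((?z * ?p2 + 2 * of_nat n * ?p) - (2 * ?z * ?p1 + 2 * of_nat n * ?p1))"
        by (simp add: algebra_simps power2_eq_square)
      also have "\<dots> = 0" unfolding ode by simp
      finally show ?thesis by simp
    qed
    then show ?thesis using r
      by (simp add: pderiv_diff q1_def q0_def field_simps)
  qed
  ultimately show ?thesis by (simp only:)
qed

text \<open>The exterior counterpart of the interior setting. In \<open>rc\<close> the radiation
  defect of order r^(-2) meets the test field x \<times> \<open>vb\<close>, which grows like
  r^(n+1); this accounts for the right-hand side.\<close>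

context
  fixes M K :: "real \<Rightarrow> complex" and n :: nat and k C r0 :: real
  assumes n: "n \<ge> 1" and k: "k > 0"
    and M': "\<And>r. r > 1 \<Longrightarrow> (M has_vector_derivative (K r + of_nat n * M r) / of_real r) (at r)"
    and Z': "\<And>r. r > 1 \<Longrightarrow>
      ((\<lambda>r. of_real r * (K r - of_nat n * M r)) has_vector_derivative - of_real (k^2 * r^2) * M r) (at r)"
    and r0: "r0 > 1"
    and rc: "\<And>r. r \<ge> r0 \<Longrightarrow> norm (of_real (r * k^2) * M r + \<i> * of_real k * (K r + M r)) \<le> C * r^n / r"
begin

text \<open>This is r^(n+1) b, which satisfies the same equation as \<open>q0\<close>;
  \<open>ext_d\<close> is its derivative.\<close>

definition ext_q :: "real \<Rightarrow> complex" where "ext_q r = of_real r * M r"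
definition ext_d :: "real \<Rightarrow> complex" where "ext_d r = K r + (of_nat n + 1) * M r"

lemma ext_q_deriv: "r > 1 \<Longrightarrow> (ext_q has_vector_derivative ext_d r) (at r)"
proof -
  assume r: "r > 1"
  have "((\<lambda>r. of_real r * M r) has_vector_derivative of_real r * ((K r + of_nat n * M r) / of_real r) + 1 * M r) (at r)"
    by (rule has_vector_derivative_mult[OF _ M'[OF r]]) (rule has_vector_derivative_of_real[OF DERIV_ident, unfolded of_real_1])
  moreover have "of_real r * ((K r + of_nat n * M r) / of_real r) + 1 * M r = ext_d r"
    using r by (simp add: ext_d_def) (simp add: algebra_simps)
  ultimately show ?thesis by (simp add: ext_q_def[abs_def])
qed

lemma ext_d_deriv: "r > 1 \<Longrightarrow> (ext_d has_vector_derivative 2 * of_nat n / of_real r * ext_d r - of_real (k^2) * ext_q r) (at r)"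
proof -
  assume r: "r > 1"
  let ?Z = "\<lambda>r. of_real r * (K r - of_nat n * M r)"
  have 1: "((\<lambda>x. complex_of_real (inverse x)) has_vector_derivative of_real (- (inverse r * inverse r))) (at r)"
    by (rule has_vector_derivative_of_real) (use r in \<open>auto intro!: derivative_eq_intros simp: power2_eq_square\<close>)
  \<comment> \<open>\<open>ext_d\<close> is written as Z/r + (2n + 1) M, because the derivatives of
    Z = r (K - n M) and of M are the given ones.\<close>
  have "((\<lambda>x. ?Z x * complex_of_real (inverse x) + (2 * of_nat n + 1) * M x) has_vector_derivative
     (?Z r * of_real (- (inverse r * inverse r)) + - of_real (k^2 * r^2) * M r * of_real (inverse r))
     + (2 * of_nat n + 1) * ((K r + of_nat n * M r) / of_real r)) (at r)"
    by (intro has_vector_derivative_add has_vector_derivative_mult has_vector_derivative_mult_right Z' M' r 1)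
  moreover have "(?Z r * of_real (- (inverse r * inverse r)) + - of_real (k^2 * r^2) * M r * of_real (inverse r))
     + (2 * of_nat n + 1) * ((K r + of_nat n * M r) / of_real r)
     = 2 * of_nat n / of_real r * ext_d r - of_real (k^2) * ext_q r"
    using r by (simp add: ext_d_def ext_q_def field_simps power2_eq_square)
  ultimately have 2: "((\<lambda>x. ?Z x * complex_of_real (inverse x) + (2 * of_nat n + 1) * M x) has_vector_derivative
     2 * of_nat n / of_real r * ext_d r - of_real (k^2) * ext_q r) (at r)" by simp
  show ?thesis
  proof (rule has_vector_derivative_transform_within_open[OF 2])
    show "open {1::real<..}" by simp
    show "?Z x * complex_of_real (inverse x) + (2 * of_nat n + 1) * M x = ext_d x" if "x \<in> {1<..}" for x
      using that by (simp add: ext_d_def algebra_simps)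
  qed (use r in simp)
qed

text \<open>The weight r^(-2n) is the Abel factor of q'' = (2n/r) q' - k^2 q and makes the Wronskian
  constant.\<close>

definition wron :: "real \<Rightarrow> complex" where
  "wron r = (ext_q r * q1 n k r - ext_d r * q0 n k r) * of_real (inverse (r^(2*n)))"

lemma wron_deriv: "r > 1 \<Longrightarrow> (wron has_vector_derivative 0) (at r)"
proof -
  assume r: "r > 1"
  then have r': "r > 0" by simp
  let ?E = "2 * of_nat n / of_real r * ext_d r - of_real (k^2) * ext_q r"
  let ?F = "2 * of_nat n / of_real r * q1 n k r - of_real (k^2) * q0 n k r"
  let ?W = "ext_q r * q1 n k r - ext_d r * q0 n k r"
  have "(wron has_vector_derivative
      ?W * of_real (- real (2*n) / r^(2*n+1))
      + ((ext_q r * ?F + ext_d r * q1 n k r) - (ext_d r * q1 n k r + ?E * q0 n k r)) * of_real (inverse (r^(2*n)))) (at r)"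
    unfolding wron_def[abs_def]
    by (intro has_vector_derivative_mult has_vector_derivative_diff has_vector_derivative_of_real
        ext_q_deriv ext_d_deriv q0_deriv q1_deriv DERIV_inverse_power n r r')
  moreover have "(ext_q r * ?F + ext_d r * q1 n k r) - (ext_d r * q1 n k r + ?E * q0 n k r) = 2 * of_nat n / of_real r * ?W"
    by (simp add: algebra_simps)
  moreover have "?W * of_real (- real (2*n) / r^(2*n+1)) + 2 * of_nat n / of_real r * ?W * of_real (inverse (r^(2*n))) = 0"
    using r' by (simp add: field_simps)
  ultimately show ?thesis by (simp only:)
qed

text \<open>Being constant, the Wronskian vanishes as soon as it is O(1/r). It is unchanged if each
  derivative q' is replaced by the outgoing defect q' - (n/r) q - i k q, which is O(r^(n-1)) for
  \<open>ext_q\<close> by the radiation condition and O(r^(n-2)) for the explicit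
  \<open>q0\<close>.\<close>

lemma wron_zero: "r > 1 \<Longrightarrow> wron r = 0"
proof -
  have const: "wron r = wron s" if "r > 1" "s > 1" for r s
  proof -
    have "\<exists>c. \<forall>x\<in>{1<..}. wron x = c"
    proof (rule has_derivative_zero_constant)
      fix x :: real assume "x \<in> {1<..}"
      then have "(wron has_vector_derivative 0) (at x within {1<..})"
        by (intro has_vector_derivative_at_within[OF wron_deriv]) simp
      then show "(wron has_derivative (\<lambda>h. 0)) (at x within {1<..})" by (simp add: has_vector_derivative_def)
    qed simp
    then show ?thesis using that by auto
  qed
  define C1 where "C1 = C / k"
  have X: "norm (K r + M r - \<i> * of_real k * ext_q r) \<le> C1 * r^n / r" if r: "r \<ge> r0" for r
  proof -
    have "of_real (r * k^2) * M r + \<i> * of_real k * (K r + M r) = \<i> * of_real k * (K r + M r - \<i> * of_real k * ext_q r)"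
      by (simp add: ext_q_def algebra_simps power2_eq_square)
    then have "k * norm (K r + M r - \<i> * of_real k * ext_q r) \<le> C * r^n / r"
      using rc[OF r] k by (simp add: norm_mult)
    then have "norm (K r + M r - \<i> * of_real k * ext_q r) \<le> (C * r^n / r) / k"
      using k by (simp only: pos_le_divide_eq mult.commute)
    then show ?thesis by (simp add: C1_def mult.commute)
  qed
  have C1: "C1 \<ge> 0"
  proof -
    have "0 \<le> C1 * r0^n / r0" using X[of r0] norm_ge_zero order_trans by blast
    moreover have "r0^n / r0 > 0" using r0 by simp
    ultimately show ?thesis by (metis mult_neg_pos not_le times_divide_eq_right)
  qed
  let ?\<beta> = "\<lambda>r. ext_q r * of_real (inverse (r^n))"
  let ?g = "\<lambda>r. ?\<beta> r * exp (- \<i> * of_real k * of_real r)"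
  \<comment> \<open>Without the weight r^n and the phase e^(ikr), \<open>ext_q\<close> has the
    weighted outgoing defect as derivative, which is bounded. The resulting linear growth is
    affordable, since the defect of \<open>q0\<close> is two powers smaller than r^n.\<close>
  obtain A where A: "\<And>r. r \<ge> r0 \<Longrightarrow> norm (?\<beta> r) \<le> A * r"
  proof
    fix r assume r: "r \<ge> r0"
    have ne: "norm (exp (- \<i> * of_real k * complex_of_real x)) = 1" for x
      by (simp add: norm_exp_eq_Re)
    have "norm (?g r - ?g r0) \<le> C1 * r - C1 * r0"
    proof (rule growth_bound[OF r])
      fix x assume x: "x \<in> {r0..r}"
      then have x1: "x > 1" "x > 0" using r0 by auto
      show "((\<lambda>x. C1 * x) has_real_derivative C1) (at x)" by (auto intro!: derivative_eq_intros)
      have e: "((\<lambda>x. exp (- \<i> * of_real k * complex_of_real x)) has_vector_derivative - \<i> * of_real k * exp (- \<i> * of_real k * complex_of_real x)) (at x)"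
        by (rule has_vector_derivative_real_field) (auto intro!: derivative_eq_intros)
      have "(?g has_vector_derivative ?\<beta> x * (- \<i> * of_real k * exp (- \<i> * of_real k * complex_of_real x))
         + (ext_q x * of_real (- real n / x^(n+1)) + ext_d x * of_real (inverse (x^n))) * exp (- \<i> * of_real k * complex_of_real x)) (at x)"
        by (intro has_vector_derivative_mult has_vector_derivative_of_real ext_q_deriv DERIV_inverse_power e x1)
      moreover have "?\<beta> x * (- \<i> * of_real k * exp (- \<i> * of_real k * complex_of_real x))
         + (ext_q x * of_real (- real n / x^(n+1)) + ext_d x * of_real (inverse (x^n))) * exp (- \<i> * of_real k * complex_of_real x)
         = (K x + M x - \<i> * of_real k * ext_q x) * of_real (inverse (x^n)) * exp (- \<i> * of_real k * complex_of_real x)"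
        using x1 by (simp add: ext_q_def ext_d_def field_simps)
      ultimately show "(?g has_vector_derivative (K x + M x - \<i> * of_real k * ext_q x) * of_real (inverse (x^n)) * exp (- \<i> * of_real k * complex_of_real x)) (at x)"
        by (simp only:)
      have "norm ((K x + M x - \<i> * of_real k * ext_q x) * of_real (inverse (x^n)) * exp (- \<i> * of_real k * complex_of_real x))
         = norm (K x + M x - \<i> * of_real k * ext_q x) * inverse (x^n)"
        unfolding norm_mult ne using x1 by (simp add: norm_power norm_inverse)
      also have "\<dots> \<le> (C1 * x^n / x) * inverse (x^n)"
        using X[of x] x x1 by (intro mult_right_mono) auto
      also have "\<dots> = C1 / x" using x1 by (simp add: field_simps)
      also have "\<dots> \<le> C1 / 1" using C1 x1 by (intro divide_left_mono) auto
      finally show "norm ((K x + M x - \<i> * of_real k * ext_q x) * of_real (inverse (x^n)) * exp (- \<i> * of_real k * complex_of_real x)) \<le> C1" by simp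
    qed
    then have "norm (?g r) \<le> norm (?g r0) + C1 * r - C1 * r0"
      using norm_triangle_sub[of "?g r" "?g r0"] by linarith
    also have "\<dots> \<le> norm (?g r0) * r + C1 * r"
    proof -
      have "norm (?g r0) * 1 \<le> norm (?g r0) * r" using r r0 by (intro mult_left_mono) auto
      moreover have "0 \<le> C1 * r0" using C1 r0 by simp
      ultimately show ?thesis by linarith
    qed
    finally have "norm (?g r) \<le> (norm (?g r0) + C1) * r" by (simp add: algebra_simps)
    moreover have "norm (?g r) = norm (?\<beta> r)" unfolding norm_mult[of _ "exp _"] ne by simp
    ultimately show "norm (?\<beta> r) \<le> (norm (?g r0) + C1) * r" by simp
  qed
  \<comment> \<open>Up to the phase, r times the outgoing defect of \<open>q0\<close>: the
    polynomial z \<theta>' - n \<theta>, whose top coefficient cancels. This gains one power of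
    r.\<close>
  let ?P = "pCons 0 (pderiv (rbp n)) - smult (of_nat n) (rbp n)"
  have "degree ?P \<le> n - 1"
  proof (rule degree_le, intro allI impI)
    fix i assume i: "n - 1 < i"
    then obtain j where j: "i = Suc j" by (cases i) auto
    show "coeff ?P i = 0"
    proof (cases "i = n")
      case True
      then have "n = Suc j" using j by simp
      then have "of_nat n = (of_nat (Suc j) :: complex)" by (simp only:)
      then show ?thesis unfolding j by (simp add: coeff_pderiv coeff_rbp del: rbc.simps(2))
    next
      case False
      then have "rbc n i = 0" using i by (intro rbc_zero) simp
      then show ?thesis using j by (simp add: coeff_pderiv coeff_rbp del: rbc.simps(2))
    qed
  qed
  then obtain C2 where C2: "\<And>r. r \<ge> 1 \<Longrightarrow> norm (poly ?P (- \<i> * of_real k * of_real r)) \<le> C2 * r^(n-1)"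
    using poly_growth by blast
  obtain C3 where C3: "\<And>r. r \<ge> 1 \<Longrightarrow> norm (poly (rbp n) (- \<i> * of_real k * of_real r)) \<le> C3 * r^n"
    using poly_growth[OF degree_rbp] by blast
  have ne: "norm (exp (\<i> * of_real k * complex_of_real x)) = 1" for x
    by (simp add: norm_exp_eq_Re)
  have bound: "norm (wron r) \<le> (A * C2 + C1 * C3) / r" if r: "r \<ge> r0" for r
  proof -
    have r1: "r \<ge> 1" "r > 0" using r r0 by auto
    let ?z = "- \<i> * of_real k * complex_of_real r"
    have S: "of_real r * (q1 n k r - of_nat n / of_real r * q0 n k r - \<i> * of_real k * q0 n k r) = exp (\<i> * of_real k * of_real r) * poly ?P ?z"
      using r1 by (simp add: q1_def q0_def field_simps)
    have "r * norm (q1 n k r - of_nat n / of_real r * q0 n k r - \<i> * of_real k * q0 n k r) = norm (poly ?P ?z)"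
      using arg_cong[OF S, of norm] ne[of r] r1 by (simp add: norm_mult)
    also have "\<dots> \<le> C2 * r^(n-1)" by (rule C2[OF r1(1)])
    finally have 1: "norm (q1 n k r - of_nat n / of_real r * q0 n k r - \<i> * of_real k * q0 n k r) \<le> C2 * r^(n-1) / r"
      using r1 by (simp add: field_simps)
    have 2: "norm (q0 n k r) \<le> C3 * r^n"
      unfolding q0_def norm_mult ne using C3[OF r1(1)] by simp
    have eqw: "wron r = ?\<beta> r * ((q1 n k r - of_nat n / of_real r * q0 n k r - \<i> * of_real k * q0 n k r) * of_real (inverse (r^n)))
       - (q0 n k r * of_real (inverse (r^n))) * ((K r + M r - \<i> * of_real k * ext_q r) * of_real (inverse (r^n)))"
    proof -
      define a where "a = complex_of_real (inverse (r^n))"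
      define t where "t = of_nat n / complex_of_real r"
      have aa: "complex_of_real (inverse (r^(2*n))) = a * a" by (simp add: a_def mult_2 power_add)
      have qt: "ext_q r * t = of_nat n * M r" using r1 by (simp add: t_def ext_q_def)
      have "wron r - (ext_q r * a * ((q1 n k r - t * q0 n k r - \<i> * of_real k * q0 n k r) * a)
         - (q0 n k r * a) * ((K r + M r - \<i> * of_real k * ext_q r) * a)) = a * a * q0 n k r * (ext_q r * t - of_nat n * M r)"
        unfolding wron_def aa ext_d_def by (simp add: algebra_simps)
      also have "\<dots> = 0" by (simp add: qt)
      finally show ?thesis by (simp add: a_def t_def)
    qed
    have "norm (wron r) \<le> (A * r) * (C2 * r^(n-1) / r * inverse (r^n)) + (C3 * r^n * inverse (r^n)) * (C1 * r^n / r * inverse (r^n))"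
      unfolding eqw
    proof (rule order_trans[OF norm_triangle_ineq4], rule add_mono)
      have ni: "norm (complex_of_real (inverse (r^n))) = inverse (r^n)" using r1 by (simp add: norm_power norm_inverse)
      have A0: "0 \<le> A * r" using A[OF r] norm_ge_zero order_trans by blast
      show "norm (?\<beta> r * ((q1 n k r - of_nat n / of_real r * q0 n k r - \<i> * of_real k * q0 n k r) * of_real (inverse (r^n))))
         \<le> (A * r) * (C2 * r^(n-1) / r * inverse (r^n))"
        unfolding norm_mult ni
        by (rule mult_mono[OF A[OF r, unfolded norm_mult ni] mult_right_mono[OF 1] A0]) (use r1 in auto)
      have "0 \<le> C3 * r^n" using 2 norm_ge_zero order_trans by blast
      then show "norm ((q0 n k r * of_real (inverse (r^n))) * ((K r + M r - \<i> * of_real k * ext_q r) * of_real (inverse (r^n))))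
         \<le> (C3 * r^n * inverse (r^n)) * (C1 * r^n / r * inverse (r^n))"
        unfolding norm_mult ni
        by (intro mult_mono[OF mult_right_mono[OF 2] mult_right_mono[OF X[OF r]]]) (use r1 in auto)
    qed
    also have "\<dots> = (A * C2 + C1 * C3) / r"
    proof -
      have "r^n = r^(n-1) * r" using n power_minus_mult[of n r] by simp
      then show ?thesis using r1 by (simp add: field_simps)
    qed
    finally show ?thesis .
  qed
  assume r: "r > 1"
  have "(wron \<longlongrightarrow> 0) at_top"
  proof (rule Lim_null_comparison)
    show "eventually (\<lambda>r. norm (wron r) \<le> (A * C2 + C1 * C3) / r) at_top"
      using eventually_ge_at_top[of r0] by eventually_elim (rule bound)
    show "((\<lambda>r. (A * C2 + C1 * C3) / r) \<longlongrightarrow> 0) at_top"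
      by (intro tendsto_divide_0[OF tendsto_const] filterlim_at_top_imp_at_infinity filterlim_ident)
  qed
  moreover have "(wron \<longlongrightarrow> wron r) at_top"
  proof (rule tendsto_eventually)
    show "eventually (\<lambda>s. wron s = wron r) at_top"
      using eventually_gt_at_top[of 1]
    proof eventually_elim
      case (elim s)
      then show ?case by (rule const[OF _ r])
    qed
  qed
  ultimately show "wron r = 0"
    using tendsto_unique[OF trivial_limit_at_top_linorder] by blast
qed

text \<open>A vanishing Wronskian makes \<open>ext_q\<close> / \<open>q0\<close> constant where
  \<open>q0\<close> has no zeros, and for k r \<le> 1/100 the polynomial factor of \<open>q0\<close>
  is close to 1.\<close>

lemma exterior_mode:
  assumes b: "\<And>r. r \<in> {1<..<b} \<Longrightarrow> k * r \<le> 1/100" and b1: "b > 1"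
  obtains c where "\<And>r. r \<in> {1<..<b} \<Longrightarrow> M r = c * q0 n k r / of_real r"
    and "\<And>r. r \<in> {1<..<b} \<Longrightarrow> K r = c * (q1 n k r - (of_nat n + 1) * q0 n k r / of_real r)"
proof -
  have nz: "q0 n k r \<noteq> 0" if r: "r \<in> {1<..<b}" for r
  proof
    assume "q0 n k r = 0"
    then have 0: "poly (rbp n) (- \<i> * of_real k * of_real r) = 0" by (simp add: q0_def)
    have "norm (- \<i> * of_real k * complex_of_real r) \<le> 1/100" using b[OF r] k r by (simp add: norm_mult)
    then show False using rbp_near_one(1)[of "- \<i> * of_real k * of_real r" n] 0 by simp
  qed
  have w: "ext_q r * q1 n k r = ext_d r * q0 n k r" if "r \<in> {1<..<b}" for r
    using wron_zero[of r] that by (simp add: wron_def)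
  have "\<exists>c. \<forall>r\<in>{1<..<b}. ext_q r / q0 n k r = c"
  proof (rule has_derivative_zero_constant)
    fix r assume r: "r \<in> {1<..<b}"
    then have r1: "r > 1" by simp
    have "((\<lambda>r. ext_q r / q0 n k r) has_derivative
      (\<lambda>h. (h *\<^sub>R ext_d r * q0 n k r - ext_q r * (h *\<^sub>R q1 n k r)) / (q0 n k r * q0 n k r))) (at r)"
      by (rule has_derivative_divide')
         (use ext_q_deriv[OF r1] q0_deriv nz[OF r] in \<open>auto simp: has_vector_derivative_def\<close>)
    moreover have "(\<lambda>h::real. (h *\<^sub>R ext_d r * q0 n k r - ext_q r * (h *\<^sub>R q1 n k r)) / (q0 n k r * q0 n k r)) = (\<lambda>h. 0)"
      by (simp add: fun_eq_iff w[OF r])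
    ultimately have "((\<lambda>r. ext_q r / q0 n k r) has_derivative (\<lambda>h. 0)) (at r)" by (simp only:)
    then show "((\<lambda>r. ext_q r / q0 n k r) has_derivative (\<lambda>h. 0)) (at r within {1<..<b})"
      by (rule has_derivative_at_withinI)
  qed simp
  then obtain c where c': "\<And>r. r \<in> {1<..<b} \<Longrightarrow> ext_q r / q0 n k r = c" by blast
  have c: "ext_q r = c * q0 n k r" if "r \<in> {1<..<b}" for r
    using nz[OF that] c'[OF that] by (simp add: divide_eq_eq)
  show thesis
  proof
    fix r assume r: "r \<in> {1<..<b}"
    then have r0: "r > 0" by simp
    show M: "M r = c * q0 n k r / of_real r" using c[OF r] r0 by (simp add: ext_q_def field_simps)
    have "ext_d r = c * q1 n k r" using w[OF r] c[OF r] nz[OF r] by simp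
    then show "K r = c * (q1 n k r - (of_nat n + 1) * q0 n k r / of_real r)"
      unfolding ext_d_def M using r0 by (simp add: field_simps)
  qed
qed

end

section \<open>The incident field and the boundary layers\<close>

lemma degree_pderiv_iterate:
  fixes p :: "real poly"
  assumes "p \<noteq> 0" "m \<le> degree p"
  shows "(pderiv ^^ m) p \<noteq> 0 \<and> degree ((pderiv ^^ m) p) = degree p - m"
  using assms(2)
proof (induction m)
  case (Suc m)
  then have IH: "(pderiv ^^ m) p \<noteq> 0" "degree ((pderiv ^^ m) p) = degree p - m" by auto
  then have "degree ((pderiv ^^ m) p) > 0" using Suc.prems by simp
  then have "pderiv ((pderiv ^^ m) p) \<noteq> 0" by (simp add: pderiv_eq_0_iff)
  then show ?case using IH by (simp add: degree_pderiv)
qed (use assms(1) in simp)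

text \<open>The \<open>n\<close>-th derivative of a polynomial of degree \<open>n\<close> is a
  nonzero constant, so only the power of the square root remains.\<close>

lemma assoc_legendre_diag: "\<exists>c. c \<noteq> 0 \<and> (\<forall>t. assoc_legendre n n t = c * sqrt (1 - t\<^sup>2) ^ n)"
proof -
  let ?p = "[:-1, 0, 1:] ^ n :: real poly"
  have d: "degree ?p = 2 * n" "?p \<noteq> 0" by (auto simp: degree_power_eq)
  let ?q = "(pderiv ^^ n) ?p"
  have q: "?q \<noteq> 0" "degree ?q = n" using degree_pderiv_iterate[OF d(2), of n] d(1) by auto
  have l: "legendre_poly n \<noteq> 0" "degree (legendre_poly n) = n"
    using q by (auto simp: legendre_poly_def)
  let ?r = "(pderiv ^^ n) (legendre_poly n)"
  have r: "?r \<noteq> 0" "degree ?r = 0" using degree_pderiv_iterate[OF l(1), of n] l(2) by auto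
  then obtain c where c: "?r = [:c:]" by (metis degree_eq_zeroE)
  with r have "c \<noteq> 0" by auto
  moreover have "assoc_legendre n n t = c * sqrt (1 - t\<^sup>2) ^ n" for t
    by (simp add: assoc_legendre_def c)
  ultimately show ?thesis by blast
qed

text \<open>With \<zeta> = x1 + i x2 one has sin \<theta> e^(i \<phi>) = \<zeta> / |y|, and
  \<open>zb\<close> is the conjugate of \<zeta>.\<close>

lemma sph_harm_diag:
  assumes n: "n \<ge> 1"
  shows "\<exists>c. c \<noteq> 0 \<and> (\<forall>y. y \<noteq> 0 \<longrightarrow> sph_harm n (int n) (polar_angle y) (azimuth y) = c * cnj (zb y) ^ n * of_real (inverse (norm y) ^ n))"
proof -
  obtain a where a: "a \<noteq> 0" "\<And>t. assoc_legendre n n t = a * sqrt (1 - t\<^sup>2) ^ n"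
    using assoc_legendre_diag by blast
  define b where "b = sqrt ((2 * real n + 1) / (4 * pi) * (fact (n - n) / fact (n + n))) * a"
  have b: "b \<noteq> 0" using a(1) by (simp add: b_def add_nonneg_eq_0_iff)
  have "sph_harm n (int n) (polar_angle y) (azimuth y) = of_real b * cnj (zb y) ^ n * of_real (inverse (norm y) ^ n)"
    if y: "y \<noteq> 0" for y
  proof -
    define \<zeta> where "\<zeta> = Complex (y$1) (y$2)"
    have z: "cnj (zb y) = \<zeta>" by (simp add: zb_def cx_def \<zeta>_def complex_eq_iff)
    have ny: "norm y > 0" using y by simp
    have y2: "(norm y)^2 = (y$1)^2 + (y$2)^2 + (y$3)^2"
      unfolding power2_norm_eq_inner by (simp add: inner_vec_def sum_3 power2_eq_square)
    have "\<bar>y$3\<bar> \<le> norm y" by (rule component_le_norm_cart)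
    then have "-1 \<le> y$3 / norm y" "y$3 / norm y \<le> 1" using ny by (auto simp: field_simps)
    then have c: "cos (polar_angle y) = y$3 / norm y" by (simp add: polar_angle_def cos_arccos)
    have "1 - (y$3 / norm y)^2 = ((norm y)^2 - (y$3)^2) / (norm y)^2"
      using ny by (simp add: diff_divide_distrib power_divide)
    also have "\<dots> = (norm \<zeta> / norm y)^2"
      using y2 by (simp add: \<zeta>_def cmod_power2 power_divide)
    finally have "1 - (y$3 / norm y)^2 = (norm \<zeta> / norm y)^2" .
    then have s: "sqrt (1 - (cos (polar_angle y))^2) = norm \<zeta> / norm y" unfolding c by simp
    have e: "exp (\<i> * of_int (int n) * of_real (azimuth y)) = exp (\<i> * of_real (azimuth y)) ^ n"
      by (simp add: exp_of_nat_mult[symmetric] mult_ac)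
    have "\<zeta> = of_real (norm \<zeta>) * exp (\<i> * of_real (azimuth y))"
    \<comment> \<open>On the polar axis both sides are 0, whatever the azimuth.\<close>
    proof (cases "\<zeta> = 0")
      case False
      then show ?thesis using Arg_eq[OF False] by (simp add: azimuth_def \<zeta>_def)
    qed simp
    then have ze: "\<zeta> ^ n = of_real (norm \<zeta>) ^ n * exp (\<i> * of_real (azimuth y)) ^ n"
      by (metis power_mult_distrib)
    have "sph_harm n (int n) (polar_angle y) (azimuth y)
      = of_real (b * (norm \<zeta> / norm y)^n) * exp (\<i> * of_real (azimuth y)) ^ n"
      unfolding sph_harm_def e[symmetric] by (simp add: a(2) s b_def)
    also have "\<dots> = of_real b * \<zeta> ^ n * of_real (inverse (norm y) ^ n)"
      unfolding ze by (simp add: power_divide divide_inverse power_inverse power_mult_distrib)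
    finally show ?thesis by (simp add: z)
  qed
  then show ?thesis using b by (intro exI[of _ "of_real b"]) auto
qed

lemma has_derivative_cnj_zb: "((\<lambda>x. cnj (zb x)) has_derivative (\<lambda>h. \<Sum>j\<in>UNIV. h$j *\<^sub>R cnj (zc j))) (at x)"
proof -
  have "((\<lambda>x. cnj (zb x)) has_derivative (\<lambda>h. cnj (\<Sum>j\<in>UNIV. h$j *\<^sub>R zc j))) (at x)"
    by (rule bounded_linear.has_derivative[OF bounded_linear_cnj has_derivative_zb])
  then show ?thesis by simp
qed

lemma cnj_vb: "cnj (vb n i x) = cnj (zb x) ^ (n - 1) * cnj (vlin i x)"
  by (simp add: vb_def)

text \<open>The extension constant along rays is a multiple of \<zeta>^n |y|^(-n). Differentiating
  the second factor only adds a radial vector, which the cross product with the normal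
  annihilates.\<close>

lemma vsh_T_diag:
  assumes n: "n \<ge> 1"
  shows "\<exists>c. c \<noteq> 0 \<and> (\<forall>x i. x \<noteq> 0 \<longrightarrow> vsh_T n (int n) x $ i = c * cnj (vb n i (x /\<^sub>R norm x)))"
proof -
  obtain c where c: "c \<noteq> 0" "\<And>y. y \<noteq> 0 \<Longrightarrow> sph_harm n (int n) (polar_angle y) (azimuth y) = c * cnj (zb y) ^ n * of_real (inverse (norm y) ^ n)"
    using sph_harm_diag[OF n] by blast
  let ?g = "\<lambda>y. sph_harm n (int n) (polar_angle y) (azimuth y)"
  have "vsh_T n (int n) x $ i = (\<i> * of_nat n * c) * cnj (vb n i (x /\<^sub>R norm x))" if x: "x \<noteq> 0" for x i
  proof -
    define p where "p = x /\<^sub>R norm x"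
    have np: "norm p = 1" using x by (simp add: p_def)
    then have p0: "p \<noteq> 0" by auto
    let ?Z = "\<lambda>y. c * cnj (zb y) ^ n" and ?N = "\<lambda>y::real^3. complex_of_real (inverse (norm y) ^ n)"
    have dz: "(\<lambda>y. cnj (zb y)) differentiable (at p)" using has_derivative_cnj_zb by (auto simp: differentiable_def)
    have dZ: "?Z differentiable (at p)" by (intro differentiable_mult differentiable_power dz) simp
    have pZ: "partial j ?Z p = c * (of_nat n * cnj (zb p) ^ (n - 1) * cnj (zc j))" for j
    proof -
      have "partial j (\<lambda>y. cnj (zb y)) p = (\<Sum>k\<in>UNIV. axis j 1 $ k *\<^sub>R cnj (zc k))"
        by (rule partial_eq[OF has_derivative_cnj_zb])
      also have "\<dots> = (\<Sum>k\<in>UNIV. if k = j then cnj (zc k) else 0)"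
        by (rule sum.cong) (auto simp: axis_def)
      finally have "partial j (\<lambda>y. cnj (zb y)) p = cnj (zc j)" by simp
      then show ?thesis by (simp add: partial_mult partial_power[OF dz] differentiable_power[OF dz])
    qed
    have "((\<lambda>y. inverse (norm y) ^ n) has_derivative (\<lambda>h. of_nat n * (- (inverse (norm p) * (h \<bullet> sgn p) * inverse (norm p))) * inverse (norm p) ^ (n - 1))) (at p)"
      using has_derivative_power[OF Deriv.has_derivative_inverse[OF _ has_derivative_norm[OF p0]], of n] p0
      by (simp add: inner_commute)
    then have "((\<lambda>y. inverse (norm y) ^ n) has_derivative (\<lambda>h. - real n * (h \<bullet> p))) (at p)"
      by (simp add: np sgn_div_norm)
    then have N': "(?N has_derivative (\<lambda>h. of_real (- real n * (h \<bullet> p)))) (at p)"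
      by (rule bounded_linear.has_derivative[OF bounded_linear_of_real])
    then have dN: "?N differentiable (at p)" by (auto simp: differentiable_def)
    have pN: "partial j ?N p = - of_nat n * cx j p" for j
      using partial_eq[OF N', of j] by (simp add: inner_axis' cx_def)
    have gr: "grad (\<lambda>y. ?g (y /\<^sub>R norm y)) p $ j = c * (of_nat n * cnj (zb p) ^ (n - 1) * cnj (zc j)) + ?Z p * (- of_nat n * cx j p)" for j
    proof -
      have "partial j (\<lambda>y. ?g (y /\<^sub>R norm y)) p = partial j (\<lambda>y. ?Z y * ?N y) p"
      proof (rule partial_cong[of "- {0}"])
        fix y :: "real^3" assume "y \<in> - {0}"
        then have y: "y \<noteq> 0" by simp
        then have "y /\<^sub>R norm y \<noteq> 0" by simp
        from c(2)[OF this] show "?g (y /\<^sub>R norm y) = ?Z y * ?N y"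
          using y by (simp add: zb_scale power_mult_distrib)
      qed (use p0 in auto)
      also have "\<dots> = partial j ?Z p * ?N p + ?Z p * partial j ?N p"
        by (rule partial_mult[OF dZ dN])
      finally show ?thesis unfolding grad_def pZ pN by (simp add: np)
    qed
    have cv: "cvec p $ j = cx j p" for j by (simp add: cvec_def cx_def)
    have "vsh_T n (int n) x = ccross (grad (\<lambda>y. ?g (y /\<^sub>R norm y)) p) (cvec p)"
      by (simp add: vsh_T_def surface_grad_def p_def)
    then have "vsh_T n (int n) x $ i = (\<i> * of_nat n * c) * (cnj (zb p) ^ (n - 1) * cnj (vlin i p))"
      using exhaust_3[of i]
      by (auto simp: ccross_def gr cv zc_def vlin_def zb_def cx_def algebra_simps)
    then show ?thesis by (simp add: cnj_vb p_def)
  qed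
  moreover have "\<i> * of_nat n * c \<noteq> 0" using c(1) n by simp
  ultimately show ?thesis by blast
qed

text \<open>The double factorial grows by a factor of at least 3 per term, so the tail is at most
  1/3 + 1/9 + ... = 1/2 of the leading term \<open>T\<close>. Positivity ensures that the incident
  mode is not zero.\<close>

lemma sph_bessel_j_pos:
  assumes z: "0 < z" "z \<le> 1"
  shows "sph_bessel_j n z > 0"
proof -
  let ?P = "\<lambda>m. \<Prod>i\<le>m. real (2*i + 1)"
  let ?t = "\<lambda>k. (-1)^k * z^(n + 2*k) / (2^k * fact k * ?P (n + k))"
  define T where "T = z^n / ?P n"
  have P: "?P m > 0" for m by (intro prod_pos) auto
  have P3: "?P n * 3^k \<le> ?P (n + k)" for k
  proof (induction k)
    case (Suc k)
    have "?P n * 3^k * 3 \<le> ?P (n + k) * real (2 * (n + Suc k) + 1)"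
      by (rule mult_mono[OF Suc]) (use less_imp_le[OF P] in auto)
    then show ?case by (simp add: mult_ac)
  qed simp
  have T: "T > 0" unfolding T_def using z P[of n] by simp
  have b: "norm (?t k) \<le> T * (1/3)^k" for k
  proof -
    have "norm (?t k) = z^(n + 2*k) / (2^k * fact k * ?P (n + k))"
      using z less_imp_le[OF P[of "n+k"]] by (simp add: abs_mult power_abs)
    also have "\<dots> \<le> z^n / (1 * (?P n * 3^k))"
    proof (rule frac_le)
      show "z^(n + 2*k) \<le> z^n" using z by (intro power_decreasing) auto
      have "(1::real) * 1 \<le> 2^k * fact k" by (intro mult_mono) auto
      then show "1 * (?P n * 3^k) \<le> 2^k * fact k * ?P (n + k)"
        by (intro mult_mono P3) (use less_imp_le[OF P[of n]] in auto)
    qed (use z P[of n] in auto)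
    also have "\<dots> = T * (1/3)^k" by (simp add: T_def power_divide)
    finally show ?thesis .
  qed
  have sg: "summable (\<lambda>k. T * (1/3)^k)" by (intro summable_mult summable_geometric) simp
  then have s: "summable ?t" using b by (intro summable_comparison_test'[OF sg, of 0]) auto
  have "sph_bessel_j n z = (\<Sum>k. ?t k)" by (simp add: sph_bessel_j_def)
  also have "\<dots> = (\<Sum>k. ?t (Suc k)) + ?t 0" using suminf_split_head[OF s] by simp
  also have "?t 0 = T" by (simp add: T_def)
  finally have e: "sph_bessel_j n z = (\<Sum>k. ?t (Suc k)) + T" .
  have sg': "(\<lambda>k. T * (1/3)^(Suc k)) sums (T / 2)"
    using sums_mult[OF geometric_sums[of "1/3::real"], of "T/3"] by (simp add: field_simps)
  have "norm (\<Sum>k. ?t (Suc k)) \<le> (\<Sum>k. T * (1/3)^(Suc k))"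
    by (rule norm_suminf_le) (use b[of "Suc _"] sg' in \<open>auto simp: sums_iff\<close>)
  also have "\<dots> = T / 2" using sg' by (simp add: sums_iff)
  finally show ?thesis using e T by (simp add: abs_le_iff)
qed

lemma infdist_sphere: "infdist x (sphere 0 1) = \<bar>norm x - 1\<bar>" for x :: "real^3"
proof (rule antisym)
  have ne: "sphere (0::real^3) 1 \<noteq> {}" by auto
  show "\<bar>norm x - 1\<bar> \<le> infdist x (sphere 0 1)"
    unfolding infdist_notempty[OF ne]
  proof (rule cINF_greatest[OF ne])
    fix y :: "real^3" assume "y \<in> sphere 0 1"
    then have "norm y = 1" by simp
    then show "\<bar>norm x - 1\<bar> \<le> dist x y" using norm_triangle_ineq3[of x y] by (simp add: dist_norm)
  qed
  show "infdist x (sphere 0 1) \<le> \<bar>norm x - 1\<bar>"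
  proof (cases "x = 0")
    case True
    have "infdist x (sphere 0 1) \<le> dist x (axis 1 1)"
      by (rule infdist_le) (simp add: norm_axis_1)
    then show ?thesis using True by (simp add: norm_axis_1)
  next
    case False
    have "infdist x (sphere 0 1) \<le> dist x (sgn x)"
      by (rule infdist_le) (use False in \<open>simp add: norm_sgn\<close>)
    also have "x - sgn x = (norm x - 1) *\<^sub>R sgn x" using False by (simp add: sgn_div_norm algebra_simps)
    then have "dist x (sgn x) = \<bar>norm x - 1\<bar>" using False by (simp add: dist_norm norm_sgn)
    finally show ?thesis .
  qed
qed

lemma layer_in_ball:
  assumes "0 < \<gamma>" "\<gamma> < 1"
  shows "layer_in (ball 0 1) (1 - \<gamma>) = shell {\<gamma><..<1}"
  using assms by (auto simp: layer_in_def infdist_sphere)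

lemma layer_out_ball:
  assumes "1 < \<gamma>" "\<gamma> < R"
  shows "layer_out (ball 0 1) R (\<gamma> - 1) = shell {1<..<\<gamma>}"
  using assms by (auto simp: layer_out_def infdist_sphere)

text \<open>The averages over directions live on positive radii; the missing origin is a null
  set.\<close>

lemma L2_norm_on_ball:
  assumes "continuous_on (ball 0 1) g"
  shows "L2_norm_on (ball 0 1) g = L2_norm_on (shell {0<..<1}) g"
proof -
  have c: "continuous_on S (\<lambda>x. (norm (g x))\<^sup>2)" if "S \<subseteq> ball 0 1" for S
    by (intro continuous_intros continuous_on_subset[OF assms that])
  have m: "(\<lambda>x. indicator S x *\<^sub>R (norm (g x))\<^sup>2) \<in> borel_measurable lborel" if "S \<subseteq> ball 0 1" "open S" for S
    unfolding measurable_lborel1 measurable_lborel2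
    by (rule borel_measurable_continuous_on_indicator[OF _ c[OF that(1)]]) (use that in auto)
  have "AE x in lborel. x \<noteq> (0::real^3)" by (rule AE_lborel_singleton)
  then have "AE x in lborel. indicator (ball 0 1) x *\<^sub>R (norm (g x))\<^sup>2 = indicator (shell {0<..<1}) x *\<^sub>R (norm (g x))\<^sup>2"
    by eventually_elim (auto simp: indicator_def)
  then have "(LINT x|lborel. indicator (ball 0 1) x *\<^sub>R (norm (g x))\<^sup>2) = (LINT x|lborel. indicator (shell {0<..<1}) x *\<^sub>R (norm (g x))\<^sup>2)"
    by (intro integral_cong_AE m) (auto intro: open_shell)
  then show ?thesis by (simp add: L2_norm_on_def set_lebesgue_integral_def)
qed

section \<open>One-sided limits at the interface\<close>

lemma lame_solution_subset:
  "lame_solution lam mu rho \<omega> T u \<Longrightarrow> S \<subseteq> T \<Longrightarrow> lame_solution lam mu rho \<omega> S u"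
  by (auto simp: lame_solution_def C2_on_def intro: C1_on_subset)

text \<open>The scattered field is tied to the other two only outside the inclusion, so the
  difference is known on \<open>S\<close> alone; openness of \<open>S\<close> transfers the equality
  to the derivatives.\<close>

lemma lame_solution_diff:
  assumes S: "open S" and u: "lame_solution lam mu rho \<omega> S u" and w: "lame_solution lam mu rho \<omega> S w"
    and v: "\<And>x. x \<in> S \<Longrightarrow> v x = u x - w x"
  shows "lame_solution lam mu rho \<omega> S v"
proof -
  have u1: "C1_on S u" "C1_on S (partial j u)" and w1: "C1_on S w" "C1_on S (partial j w)" for j
    using u w by (auto simp: lame_solution_def C2_on_def)
  have p1: "partial j v x = partial j u x - partial j w x" if "x \<in> S" for x j
  proof -
    have "partial j v x = partial j (\<lambda>x. u x - w x) x" by (rule partial_cong[OF S that v])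
    then show ?thesis using u1 w1 that by (simp add: partial_diff C1_on_def)
  qed
  have p2: "partial i (partial j v) x = partial i (partial j u) x - partial i (partial j w) x" if "x \<in> S" for x i j
  proof -
    have "partial i (partial j v) x = partial i (\<lambda>x. partial j u x - partial j w x) x" by (rule partial_cong[OF S that p1])
    then show ?thesis using u1(2) w1(2) that by (simp add: partial_diff C1_on_def)
  qed
  have du: "C1_on S (divergence u)" "C1_on S (divergence w)"
    unfolding divergence_def[abs_def] by (intro C1_on_sum C1_on_nth u1 w1 finite)+
  have pd: "partial i (divergence v) x = partial i (divergence u) x - partial i (divergence w) x" if "x \<in> S" for x i
  proof -
    have "partial i (divergence v) x = partial i (\<lambda>x. divergence u x - divergence w x) x"
      by (rule partial_cong[OF S that]) (simp add: divergence_def p1 sum_subtractf)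
    then show ?thesis using du that by (simp add: partial_diff C1_on_def)
  qed
  have "C1_on S v" by (rule C1_on_cong[OF S _ C1_on_diff[OF u1(1) w1(1)]]) (simp add: v)
  moreover have "C1_on S (partial j v)" for j
    by (rule C1_on_cong[OF S _ C1_on_diff[OF u1(2) w1(2)]]) (simp add: p1)
  moreover have "lame lam mu v x + (\<omega>\<^sup>2 * rho) *\<^sub>R v x = 0" if x: "x \<in> S" for x
  proof -
    have lv: "lame lam mu v x = lame lam mu u x - lame lam mu w x"
      by (simp add: lame_def laplacian_def grad_def p2[OF x] pd[OF x] vec_eq_iff sum_subtractf algebra_simps)
    have 0: "lame lam mu u x + (\<omega>\<^sup>2 * rho) *\<^sub>R u x = 0" "lame lam mu w x + (\<omega>\<^sup>2 * rho) *\<^sub>R w x = 0"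
      using u w x by (auto simp: lame_solution_def)
    have "lame lam mu v x + (\<omega>\<^sup>2 * rho) *\<^sub>R v x
      = (lame lam mu u x + (\<omega>\<^sup>2 * rho) *\<^sub>R u x) - (lame lam mu w x + (\<omega>\<^sup>2 * rho) *\<^sub>R w x)"
      unfolding lv v[OF x] scaleR_diff_right by (simp only: add_diff_add diff_conv_add_uminus ac_simps minus_add_distrib)
    then show ?thesis unfolding 0 by simp
  qed
  ultimately show ?thesis by (simp add: lame_solution_def C2_on_def)
qed

lemma continuous_on_gradv: "C1_on S u \<Longrightarrow> continuous_on S (gradv u)"
  unfolding gradv_def[abs_def] by (intro continuous_intros C1_on_partial_continuous)

section \<open>Pointwise bounds and limits of the projected integrands\<close>

lemma norm_proj_le:
  assumes n: "n \<ge> 1" and B: "norm (u x) \<le> B"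
  shows "norm (proj n u x) \<le> 3 * B * norm x ^ n"
proof -
  have B0: "0 \<le> B" using B norm_ge_zero order_trans by blast
  have "norm (u x $ i * vb n i x) \<le> B * norm x ^ n" for i
    unfolding norm_mult using B norm_vb[OF n] Finite_Cartesian_Product.norm_nth_le[of "u x" i] B0
    by (intro mult_mono) (auto intro: order_trans)
  then have "norm (proj n u x) \<le> (\<Sum>i\<in>(UNIV::3 set). B * norm x ^ n)"
    unfolding proj_def by (intro sum_norm_le) auto
  then show ?thesis by simp
qed

lemma norm_gradv_nth: "norm (A $ i $ j) \<le> norm (A :: complex^3^3)"
  using Finite_Cartesian_Product.norm_nth_le[of "A $ i" j] Finite_Cartesian_Product.norm_nth_le[of A i] by linarith

lemma norm_radproj_le:
  assumes n: "n \<ge> 1" and u: "u differentiable (at x)" and B: "norm (gradv u x) \<le> B"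
  shows "norm (radproj n u x) \<le> 9 * B * norm x ^ (n + 1)"
proof -
  have p: "norm (partial j u x $ i) \<le> B" for i j
    using norm_gradv_nth[of "gradv u x" i j] B by (simp add: gradv_def)
  have B0: "0 \<le> B" using B norm_ge_zero order_trans by blast
  have r: "norm (rad (\<lambda>y. u y $ i) x) \<le> 3 * (norm x * B)" for i
  proof -
    have "norm (cx j x * partial j u x $ i) \<le> norm x * B" for j
      unfolding norm_mult using p norm_cx by (intro mult_mono) auto
    then have "norm (rad (\<lambda>y. u y $ i) x) \<le> (\<Sum>j\<in>(UNIV::3 set). norm x * B)"
      unfolding rad_def partial_nth(1)[OF u] by (intro sum_norm_le) auto
    then show ?thesis by simp
  qed
  have "norm (rad (\<lambda>y. u y $ i) x * vb n i x) \<le> 3 * (norm x * B) * norm x ^ n" for i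
    unfolding norm_mult using r norm_vb[OF n] B0 by (intro mult_mono) auto
  then have "norm (radproj n u x) \<le> (\<Sum>i\<in>(UNIV::3 set). 3 * (norm x * B) * norm x ^ n)"
    unfolding radproj_def by (intro sum_norm_le) auto
  then show ?thesis by (simp add: mult_ac)
qed

lemma norm_tracproj_le:
  assumes n: "n \<ge> 1" and B: "norm (A x) \<le> B"
  shows "norm (tracproj n A x) \<le> 18 * B * norm x ^ (n + 1)"
proof -
  have B0: "0 \<le> B" using B norm_ge_zero order_trans by blast
  have t: "norm ((A x $ i $ j + A x $ j $ i) * cx j x * vb n i x) \<le> (B + B) * norm x * norm x ^ n" for i j
    unfolding norm_mult
    using norm_triangle_le[of "A x $ i $ j" "A x $ j $ i" "B + B"] norm_gradv_nth[of "A x" i j] norm_gradv_nth[of "A x" j i] B B0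
    by (intro mult_mono norm_cx norm_vb n) auto
  have "norm (tracproj n A x) \<le> (\<Sum>i\<in>(UNIV::3 set). \<Sum>j\<in>(UNIV::3 set). (B + B) * norm x * norm x ^ n)"
    unfolding tracproj_def by (intro sum_norm_le t)
  then show ?thesis by (simp add: mult_ac)
qed

lemma continuous_on_tracproj:
  assumes "continuous_on S A"
  shows "continuous_on S (tracproj n A)"
  unfolding tracproj_def[abs_def] by (intro continuous_intros assms)

lemma tendsto_tracproj:
  assumes "(A \<longlongrightarrow> A0) (at x within S)"
  shows "(tracproj n A \<longlongrightarrow> tracproj n (\<lambda>_. A0) x) (at x within S)"
proof -
  have c: "(cx j \<longlongrightarrow> cx j x) (at x within S)" "(vb n i \<longlongrightarrow> vb n i x) (at x within S)" for i j
    using continuous_on_cx[of UNIV j] continuous_on_vb[of UNIV n i]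
    by (auto simp: continuous_on_eq_continuous_at continuous_within intro: tendsto_within_subset)
  show ?thesis unfolding tracproj_def[abs_def]
    by (intro tendsto_intros assms c)
qed

lemma tendsto_proj:
  assumes "(u \<longlongrightarrow> v) (at x within S)"
  shows "(proj n u \<longlongrightarrow> proj n (\<lambda>_. v) x) (at x within S)"
proof -
  have c: "(vb n i \<longlongrightarrow> vb n i x) (at x within S)" for i
    using continuous_on_vb[of UNIV n i]
    by (auto simp: continuous_on_eq_continuous_at continuous_within intro: tendsto_within_subset)
  show ?thesis unfolding proj_def[abs_def]
    by (intro tendsto_intros assms c)
qed

text \<open>\<open>L\<close> marks the points of the outer sphere at which a limit is assumed; its
  other points lie in \<open>S\<close>, where continuity provides one. This treats alike the inner
  shell, bounded outside by the interface, and the outer shell, bounded outside by a sphere within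
  the medium.\<close>

lemma bounded_shell:
  fixes F :: "real^3 \<Rightarrow> 'b::real_normed_vector"
  assumes S: "open S" "shell {a<..<b} \<subseteq> S" "\<And>x. a < norm x \<Longrightarrow> norm x \<le> b \<Longrightarrow> x \<in> S \<or> norm x = b \<and> L x"
    and F: "continuous_on S F"
    and lim: "\<And>x. norm x = a \<or> L x \<Longrightarrow> \<exists>l. (F \<longlongrightarrow> l) (at x within shell {a<..<b})"
  obtains B where "B \<ge> 0" "\<And>x. norm x \<in> {a<..<b} \<Longrightarrow> norm (F x) \<le> B"
proof -
  have "bounded (F ` shell {a<..<b})"
  proof (rule bounded_image_limits)
    have "{x::real^3. a \<le> norm x \<and> norm x \<le> b} = cball 0 b \<inter> - ball 0 a" by auto
    then show "compact {x::real^3. a \<le> norm x \<and> norm x \<le> b}"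
      by (metis compact_Int_closed compact_cball closed_Compl open_ball)
    show "shell {a<..<b} \<subseteq> {x. a \<le> norm x \<and> norm x \<le> b}" by auto
    fix x assume x: "x \<in> {x::real^3. a \<le> norm x \<and> norm x \<le> b}"
    show "\<exists>l. (F \<longlongrightarrow> l) (at x within shell {a<..<b})"
    proof (cases "norm x = a \<or> L x")
      case False
      then have "x \<in> S" using x S(3)[of x] by auto
      then have "isCont F x" using F S(1) by (simp add: continuous_on_eq_continuous_at)
      then show ?thesis by (auto simp: isCont_def intro: tendsto_within_subset)
    qed (rule lim)
  qed
  then obtain B where "\<forall>z\<in>F ` shell {a<..<b}. norm z \<le> B" by (auto simp: bounded_iff)
  then show thesis by (intro that[of "max 0 B"]) (auto simp: le_max_iff_disj)
qed

context
  fixes lam mu lam' mu' b :: real and u :: "real^3 \<Rightarrow> complex^3"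
  assumes tr: "transmission (ball 0 1) (\<lambda>x. x /\<^sub>R norm x) lam mu lam' mu' u"
    and ui: "C1_on (ball 0 1) u" and uo: "C1_on (- closure (ball 0 1)) u" and b: "b > 1"
begin

lemma bounded_inside:
  obtains B where "B \<ge> 0" "\<And>x. norm x \<in> {0<..<1} \<Longrightarrow> norm (u x) \<le> B \<and> norm (gradv u x) \<le> B"
proof -
  have sub: "shell {0<..<1} \<subseteq> ball 0 1" by auto
  have l1: "\<exists>l. (u \<longlongrightarrow> l) (at x within shell {0<..<1})" if "norm x = 0 \<or> norm x = 1" for x
  proof (cases "norm x = 1")
    case True
    then obtain v where "(u \<longlongrightarrow> v) (at x within ball 0 1)" using tr by (fastforce simp: transmission_def)
    then show ?thesis using sub tendsto_within_subset by blast
  next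
    case False
    then have "x \<in> ball 0 1" using that by simp
    then have "isCont u x" using C1_on_continuous[OF ui] by (simp add: continuous_on_eq_continuous_at)
    then show ?thesis by (auto simp: isCont_def intro: tendsto_within_subset)
  qed
  have l2: "\<exists>l. (gradv u \<longlongrightarrow> l) (at x within shell {0<..<1})" if "norm x = 0 \<or> norm x = 1" for x
  proof (cases "norm x = 1")
    case True
    then obtain v where "(gradv u \<longlongrightarrow> v) (at x within ball 0 1)" using tr by (fastforce simp: transmission_def)
    then show ?thesis using sub tendsto_within_subset by blast
  next
    case False
    then have "x \<in> ball 0 1" using that by simp
    then have "isCont (gradv u) x" using continuous_on_gradv[OF ui] by (simp add: continuous_on_eq_continuous_at)
    then show ?thesis by (auto simp: isCont_def intro: tendsto_within_subset)
  qed
  obtain B1 where B1: "B1 \<ge> 0" "\<And>x. norm x \<in> {0<..<1} \<Longrightarrow> norm (u x) \<le> B1"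
    by (rule bounded_shell[where S="ball 0 1" and a=0 and b=1 and L="\<lambda>x. norm x = 1", OF open_ball sub _ C1_on_continuous[OF ui] l1]) auto
  obtain B2 where B2: "B2 \<ge> 0" "\<And>x. norm x \<in> {0<..<1} \<Longrightarrow> norm (gradv u x) \<le> B2"
    by (rule bounded_shell[where S="ball 0 1" and a=0 and b=1 and L="\<lambda>x. norm x = 1", OF open_ball sub _ continuous_on_gradv[OF ui] l2]) auto
  show thesis
  proof (rule that)
    show "0 \<le> max B1 B2" using B1 by simp
    show "norm (u x) \<le> max B1 B2 \<and> norm (gradv u x) \<le> max B1 B2" if "norm x \<in> {0<..<1}" for x
      using B1(2)[OF that] B2(2)[OF that] by auto
  qed
qed

lemma bounded_outside:
  obtains B where "B \<ge> 0" "\<And>x. norm x \<in> {1<..<b} \<Longrightarrow> norm (u x) \<le> B \<and> norm (gradv u x) \<le> B"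
proof -
  have sub: "shell {1<..<b} \<subseteq> - closure (ball 0 1)" by auto
  have l1: "\<exists>l. (u \<longlongrightarrow> l) (at x within shell {1<..<b})" if "norm x = 1 \<or> False" for x
  proof -
    from that obtain v where "(u \<longlongrightarrow> v) (at x within - closure (ball 0 1))" using tr by (fastforce simp: transmission_def)
    then show ?thesis using sub tendsto_within_subset by blast
  qed
  have l2: "\<exists>l. (gradv u \<longlongrightarrow> l) (at x within shell {1<..<b})" if "norm x = 1 \<or> False" for x
  proof -
    from that obtain v where "(gradv u \<longlongrightarrow> v) (at x within - closure (ball 0 1))" using tr by (fastforce simp: transmission_def)
    then show ?thesis using sub tendsto_within_subset by blast
  qed
  obtain B1 where B1: "B1 \<ge> 0" "\<And>x. norm x \<in> {1<..<b} \<Longrightarrow> norm (u x) \<le> B1"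
    by (rule bounded_shell[where S="- closure (ball 0 1)" and a=1 and b=b and L="\<lambda>x. False", OF _ sub _ C1_on_continuous[OF uo] l1]) auto
  obtain B2 where B2: "B2 \<ge> 0" "\<And>x. norm x \<in> {1<..<b} \<Longrightarrow> norm (gradv u x) \<le> B2"
    by (rule bounded_shell[where S="- closure (ball 0 1)" and a=1 and b=b and L="\<lambda>x. False", OF _ sub _ continuous_on_gradv[OF uo] l2]) auto
  show thesis
  proof (rule that)
    show "0 \<le> max B1 B2" using B1 by simp
    show "norm (u x) \<le> max B1 B2 \<and> norm (gradv u x) \<le> max B1 B2" if "norm x \<in> {1<..<b}" for x
      using B1(2)[OF that] B2(2)[OF that] by auto
  qed
qed

text \<open>The common limit \<open>m\<close> is continuity of the displacement. By
  \<open>smean_tracproj\<close> the differences K - M are the projected tractions divided by the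
  shear modulus, so continuity of the traction links \<open>ei\<close> and
  \<open>eo\<close>.\<close>

lemma transmission_modes:
  assumes n: "n \<ge> 1"
  obtains m ei eo where
    "(smean (proj n u) \<longlongrightarrow> m) (at 1 within {0<..<1})" "(smean (proj n u) \<longlongrightarrow> m) (at 1 within {1<..<b})"
    "((\<lambda>r. smean (radproj n u) r - smean (proj n u) r) \<longlongrightarrow> ei) (at 1 within {0<..<1})"
    "((\<lambda>r. smean (radproj n u) r - smean (proj n u) r) \<longlongrightarrow> eo) (at 1 within {1<..<b})"
    "of_real mu' * ei = of_real mu * eo"
proof -
  have si: "shell {0<..<1} \<subseteq> ball 0 1" and so: "shell {1<..<b} \<subseteq> - closure (ball 0 1)" by auto
  have ui': "C1_on (shell {0<..<1}) u" and uo': "C1_on (shell {1<..<b}) u"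
    using ui uo si so C1_on_subset by blast+
  have "\<forall>x. norm x = 1 \<longrightarrow> (\<exists>v A B. (u \<longlongrightarrow> v) (at x within ball 0 1) \<and> (u \<longlongrightarrow> v) (at x within - closure (ball 0 1))
     \<and> (gradv u \<longlongrightarrow> A) (at x within ball 0 1) \<and> (gradv u \<longlongrightarrow> B) (at x within - closure (ball 0 1))
     \<and> traction lam' mu' A x = traction lam mu B x)"
  proof (intro allI impI)
    fix x :: "real^3" assume x: "norm x = 1"
    then have "x \<in> frontier (ball 0 1)" "x /\<^sub>R norm x = x" by simp_all
    with tr show "\<exists>v A B. (u \<longlongrightarrow> v) (at x within ball 0 1) \<and> (u \<longlongrightarrow> v) (at x within - closure (ball 0 1))
     \<and> (gradv u \<longlongrightarrow> A) (at x within ball 0 1) \<and> (gradv u \<longlongrightarrow> B) (at x within - closure (ball 0 1))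
     \<and> traction lam' mu' A x = traction lam mu B x"
      unfolding transmission_def by metis
  qed
  then obtain v A B where vAB: "\<And>x. norm x = 1 \<Longrightarrow> (u \<longlongrightarrow> v x) (at x within ball 0 1)"
    "\<And>x. norm x = 1 \<Longrightarrow> (u \<longlongrightarrow> v x) (at x within - closure (ball 0 1))"
    "\<And>x. norm x = 1 \<Longrightarrow> (gradv u \<longlongrightarrow> A x) (at x within ball 0 1)"
    "\<And>x. norm x = 1 \<Longrightarrow> (gradv u \<longlongrightarrow> B x) (at x within - closure (ball 0 1))"
    "\<And>x. norm x = 1 \<Longrightarrow> traction lam' mu' (A x) x = traction lam mu (B x) x"
    by metis
  obtain Bi where Bi: "Bi \<ge> 0" "\<And>x. norm x \<in> {0<..<1} \<Longrightarrow> norm (u x) \<le> Bi \<and> norm (gradv u x) \<le> Bi"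
    using bounded_inside by blast
  obtain Bo where Bo: "Bo \<ge> 0" "\<And>x. norm x \<in> {1<..<b} \<Longrightarrow> norm (u x) \<le> Bo \<and> norm (gradv u x) \<le> Bo"
    using bounded_outside by blast
  have pi: "norm (proj n u x) \<le> 3 * Bi" and ti: "norm (tracproj n (gradv u) x) \<le> 18 * Bi" if x: "norm x \<in> {0<..<1}" for x
  proof -
    have le: "norm x ^ n \<le> 1" "norm x ^ (n + 1) \<le> 1" using x by (auto intro!: power_le_one simp del: power_Suc)
    have "norm (proj n u x) \<le> 3 * Bi * norm x ^ n" using norm_proj_le[OF n] Bi(2)[OF x] by blast
    also have "\<dots> \<le> 3 * Bi * 1" by (rule mult_left_mono[OF le(1)]) (use Bi in auto)
    finally show "norm (proj n u x) \<le> 3 * Bi" by simp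
    have "norm (tracproj n (gradv u) x) \<le> 18 * Bi * norm x ^ (n + 1)" using norm_tracproj_le[OF n] Bi(2)[OF x] by blast
    also have "\<dots> \<le> 18 * Bi * 1" by (rule mult_left_mono[OF le(2)]) (use Bi in auto)
    finally show "norm (tracproj n (gradv u) x) \<le> 18 * Bi" by simp
  qed
  have po: "norm (proj n u x) \<le> 3 * Bo * b^n" and to: "norm (tracproj n (gradv u) x) \<le> 18 * Bo * b^(n+1)" if x: "norm x \<in> {1<..<b}" for x
  proof -
    have le: "norm x ^ n \<le> b^n" "norm x ^ (n + 1) \<le> b^(n+1)" using x by (auto intro!: power_mono simp del: power_Suc)
    have "norm (proj n u x) \<le> 3 * Bo * norm x ^ n" using norm_proj_le[OF n] Bo(2)[OF x] by blast
    also have "\<dots> \<le> 3 * Bo * b^n" by (rule mult_left_mono[OF le(1)]) (use Bo in auto)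
    finally show "norm (proj n u x) \<le> 3 * Bo * b^n" by simp
    have "norm (tracproj n (gradv u) x) \<le> 18 * Bo * norm x ^ (n + 1)" using norm_tracproj_le[OF n] Bo(2)[OF x] by blast
    also have "\<dots> \<le> 18 * Bo * b^(n+1)" by (rule mult_left_mono[OF le(2)]) (use Bo in auto)
    finally show "norm (tracproj n (gradv u) x) \<le> 18 * Bo * b^(n+1)" by simp
  qed
  have 1: "(smean (proj n u) \<longlongrightarrow> smean (proj n v) 1) (at 1 within {0<..<1})"
  proof (rule smean_tendsto[OF _ continuous_on_proj[OF C1_on_continuous[OF ui']] pi])
    show "(proj n u \<longlongrightarrow> proj n v x) (at x within shell {0<..<1})" if "norm x = 1" for x
      using tendsto_proj[OF tendsto_within_subset[OF vAB(1)[OF that] si], of n] by (simp add: proj_def)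
  qed auto
  have 2: "(smean (proj n u) \<longlongrightarrow> smean (proj n v) 1) (at 1 within {1<..<b})"
  proof (rule smean_tendsto[OF _ continuous_on_proj[OF C1_on_continuous[OF uo']] po])
    show "(proj n u \<longlongrightarrow> proj n v x) (at x within shell {1<..<b})" if "norm x = 1" for x
      using tendsto_proj[OF tendsto_within_subset[OF vAB(2)[OF that] so], of n] by (simp add: proj_def)
  qed auto
  have 3: "(smean (tracproj n (gradv u)) \<longlongrightarrow> smean (tracproj n A) 1) (at 1 within {0<..<1})"
  proof (rule smean_tendsto[OF _ continuous_on_tracproj[OF continuous_on_gradv[OF ui']] ti])
    show "(tracproj n (gradv u) \<longlongrightarrow> tracproj n A x) (at x within shell {0<..<1})" if "norm x = 1" for x
      using tendsto_tracproj[OF tendsto_within_subset[OF vAB(3)[OF that] si], of n] by (simp add: tracproj_def)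
  qed auto
  have 4: "(smean (tracproj n (gradv u)) \<longlongrightarrow> smean (tracproj n B) 1) (at 1 within {1<..<b})"
  proof (rule smean_tendsto[OF _ continuous_on_tracproj[OF continuous_on_gradv[OF uo']] to])
    show "(tracproj n (gradv u) \<longlongrightarrow> tracproj n B x) (at x within shell {1<..<b})" if "norm x = 1" for x
      using tendsto_tracproj[OF tendsto_within_subset[OF vAB(4)[OF that] so], of n] by (simp add: tracproj_def)
  qed auto
  have e: "(smean (tracproj n (gradv u)) \<longlongrightarrow> l) (at 1 within I) \<longleftrightarrow>
     ((\<lambda>r. smean (radproj n u) r - smean (proj n u) r) \<longlongrightarrow> l) (at 1 within I)"
    if "I \<subseteq> {0<..}" "open I" "C1_on (shell I) u" for I l
    by (rule filterlim_cong) (use that smean_tracproj[OF that(2,1) n that(3)] in \<open>auto simp: eventually_at_filter\<close>)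
  have s1: "{0<..<1} \<subseteq> {0::real<..}" and s2: "{1<..<b} \<subseteq> {0::real<..}" by auto
  have "of_real mu' * smean (tracproj n A) 1 = smean (\<lambda>x. of_real mu' * tracproj n A x) 1"
    by (rule smean_cmult[symmetric])
  also have "\<dots> = smean (\<lambda>x. of_real mu * tracproj n B x) 1"
  proof (rule smean_cong)
    fix x :: "real^3" assume "norm x = 1"
    then have "(\<Sum>i\<in>UNIV. traction lam' mu' (A x) x $ i * vb n i x) = (\<Sum>i\<in>UNIV. traction lam mu (B x) x $ i * vb n i x)"
      by (simp add: vAB(5))
    then show "of_real mu' * tracproj n A x = of_real mu * tracproj n B x"
      unfolding tracproj_traction by (simp add: tracproj_def)
  qed simp
  also have "\<dots> = of_real mu * smean (tracproj n B) 1" by (rule smean_cmult)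
  finally have "of_real mu' * smean (tracproj n A) 1 = of_real mu * smean (tracproj n B) 1" .
  then show thesis
    using that[OF 1 2] 3 4 e[OF s1 open_greaterThanLessThan ui'] e[OF s2 open_greaterThanLessThan uo'] by blast
qed

end

section \<open>Norm estimates\<close>

lemma DERIV_monomial: "((\<lambda>r. A * r^(N+1) / real (N+1)) has_real_derivative A * r^N) (at r)"
  by (rule DERIV_cong[OF DERIV_cdivide[OF DERIV_cmult[OF DERIV_pow]]]) (simp del: of_nat_Suc of_nat_add)

text \<open>The mode estimates combine to |K| \<ge> |m1| r^n (n r^n - 1); squaring and integrating
  gives n/12, and the error terms reduce it to n/16. The condition on
  \<open>\<gamma> ^ (2*n+1)\<close> says that the layer carries at least half of the integral of
  r^(2n).\<close>

lemma gradient_lower_interior: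
  fixes u :: "real^3 \<Rightarrow> complex^3" and n :: nat and \<gamma> B :: real and m1 :: complex
  assumes n: "n \<ge> 100" and u: "C1_on (shell {0<..<1}) u" and \<gamma>: "0 < \<gamma>" "\<gamma> < 1" "\<gamma> ^ (2*n+1) \<le> 1/2"
    and B: "\<And>x. norm x \<in> {0<..<1} \<Longrightarrow> norm (gradv u x) \<le> B"
    and hM: "\<And>r. r \<in> {0<..<1} \<Longrightarrow> norm (smean (proj n u) r - of_real (r^(2*n)) * m1) \<le> norm m1 * r^(n+2) / n^2"
    and hK: "\<And>r. r \<in> {0<..<1} \<Longrightarrow> norm (smean (radproj n u) r - of_nat n * smean (proj n u) r) \<le> norm m1 * r^(n+2) / n"
  shows "(norm m1)^2 / vb_mass n * (n / 16) \<le> 7/3 * (LINT x:shell {\<gamma><..<1}|lborel. (norm (gradv u x))^2)"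
proof -
  define N where "N = vb_mass n"
  have N: "N > 0" using vb_mass_pos by (simp add: N_def)
  define c where "c = (norm m1)^2 / N"
  have c: "c \<ge> 0" using N by (simp add: c_def)
  let ?\<phi> = "\<lambda>r. c * (real n^2 / 2) * r^(2*n)"
  let ?\<Phi> = "\<lambda>r. c * (real n^2 / 2) * r^(2*n+1) / (2*n+1)"
  have sub: "shell {\<gamma><..<1} \<subseteq> shell {0<..<1}" using \<gamma> by auto
  have "?\<Phi> 1 - ?\<Phi> \<gamma> \<le> 7/3 * (LINT x:shell {\<gamma><..<1}|lborel. (norm (gradv u x))^2) + c * (1 - \<gamma>)"
  proof (rule shell_integral_lower)
    show "continuous_on (shell {\<gamma><..<1}) (\<lambda>x. (norm (gradv u x))\<^sup>2)"
      by (intro continuous_intros continuous_on_subset[OF continuous_on_gradv[OF u] sub])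
    show "0 \<le> (norm (gradv u x))\<^sup>2 \<and> (norm (gradv u x))\<^sup>2 \<le> B^2" if "norm x \<in> {\<gamma><..<1}" for x
    proof -
      have "norm x \<in> {0<..<1}" using that \<gamma> by auto
      then show ?thesis using B[of x] by (auto intro!: power_mono)
    qed
    fix r assume r: "r \<in> {\<gamma><..<1}"
    then have r01: "r \<in> {0<..<1}" "r > 0" "r < 1" using \<gamma> by auto
    let ?M = "smean (proj n u) r" and ?K = "smean (radproj n u) r"
    let ?a = "real n * r^n"
    have "r^(2*n) * norm m1 = norm (of_real (r^(2*n)) * m1)"
      using r01 by (simp add: norm_mult norm_power)
    then have 1: "r^(2*n) * norm m1 \<le> norm ?M + norm m1 * r^(n+2) / n^2"
      using hM[OF r01(1)] norm_triangle_sub[of "of_real (r^(2*n)) * m1" ?M] by (simp add: norm_minus_commute)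
    have "real n * norm ?M = norm (of_nat n * ?M)" by (simp add: norm_mult)
    then have 2: "real n * norm ?M \<le> norm ?K + norm m1 * r^(n+2) / n"
      using hK[OF r01(1)] norm_triangle_sub[of "of_nat n * ?M" ?K] by (simp add: norm_minus_commute)
    have "real n * (r^(2*n) * norm m1) \<le> real n * norm ?M + real n * (norm m1 * r^(n+2) / n^2)"
      using mult_left_mono[OF 1 of_nat_0_le_iff[of n]] unfolding distrib_left .
    also have "real n * (norm m1 * r^(n+2) / n^2) = norm m1 * r^(n+2) / n"
      using n by (simp add: power2_eq_square)
    also have "real n * norm ?M + norm m1 * r^(n+2) / n \<le> (norm ?K + norm m1 * r^(n+2) / n) + norm m1 * r^(n+2) / n"
      by (rule add_right_mono[OF 2])
    also have "\<dots> = norm ?K + 2 * (norm m1 * r^(n+2) / n)" by simp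
    also have "2 * (norm m1 * r^(n+2) / n) \<le> norm m1 * r^n"
    proof -
      have "r^(n+2) \<le> r^n" using r01 by (intro power_decreasing) auto
      then have "norm m1 * r^(n+2) * 2 \<le> norm m1 * r^n * n"
        using n r01 by (intro mult_mono) auto
      then show ?thesis using n by (simp add: field_simps)
    qed
    also have "r^(2*n) = r^n * r^n" by (simp add: mult_2 power_add)
    finally have 3: "norm m1 * r^n * (?a - 1) \<le> norm ?K"
      by (simp add: algebra_simps)
    have 4: "(norm ?K)^2 \<le> r^2 * smean (\<lambda>x. (norm (gradv u x))^2) r * (r^(2*n) * N)"
      unfolding N_def by (rule smean_gradv_lower[OF _ u r01(1,2)]) (use n in simp)
    \<comment> \<open>For n r^n < 1 the bound on |K| carries no information, but then the left-hand
      side is not positive.\<close>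
    have "(norm m1)^2 * r^(2*n) * (?a^2 / 2 - 1) \<le> (norm ?K)^2"
    proof (cases "?a \<ge> 1")
      case True
      have "(norm m1)^2 * r^(2*n) * (?a^2 / 2 - 1) \<le> (norm m1)^2 * r^(2*n) * (?a - 1)^2"
      proof (rule mult_left_mono)
        have "0 \<le> (?a - 2)^2" by simp
        then show "?a^2 / 2 - 1 \<le> (?a - 1)^2" by (simp add: power2_eq_square algebra_simps)
      qed (use r01 in auto)
      also have "\<dots> = (norm m1 * r^n * (?a - 1))^2" by (simp add: power_mult_distrib power_mult[symmetric] mult.commute)
      also have "\<dots> \<le> (norm ?K)^2" using 3 True r01 by (intro power_mono) auto
      finally show ?thesis .
    next
      case False
      have "?a \<ge> 0" using r01 by simp
      then have "?a^2 \<le> 1" using False by (intro power_le_one) auto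
      then have "(norm m1)^2 * r^(2*n) * (?a^2 / 2 - 1) \<le> 0" using r01 by (intro mult_nonneg_nonpos) auto
      then show ?thesis using zero_le_power2[of "norm ?K"] by linarith
    qed
    with 4 have "((norm m1)^2 * (?a^2 / 2 - 1)) * r^(2*n) \<le> (r^2 * smean (\<lambda>x. (norm (gradv u x))^2) r * N) * r^(2*n)"
      by (simp add: mult_ac)
    then have "(norm m1)^2 * (?a^2 / 2 - 1) \<le> r^2 * smean (\<lambda>x. (norm (gradv u x))^2) r * N"
      by (rule mult_right_le_imp_le) (use r01 in simp)
    then have "c * (?a^2 / 2 - 1) \<le> r^2 * smean (\<lambda>x. (norm (gradv u x))^2) r"
      using N by (simp add: c_def pos_divide_le_eq)
    moreover have "c * (?a^2 / 2 - 1) = ?\<phi> r - c"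
      by (simp add: power_mult_distrib power_mult[symmetric] algebra_simps)
    ultimately show "?\<phi> r \<le> r^2 * smean (\<lambda>x. (norm (gradv u x))^2) r + c" by linarith
  next
    fix r :: real assume r: "r \<in> {\<gamma>..1}"
    show "(?\<Phi> has_real_derivative ?\<phi> r) (at r)" by (rule DERIV_monomial)
    show "0 \<le> ?\<phi> r" using c r \<gamma> by simp
  qed (use \<gamma> c in auto)
  moreover have "c * (n / 16) + c * (1 - \<gamma>) \<le> ?\<Phi> 1 - ?\<Phi> \<gamma>"
  proof -
    have n2: "real n^2 / (2*n+1) \<ge> n / 3"
      using n by (simp add: field_simps power2_eq_square)
    have "1/4 \<le> (1 - \<gamma>^(2*n+1)) / 2" using \<gamma>(3) by simp
    from mult_mono[OF mult_left_mono[OF n2 c] this]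
    have "c * (n / 3) * (1 / 4) \<le> c * (real n^2 / (2*n+1)) * ((1 - \<gamma>^(2*n+1)) / 2)" using c by simp
    moreover have "?\<Phi> 1 - ?\<Phi> \<gamma> = c * (real n^2 / (2*n+1)) * ((1 - \<gamma>^(2*n+1)) / 2)"
    proof -
      have "c * (A / 2) * 1 / D - c * (A / 2) * g / D = c * (A / D) * ((1 - g) / 2)" for A D g :: real
        by (cases "D = 0") (simp_all add: field_simps)
      then show ?thesis by (simp only: power_one)
    qed
    moreover have "c * (n / 3) * (1 / 4) = c * (n / 12)" by simp
    ultimately have "c * (n / 12) \<le> ?\<Phi> 1 - ?\<Phi> \<gamma>" by (simp only:)
    \<comment> \<open>The margin n/12 - n/16 = n/48 exceeds 1 for n \<ge> 100.\<close>
    moreover have "c * (n / 16 + (1 - \<gamma>)) \<le> c * (n / 12)" using c n \<gamma> by (intro mult_left_mono) auto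
    ultimately show ?thesis by (simp add: distrib_left)
  qed
  ultimately have "c * (n / 16) \<le> 7/3 * (LINT x:shell {\<gamma><..<1}|lborel. (norm (gradv u x))^2)" by linarith
  then show ?thesis by (simp add: c_def N_def)
qed

text \<open>49/50 and 51/50 come from |\<theta> - 1| \<le> 2|z| with |z| \<le> 1/100; 1/25 rounds up
  (51/50 + 2)/100.\<close>

lemma q_bounds:
  assumes k: "k \<ge> 0" and r: "r \<ge> 1" "k * r \<le> 1/100"
  shows "norm (q0 n k r) \<le> 51/50" "norm (q0 n k r) \<ge> 49/50" "norm (q1 n k r) * r \<le> 1/25"
proof -
  let ?z = "- \<i> * of_real k * complex_of_real r"
  have nz: "norm ?z = k * r" using k r by (simp add: norm_mult)
  then have z: "norm ?z \<le> 1/100" using r by simp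
  have ne: "norm (exp (\<i> * of_real k * complex_of_real r)) = 1" by (simp add: norm_exp_eq_Re)
  have p: "norm (poly (rbp n) ?z - 1) \<le> 1/50" using rbp_near_one(1)[OF z, of n] z by linarith
  have p1: "norm (poly (rbp n) ?z) \<le> 51/50"
    using norm_triangle_sub[of "poly (rbp n) ?z" 1] p by simp
  have p2: "norm (poly (rbp n) ?z) \<ge> 49/50"
    using norm_triangle_sub[of 1 "poly (rbp n) ?z"] p by (simp add: norm_minus_commute)
  have q: "norm (q0 n k r) = norm (poly (rbp n) ?z)" unfolding q0_def norm_mult ne by simp
  show "norm (q0 n k r) \<le> 51/50" "norm (q0 n k r) \<ge> 49/50" using p1 p2 q by simp_all
  have "norm (poly (rbp n) ?z - poly (pderiv (rbp n)) ?z) \<le> 51/50 + 2"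
    using norm_triangle_ineq4[of "poly (rbp n) ?z" "poly (pderiv (rbp n)) ?z"] p1 rbp_near_one(2)[OF z, of n] by linarith
  then have "(k * r) * norm (poly (rbp n) ?z - poly (pderiv (rbp n)) ?z) \<le> 1/100 * (51/50 + 2)"
    using k r by (intro mult_mono) auto
  moreover have "norm (q1 n k r) * r = (k * r) * norm (poly (rbp n) ?z - poly (pderiv (rbp n)) ?z)"
    unfolding q1_def norm_mult ne using k by simp
  ultimately have "norm (q1 n k r) * r \<le> 1/100 * (51/50 + 2)" by (simp only:)
  then show "norm (q1 n k r) * r \<le> 1/25" by simp
qed

text \<open>In r K = c (r q1 - (n + 1) q0) the first term is negligible and at least 9/10 n |c|
  remains; 4/5 lies below the square of 9/10. The condition on \<open>(1/b) ^ (2*n+1)\<close> says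
  that the layer carries at least half of the integral of r^(-2n-2) over all r > 1.\<close>

lemma gradient_lower_exterior:
  fixes u :: "real^3 \<Rightarrow> complex^3" and n :: nat and b B k :: real and c :: complex
  assumes n: "n \<ge> 100" and u: "C1_on (shell {1<..<b}) u" and b: "b > 1" "(1/b) ^ (2*n+1) \<le> 1/2"
    and k: "k \<ge> 0" "k * b \<le> 1/100"
    and B: "\<And>x. norm x \<in> {1<..<b} \<Longrightarrow> norm (gradv u x) \<le> B"
    and hK: "\<And>r. r \<in> {1<..<b} \<Longrightarrow> smean (radproj n u) r = c * (q1 n k r - (of_nat n + 1) * q0 n k r / of_real r)"
  shows "(norm c)^2 / vb_mass n * (n / 6) \<le> 7/3 * (LINT x:shell {1<..<b}|lborel. (norm (gradv u x))^2)"
proof -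
  define N where "N = vb_mass n"
  have N: "N > 0" using vb_mass_pos by (simp add: N_def)
  define C where "C = (norm c)^2 / N * (4/5 * n^2)"
  have C: "C \<ge> 0" using N by (simp add: C_def)
  let ?\<phi> = "\<lambda>r. C * inverse (r^(2*n+2))"
  let ?\<Phi> = "\<lambda>r. - (C / (2*n+1)) * inverse (r^(2*n+1))"
  have a: "?\<Phi> b - ?\<Phi> 1 \<le> 7/3 * (LINT x:shell {1<..<b}|lborel. (norm (gradv u x))^2) + 0 * (b - 1)"
  proof (rule shell_integral_lower)
    show "continuous_on (shell {1<..<b}) (\<lambda>x. (norm (gradv u x))\<^sup>2)"
      by (intro continuous_intros continuous_on_gradv[OF u])
    show "0 \<le> (norm (gradv u x))\<^sup>2 \<and> (norm (gradv u x))\<^sup>2 \<le> B^2" if "norm x \<in> {1<..<b}" for x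
      using B[OF that] by (auto intro!: power_mono)
    fix r assume r: "r \<in> {1<..<b}"
    then have r1: "r > 1" "r > 0" "r < b" by auto
    have kr: "k * r \<le> 1/100" using k r1 mult_left_mono[of r b k] by linarith
    let ?K = "smean (radproj n u) r"
    have rK: "of_real r * ?K = c * (of_real r * q1 n k r - (of_nat n + 1) * q0 n k r)"
      unfolding hK[OF r] using r1 by (simp add: field_simps)
    have "norm ((of_nat n + 1) * q0 n k r) = (real n + 1) * norm (q0 n k r)"
    proof -
      have "norm (of_nat n + 1 :: complex) = real n + 1"
        by (metis norm_of_nat of_nat_Suc add.commute)
      then show ?thesis by (simp add: norm_mult)
    qed
    also have "\<dots> \<ge> (real n + 1) * (49/50)" using q_bounds(2)[OF k(1) _ kr, of n] r1 by (intro mult_left_mono) auto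
    finally have P: "(real n + 1) * (49/50) \<le> norm ((of_nat n + 1) * q0 n k r)" .
    have Q: "norm (of_real r * q1 n k r) \<le> 1/25"
      using q_bounds(3)[OF k(1) _ kr, of n] r1 by (simp add: norm_mult mult.commute)
    have "(real n + 1) * (49/50) - 1/25 \<le> norm (of_real r * q1 n k r - (of_nat n + 1) * q0 n k r)"
      using norm_triangle_ineq2[of "(of_nat n + 1) * q0 n k r" "of_real r * q1 n k r"] P Q
      by (simp only: norm_minus_commute[of "of_real r * q1 n k r"])
    moreover have "9/10 * real n \<le> (real n + 1) * (49/50) - 1/25"
      by (simp add: field_simps)
    ultimately have "9/10 * real n \<le> norm (of_real r * q1 n k r - (of_nat n + 1) * q0 n k r)"
      by (rule order_trans[rotated])
    then have "norm c * (9/10 * real n) \<le> norm (of_real r * ?K)"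
      unfolding rK norm_mult by (intro mult_left_mono) auto
    then have "(norm c * (9/10 * real n))^2 \<le> (norm (of_real r * ?K))^2"
      by (intro power_mono) auto
    moreover have "(norm (of_real r * ?K))^2 = r^2 * (norm ?K)^2" by (simp add: norm_mult power_mult_distrib)
    moreover have "(norm c)^2 * (4/5 * real n^2) \<le> (norm c * (9/10 * real n))^2"
    proof -
      have "4/5 * ((norm c)^2 * real n^2) \<le> 81/100 * ((norm c)^2 * real n^2)"
        by (rule mult_right_mono) auto
      then show ?thesis by (simp add: power_mult_distrib power_divide)
    qed
    ultimately have 1: "(norm c)^2 * (4/5 * real n^2) \<le> r^2 * (norm ?K)^2" by linarith
    have "(norm ?K)^2 \<le> r^2 * smean (\<lambda>x. (norm (gradv u x))^2) r * (r^(2*n) * N)"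
      unfolding N_def by (rule smean_gradv_lower[OF _ u r r1(2)]) (use n in simp)
    then have "r^2 * (norm ?K)^2 \<le> r^2 * (r^2 * smean (\<lambda>x. (norm (gradv u x))^2) r * (r^(2*n) * N))"
      by (rule mult_left_mono) simp
    with 1 have "(norm c)^2 * (4/5 * real n^2) \<le> (r^2 * smean (\<lambda>x. (norm (gradv u x))^2) r) * (r^(2*n+2)) * N"
      by (simp add: power_add power2_eq_square mult_ac)
    then have "C \<le> (r^2 * smean (\<lambda>x. (norm (gradv u x))^2) r) * r^(2*n+2)"
      using N by (simp add: C_def pos_divide_le_eq)
    then have "C / r^(2*n+2) \<le> r^2 * smean (\<lambda>x. (norm (gradv u x))^2) r"
      using r1 by (subst pos_divide_le_eq) auto
    then show "?\<phi> r \<le> r^2 * smean (\<lambda>x. (norm (gradv u x))^2) r + 0" by (simp only: divide_inverse add_0_right)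
  next
    fix r :: real assume r: "r \<in> {1..b}"
    then have r0: "r > 0" by simp
    have "(?\<Phi> has_real_derivative - (C / (2*n+1)) * (- real (2*n+1) / r^(2*n+1+1))) (at r)"
      by (rule DERIV_cmult[OF DERIV_inverse_power[OF r0]])
    also have "- (C / (2*n+1)) * (- real (2*n+1) / r^(2*n+1+1)) = ?\<phi> r"
    proof -
      have "- (C / D) * (- D / X) = C * inverse X" if "D \<noteq> 0" for D X :: real
        using that by (simp add: divide_inverse)
      from this[of "real (2*n+1)" "r^(2*n+1+1)"] show ?thesis by (simp add: numeral_eq_Suc del: of_nat_Suc)
    qed
    finally show "(?\<Phi> has_real_derivative ?\<phi> r) (at r)" .
    show "0 \<le> ?\<phi> r" using C r by simp
  qed (use b in auto)
  have e: "?\<Phi> b - ?\<Phi> 1 = C / (2*n+1) * (1 - (1/b)^(2*n+1))"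
  proof -
    have "- (C / D) * i - - (C / D) * inverse (1 ^ m) = C / D * (1 - i)" for D i :: real and m
      by (cases "D = 0") (simp_all add: field_simps)
    moreover have "inverse (b ^ m) = (1/b)^m" for m by (simp add: power_one_over inverse_eq_divide)
    ultimately show ?thesis by (simp only:)
  qed
  have l: "(norm c)^2 / N * (n / 6) \<le> C / (2*n+1) * (1 - (1/b)^(2*n+1))"
  proof -
    have n2: "4/5 * real n^2 / (2*n+1) \<ge> n / 3"
      using n by (simp add: field_simps power2_eq_square)
    have "(norm c)^2 / N * (n / 3) * (1/2) \<le> (norm c)^2 / N * (4/5 * real n^2 / (2*n+1)) * (1 - (1/b)^(2*n+1))"
      using n2 N b by (intro mult_mono mult_left_mono) auto
    moreover have "(norm c)^2 / N * (n / 3) * (1/2) = (norm c)^2 / N * (n / 6)" by simp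
    moreover have "(norm c)^2 / N * (4/5 * real n^2 / (2*n+1)) = C / (2*n+1)" by (simp add: C_def)
    ultimately show ?thesis by (simp only:)
  qed
  from order_trans[OF l a[unfolded e]] show ?thesis by (simp add: N_def)
qed

lemma smean_proj_toroidal:
  assumes n: "n \<ge> 1" and r: "r > 0" and uf: "\<And>x i. norm x = r \<Longrightarrow> u x $ i = g * cnj (vb n i (x /\<^sub>R norm x))"
  shows "smean (proj n u) r = g * of_real r ^ n * of_real (vb_mass n)"
proof -
  have vs: "vb n i x = of_real r ^ n * vb n i (x /\<^sub>R norm x)" if "norm x = r" for i x
    using vb_scale[OF n, of i r "x /\<^sub>R norm x"] that r by simp
  have "smean (proj n u) r = smean (\<lambda>x. (g / of_real r ^ n) * of_real (vb_sq n x)) r"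
  proof (rule smean_cong[OF _ r])
    fix x :: "real^3" assume x: "norm x = r"
    have "u x $ i * vb n i x = (g / of_real r ^ n) * of_real ((norm (vb n i x))^2)" for i
    proof -
      have "u x $ i = g / of_real r ^ n * cnj (vb n i x)"
        using uf[of x i] x r by (simp add: vs[OF x, of i])
      then show ?thesis by (simp only: complex_norm_square mult_ac)
    qed
    then show "proj n u x = (g / of_real r ^ n) * of_real (vb_sq n x)"
      by (simp add: proj_def vb_sq_def sum_distrib_left)
  qed
  also have "\<dots> = g * of_real r ^ n * of_real (vb_mass n)"
    unfolding smean_cmult smean_of_real using smean_vb_sq[OF n, of r] r
    by (simp add: mult_2 power_add)
  finally show ?thesis .
qed

text \<open>For a pure mode Cauchy-Schwarz is an equality, so the average of |u|^2 is determined by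
  the projection, which is close to r^(2n) y. The upper bound controls the denominator of the
  ratios; the lower bound shows that it is not zero.\<close>

lemma incident_norm:
  fixes u :: "real^3 \<Rightarrow> complex^3" and n :: nat and y :: complex
  assumes n: "n \<ge> 100" and u: "continuous_on (ball 0 1) u" and B: "\<And>x. norm x \<in> {0<..<1} \<Longrightarrow> norm (u x) \<le> B"
    and uf: "\<And>x i. norm x \<in> {0<..<1} \<Longrightarrow> u x $ i = g (norm x) * cnj (vb n i (x /\<^sub>R norm x))"
    and hM: "\<And>r. r \<in> {0<..<1} \<Longrightarrow> norm (smean (proj n u) r - of_real (r^(2*n)) * y) \<le> norm y * r^(n+2) / n^2"
  shows "7/3 * (LINT x:shell {0<..<1}|lborel. (norm (u x))^2) \<le> (norm y)^2 / vb_mass n * (2 / n)"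
    and "(norm y)^2 / vb_mass n * (1 / (5 * n)) \<le> 7/3 * (LINT x:shell {0<..<1}|lborel. (norm (u x))^2)"
proof -
  define N where "N = vb_mass n"
  have N: "N > 0" using vb_mass_pos by (simp add: N_def)
  define c where "c = (norm y)^2 / N"
  have c: "c \<ge> 0" using N by (simp add: c_def)
  have n1: "n \<ge> 1" using n by simp
  have sub: "shell {0<..<1} \<subseteq> ball 0 1" by auto
  have s: "smean (\<lambda>x. (norm (u x))^2) r = (norm (smean (proj n u) r))^2 / (r^(2*n) * N)"
    and M: "(norm (smean (proj n u) r / of_real (r^n)))^2 = (norm (smean (proj n u) r))^2 / r^(2*n)"
    if r: "r \<in> {0<..<1}" for r
  proof -
    have r0: "r > 0" using r by simp
    have vs: "vb n i x = of_real r ^ n * vb n i (x /\<^sub>R norm x)" if "norm x = r" for i x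
      using vb_scale[OF n1, of i r "x /\<^sub>R norm x"] that r0 by simp
    have "smean (proj n u) r = g r * of_real r ^ n * of_real N"
      unfolding N_def by (rule smean_proj_toroidal[OF n1 r0]) (use uf r in auto)
    then have P: "norm (smean (proj n u) r) = norm (g r) * r^n * N"
      using r0 N by (simp add: norm_mult norm_power)
    have "smean (\<lambda>x. (norm (u x))^2) r = smean (\<lambda>x. ((norm (g r))^2 / r^(2*n)) *\<^sub>R vb_sq n x) r"
    proof (rule smean_cong[OF _ r0])
      fix x :: "real^3" assume x: "norm x = r"
      have "(norm (u x))^2 = (\<Sum>i\<in>UNIV. (norm (u x $ i))^2)"
        by (simp add: norm_vec_def L2_set_def sum_nonneg)
      also have "\<dots> = (\<Sum>i\<in>UNIV. (norm (g r))^2 / r^(2*n) * (norm (vb n i x))^2)"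
      proof (rule sum.cong[OF refl])
        fix i
        have "norm (u x $ i) = norm (g r) / r^n * norm (vb n i x)"
          using uf[of x i] x r r0 by (simp add: vs[OF x, of i] norm_mult norm_power)
        then show "(norm (u x $ i))^2 = (norm (g r))^2 / r^(2*n) * (norm (vb n i x))^2"
          by (simp add: power_mult_distrib power_divide power_mult[symmetric] mult.commute)
      qed
      finally show "(norm (u x))^2 = ((norm (g r))^2 / r^(2*n)) *\<^sub>R vb_sq n x"
        by (simp add: vb_sq_def sum_distrib_left)
    qed
    also have "\<dots> = (norm (g r))^2 * N"
      unfolding smean_scaleR using smean_vb_sq[OF n1, of r] r0 by (simp add: N_def)
    also have "\<dots> = (norm (smean (proj n u) r))^2 / (r^(2*n) * N)"
      unfolding P using r0 N by (simp add: power_mult_distrib power_mult[symmetric] power2_eq_square mult_2 power_add mult_2_right)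
    finally show "smean (\<lambda>x. (norm (u x))^2) r = (norm (smean (proj n u) r))^2 / (r^(2*n) * N)" .
    show "(norm (smean (proj n u) r / of_real (r^n)))^2 = (norm (smean (proj n u) r))^2 / r^(2*n)"
      using r0 by (simp add: norm_divide norm_power power_divide power_mult[symmetric] mult.commute)
  qed
  have dev: "\<bar>norm (smean (proj n u) r) / r^n - norm y * r^n\<bar> \<le> norm y * r^2 / n^2" if r: "r \<in> {0<..<1}" for r
  proof -
    have r0: "r > 0" using r by simp
    have "\<bar>norm (smean (proj n u) r) - norm (of_real (r^(2*n)) * y)\<bar> \<le> norm y * r^(n+2) / n^2"
      using norm_triangle_ineq3[of "smean (proj n u) r" "of_real (r^(2*n)) * y"] hM[OF r] by linarith
    also have "norm (of_real (r^(2*n)) * y) = r^n * (norm y * r^n)"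
      using r0 by (simp add: norm_mult norm_power mult_2 power_add)
    also have "norm (smean (proj n u) r) = r^n * (norm (smean (proj n u) r) / r^n)" using r0 by simp
    also have "norm y * r^(n+2) / n^2 = r^n * (norm y * r^2 / n^2)" by (simp add: power_add power2_eq_square)
    finally have "r^n * \<bar>norm (smean (proj n u) r) / r^n - norm y * r^n\<bar> \<le> r^n * (norm y * r^2 / n^2)"
      using r0 by (simp add: abs_mult right_diff_distrib[symmetric] del: times_divide_eq_right)
    then show ?thesis using r0 by (simp only: mult_le_cancel_left_pos zero_less_power)
  qed
  have cont: "continuous_on (shell {0<..<1}) (\<lambda>x. (norm (u x))\<^sup>2)"
    by (intro continuous_intros continuous_on_subset[OF u sub])
  have bd: "0 \<le> (norm (u x))\<^sup>2 \<and> (norm (u x))\<^sup>2 \<le> B^2" if "norm x \<in> {0<..<1}" for x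
    using B[OF that] by (auto intro!: power_mono)
  have sm: "smean (\<lambda>x. (norm (u x))^2) r = (norm (smean (proj n u) r) / r^n)^2 / N" if r: "r \<in> {0<..<1}" for r
    unfolding s[OF r] using r by (simp add: power_divide power_mult[symmetric] mult.commute)
  have up: "r^2 * smean (\<lambda>x. (norm (u x))^2) r \<le> c * (2 * r^(2*n+2)) + c * (2 / n^4)"
    and lo: "c * (1/2 * r^(2*n+2)) \<le> r^2 * smean (\<lambda>x. (norm (u x))^2) r + c / n^4" if r: "r \<in> {0<..<1}" for r
  proof -
    have r0: "r > 0" "r < 1" using r by auto
    define t where "t = norm (smean (proj n u) r) / r^n"
    define e where "e = norm y * r^2 / n^2"
    have d: "\<bar>t - norm y * r^n\<bar> \<le> e" using dev[OF r] by (simp add: t_def e_def)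
    have t0: "t \<ge> 0" using r0 by (simp add: t_def)
    have "r^2 \<le> 1" using r0 by (intro power_le_one) auto
    then have "norm y * r^2 \<le> norm y" by (simp add: mult_left_le)
    then have e1: "e \<le> norm y / n^2" unfolding e_def by (intro divide_right_mono) auto
    have e0: "e \<ge> 0" by (simp add: e_def)
    have e2: "r^2 * e^2 \<le> (norm y)^2 / n^4"
    proof -
      have "e^2 \<le> (norm y / n^2)^2" using e1 e0 by (intro power_mono) auto
      then have "r^2 * e^2 \<le> 1 * (norm y / n^2)^2" using \<open>r^2 \<le> 1\<close> by (intro mult_mono) auto
      then show ?thesis by (simp add: power_divide power_mult[symmetric])
    qed
    have d2: "(t - norm y * r^n)^2 \<le> e^2" using d e0 by (metis abs_le_square_iff abs_of_nonneg)
    have "t^2 \<le> 2 * (norm y * r^n)^2 + 2 * (t - norm y * r^n)^2"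
      using zero_le_power2[of "t - 2 * (norm y * r^n)"] by (simp add: power2_eq_square algebra_simps)
    then have "t^2 \<le> 2 * (norm y * r^n)^2 + 2 * e^2" using d2 by linarith
    then have "r^2 * t^2 \<le> r^2 * (2 * (norm y * r^n)^2 + 2 * e^2)" by (rule mult_left_mono) simp
    also have "\<dots> = 2 * (r^2 * (norm y * r^n)^2) + 2 * (r^2 * e^2)" by (simp only: distrib_left mult.left_commute)
    also have "r^2 * (norm y * r^n)^2 = (norm y)^2 * r^(2*n+2)"
      by (simp add: power_mult_distrib power_add power2_eq_square mult_2)
    also have "2 * ((norm y)^2 * r^(2*n+2)) + 2 * (r^2 * e^2) \<le> (norm y)^2 * (2 * r^(2*n+2)) + 2 * ((norm y)^2 / n^4)"
      using e2 by linarith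
    finally have "r^2 * t^2 / N \<le> ((norm y)^2 * (2 * r^(2*n+2)) + 2 * ((norm y)^2 / n^4)) / N"
      using N by (intro divide_right_mono) auto
    then show "r^2 * smean (\<lambda>x. (norm (u x))^2) r \<le> c * (2 * r^(2*n+2)) + c * (2 / n^4)"
      unfolding sm[OF r] t_def[symmetric] c_def by (simp add: add_divide_distrib mult.commute)
    have "1/2 * (norm y * r^n)^2 \<le> t^2 + (t - norm y * r^n)^2"
      using zero_le_power2[of "2 * t - norm y * r^n"] by (simp add: power2_eq_square algebra_simps)
    then have "1/2 * (norm y * r^n)^2 \<le> t^2 + e^2" using d2 by linarith
    then have "r^2 * (1/2 * (norm y * r^n)^2) \<le> r^2 * (t^2 + e^2)" by (rule mult_left_mono) simp
    also have "\<dots> \<le> r^2 * t^2 + (norm y)^2 / n^4" using e2 by (simp add: distrib_left)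
    finally have "r^2 * (1/2 * (norm y * r^n)^2) / N \<le> (r^2 * t^2 + (norm y)^2 / n^4) / N"
      using N by (intro divide_right_mono) auto
    moreover have "r^2 * (1/2 * (norm y * r^n)^2) = (norm y)^2 * (1/2 * r^(2*n+2))"
      by (simp add: power_mult_distrib power_add power2_eq_square mult_2)
    ultimately show "c * (1/2 * r^(2*n+2)) \<le> r^2 * smean (\<lambda>x. (norm (u x))^2) r + c / n^4"
      unfolding sm[OF r] t_def[symmetric] c_def by (simp add: add_divide_distrib mult.commute)
  qed
  have n4: "real n^4 \<ge> 100 * n"
  proof -
    have "real n * 100 \<le> real n * real n^3"
    proof (rule mult_left_mono)
      have "real n^1 \<le> real n^3" using n by (intro power_increasing) auto
      moreover have "100 \<le> real n^1" using n by simp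
      ultimately show "100 \<le> real n^3" by (rule order_trans[rotated])
    qed simp
    then show ?thesis by (simp add: eval_nat_numeral)
  qed
  have n4': "1 / real n^4 \<le> 1 / (100 * n)" using n4 n by (intro divide_left_mono) auto
  let ?\<Phi> = "\<lambda>a d r. c * a * r^(2*n+3) / (2*n+3) + d * r"
  have D: "((?\<Phi> a d) has_real_derivative c * (a * r^(2*n+2)) + d) (at r)" for a d r :: real
  proof -
    have "((\<lambda>r. c * a * r^(2*n+3) / (2*n+3)) has_real_derivative c * (a * r^(2*n+2))) (at r)"
      by (rule DERIV_cong[OF DERIV_cdivide[OF DERIV_cmult[OF DERIV_pow]]]) (simp add: numeral_eq_Suc)
    moreover have "((\<lambda>r. d * r) has_real_derivative d) (at r)" by (auto intro!: derivative_eq_intros)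
    ultimately show ?thesis by (rule DERIV_add)
  qed
  have "7/3 * (LINT x:shell {0<..<1}|lborel. (norm (u x))^2) \<le> ?\<Phi> 2 (c * (2 / n^4)) 1 - ?\<Phi> 2 (c * (2 / n^4)) 0"
    by (rule shell_integral_upper[where \<phi>="\<lambda>r. c * (2 * r^(2*n+2)) + c * (2 / n^4)" and \<Phi>="?\<Phi> 2 (c * (2 / n^4))", OF _ _ cont bd])
       (use up D[of 2 "c * (2 / n^4)"] c in auto)
  also have "\<dots> = c * (2 / (2*n+3) + 2 / n^4)" by (simp add: distrib_left)
  also have "\<dots> \<le> c * (2 / n)"
  proof (rule mult_left_mono[OF _ c])
    have "2 / (2*real n+3) \<le> 1 / n" using n by (simp add: field_simps)
    moreover have "2 / real n^4 \<le> 1 / n" using n4' n by (simp add: field_simps)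
    ultimately have "2 / (2*real n+3) + 2 / real n^4 \<le> 1 / n + 1 / n" by (rule add_mono)
    then show "2 / (2*n+3) + 2 / n^4 \<le> 2 / real n" by simp
  qed
  finally show "7/3 * (LINT x:shell {0<..<1}|lborel. (norm (u x))^2) \<le> (norm y)^2 / vb_mass n * (2 / n)"
    by (simp add: c_def N_def)
  have "?\<Phi> (1/2) 0 1 - ?\<Phi> (1/2) 0 0 \<le> 7/3 * (LINT x:shell {0<..<1}|lborel. (norm (u x))^2) + c / n^4 * (1 - 0)"
    by (rule shell_integral_lower[where \<phi>="\<lambda>r. c * (1/2 * r^(2*n+2)) + 0" and \<Phi>="?\<Phi> (1/2) 0" and c="c / n^4", OF _ _ cont bd])
       (use lo D[of "1/2" 0] c in auto)
  moreover have "c * (1 / (5 * n)) + c / n^4 \<le> ?\<Phi> (1/2) 0 1 - ?\<Phi> (1/2) 0 0"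
  proof -
    have "1 / (5 * real n) + 1 / (100 * n) \<le> 1/2 / (2*n+3)" using n by (simp add: field_simps)
    then have "1 / (5 * real n) + 1 / real n^4 \<le> 1/2 / (2*n+3)" using n4' by linarith
    from mult_left_mono[OF this c] show ?thesis by (simp add: distrib_left zero_power)
  qed
  ultimately show "(norm y)^2 / vb_mass n * (1 / (5 * n)) \<le> 7/3 * (LINT x:shell {0<..<1}|lborel. (norm (u x))^2)"
    by (simp add: c_def N_def)
qed

text \<open>\<open>ei\<close>, \<open>Ei\<close> and \<open>eo - Ei\<close> are the limits of K - M
  for the inner, incident and scattered field, with static values (n - 1) m1, (n - 1) y and - (n +
  2) d. Eliminating d gives (n - 1 + \<delta>(n + 2)) m1 = \<delta> (2n + 1) y up to errors, hence
  m1 of size about 2 \<delta> y.\<close>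

lemma transmission_algebra:
  fixes m1 y d ei eo Ei :: complex and n :: nat and \<delta> :: real
  assumes n: "n \<ge> 100" and \<delta>: "0 < \<delta>" "\<delta> \<le> 1/40"
    and d: "d = m1 - y"
    and z1: "norm (ei - (of_nat n - 1) * m1) \<le> norm m1 / 10"
    and z2: "norm (Ei - (of_nat n - 1) * y) \<le> norm y / 10"
    and z3: "norm (eo - Ei + (of_nat n + 2) * d) \<le> norm d / 10"
    and t: "ei = of_real \<delta> * eo"
  shows "norm m1 \<ge> \<delta> * norm y" "norm d \<ge> 9/10 * norm y"
proof -
  define w where "w = (ei - (of_nat n - 1) * m1)"
  define v where "v = (Ei - (of_nat n - 1) * y) + (eo - Ei + (of_nat n + 2) * d)"
  have eq: "of_real (real n - 1 + \<delta> * (n + 2)) * m1 = of_real \<delta> * (of_real (2 * real n + 1) * y + v) - w"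
  proof -
    have "eo = v + (2 * of_nat n + 1) * y - (of_nat n + 2) * m1" unfolding v_def d by (simp add: algebra_simps)
    then have "(of_nat n - 1) * m1 + w = of_real \<delta> * (v + (2 * of_nat n + 1) * y - (of_nat n + 2) * m1)"
      using t unfolding w_def by simp
    then show ?thesis by (simp add: algebra_simps)
  qed
  have nd: "norm d \<le> norm m1 + norm y" unfolding d by (rule norm_triangle_ineq4)
  have nv: "norm v \<le> norm y / 10 + norm d / 10" unfolding v_def using z2 z3 norm_triangle_mono by blast
  have nw: "norm w \<le> norm m1 / 10" using z1 by (simp add: w_def)
  have nv': "norm v \<le> norm y / 5 + norm m1 / 10" using nv nd by linarith
  have A: "norm (of_real (real n - 1 + \<delta> * (n + 2)) * m1) = (real n - 1 + \<delta> * (n + 2)) * norm m1"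
    using n \<delta> by (simp only: norm_mult norm_of_real) (simp add: abs_of_nonneg)
  have Y: "norm (of_real (2 * real n + 1) * y) = (2 * real n + 1) * norm y" by (simp add: norm_mult del: of_real_add of_real_mult)
  have D: "norm (of_real \<delta> * x) = \<delta> * norm x" for x :: complex using \<delta> by (simp add: norm_mult)
  have lo: "(real n - 1 + \<delta> * (n + 2)) * norm m1 \<ge> \<delta> * ((2 * real n + 1) * norm y - (norm y / 5 + norm m1 / 10)) - norm m1 / 10"
  proof -
    have "(2 * real n + 1) * norm y - (norm y / 5 + norm m1 / 10) \<le> norm (of_real (2 * real n + 1) * y + v)"
      using norm_diff_ineq[of "of_real (2 * real n + 1) * y" v] Y nv' by linarith
    then have "\<delta> * ((2 * real n + 1) * norm y - (norm y / 5 + norm m1 / 10)) \<le> norm (of_real \<delta> * (of_real (2 * real n + 1) * y + v))"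
      unfolding D using \<delta> by (intro mult_left_mono) auto
    then show ?thesis
      unfolding A[symmetric] eq
      using norm_triangle_ineq2[of "of_real \<delta> * (of_real (2 * real n + 1) * y + v)" w] nw by linarith
  qed
  have hi: "(real n - 1 + \<delta> * (n + 2)) * norm m1 \<le> \<delta> * ((2 * real n + 1) * norm y + (norm y / 5 + norm m1 / 10)) + norm m1 / 10"
  proof -
    have "norm (of_real (2 * real n + 1) * y + v) \<le> (2 * real n + 1) * norm y + (norm y / 5 + norm m1 / 10)"
      using norm_triangle_ineq[of "of_real (2 * real n + 1) * y" v] Y nv' by linarith
    then have "norm (of_real \<delta> * (of_real (2 * real n + 1) * y + v)) \<le> \<delta> * ((2 * real n + 1) * norm y + (norm y / 5 + norm m1 / 10))"
      unfolding D using \<delta> by (intro mult_left_mono) auto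
    then show ?thesis
      unfolding A[symmetric] eq
      using norm_triangle_ineq4[of "of_real \<delta> * (of_real (2 * real n + 1) * y + v)" w] nw by linarith
  qed
  have "40 * \<delta> \<le> 1" using \<delta> by simp
  from mult_right_mono[OF this of_nat_0_le_iff[of "n + 2"]]
  have dm: "40 * (\<delta> * real (n + 2)) \<le> real (n + 2)" by (simp only: mult.assoc mult_1)
  have dy: "\<delta> * norm y \<le> 1/40 * norm y" using \<delta> by (intro mult_right_mono) auto
  have "(2 * real n) * (\<delta> * norm y) \<le> (2 * real n) * norm m1"
  proof -
    have "(2 * real n) * (\<delta> * norm y) \<le> (2 * real n + 4/5) * (\<delta> * norm y)"
      using \<delta> by (intro mult_right_mono) auto
    also have "\<dots> \<le> (real n - 1 + \<delta> * (n + 2)) * norm m1 + \<delta> * norm m1 / 10 + norm m1 / 10"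
      using lo by (simp add: algebra_simps)
    also have "\<dots> = (real n - 1 + \<delta> * (n + 2) + \<delta> / 10 + 1/10) * norm m1" by (simp add: algebra_simps)
    also have "\<dots> \<le> (2 * real n) * norm m1"
    proof (rule mult_right_mono)
      have "real n \<ge> 100" using n by simp
      then show "real n - 1 + \<delta> * (n + 2) + \<delta> / 10 + 1/10 \<le> 2 * real n" using dm \<delta> by linarith
    qed simp
    finally show ?thesis .
  qed
  then show "norm m1 \<ge> \<delta> * norm y" using n by simp
  \<comment> \<open>Since m1 is about 2 \<delta> y, the bound \<delta> \<le> 1/40 leaves room to
    keep it below |y|/10, so that d stays close to - y.\<close>
  have "(4/5 * real n) * norm m1 \<le> (4/5 * real n) * (norm y / 10)"
  proof -
    have "(4/5 * real n) * norm m1 \<le> (real n - 1 + \<delta> * (n + 2) - \<delta> / 10 - 1/10) * norm m1"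
    proof (rule mult_right_mono)
      have "0 \<le> \<delta> * (n + 2)" using \<delta> by simp
      then show "4/5 * real n \<le> real n - 1 + \<delta> * (n + 2) - \<delta> / 10 - 1/10" using \<delta> n by linarith
    qed simp
    also have "\<dots> \<le> (2 * real n + 6/5) * (\<delta> * norm y)" using hi by (simp add: algebra_simps)
    also have "\<dots> \<le> (2 * real n + 6/5) * (1/40 * norm y)" using dy by (intro mult_left_mono) auto
    also have "\<dots> = (2 * real n + 6/5) / 40 * norm y" by simp
    also have "\<dots> \<le> (4/5 * real n / 10) * norm y"
      using n by (intro mult_right_mono) auto
    finally show ?thesis by simp
  qed
  then have "norm m1 \<le> norm y / 10" using n by simp
  then show "norm d \<ge> 9/10 * norm y" unfolding d using norm_triangle_ineq2[of y m1] by (simp add: norm_minus_commute)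
qed

section \<open>The resonance estimates\<close>

text \<open>Feeds an actual field into the abstract radial estimate. It serves twice: for the total
  field with the inner parameters and for the incident field with the outer ones.\<close>

lemma interior_mode_field:
  fixes B :: real
  assumes n: "n \<ge> 10" and u: "lame_solution lam mu rho \<omega> (shell {0<..<1}) u" and mu: "mu > 0"
    and k2: "0 \<le> \<omega>^2 * rho / mu" "\<omega>^2 * rho / mu \<le> 1/100"
    and B: "B \<ge> 0" "\<And>x. norm x \<in> {0<..<1} \<Longrightarrow> norm (u x) \<le> B \<and> norm (gradv u x) \<le> B"
    and lim: "(smean (proj n u) \<longlongrightarrow> m1) (at 1 within {0<..<1})"
    and r: "r \<in> {0<..<1}"
  shows "norm (smean (proj n u) r - of_real (r^(2*n)) * m1) \<le> norm m1 * r^(n+2) / n^2"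
    and "norm (smean (radproj n u) r - of_nat n * smean (proj n u) r) \<le> norm m1 * r^(n+2) / n"
proof -
  let ?I = "{0<..<1::real}"
  have I: "open ?I" "?I \<subseteq> {0<..}" by auto
  have n1: "n \<ge> 1" using n by simp
  have C2: "C2_on (shell ?I) u" using u by (simp add: lame_solution_def)
  then have C1: "C1_on (shell ?I) u" by (simp add: C2_on_def)
  have Z: "((\<lambda>r. of_real r * (smean (radproj n u) r - of_nat n * smean (proj n u) r)) has_vector_derivative
      - of_real (\<omega>^2 * rho / mu * s^2) * smean (proj n u) s) (at s)" if "s \<in> ?I" for s
    using smean_proj_deriv2[OF I n1 C2 that] unfolding smean_proj_laplacian[OF I n1 u mu that]
    by (simp add: mult_ac)
  have bM: "norm (smean (proj n u) s) \<le> (9 * B * ann_vol) * s^n" if s: "s \<in> ?I" for s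
  proof -
    have "norm (smean (proj n u) s) \<le> (3 * B * s^n) * ann_vol"
      by (rule smean_norm_le) (use s norm_proj_le[OF n1] B(2) in auto)
    also have "\<dots> \<le> (9 * B * s^n) * ann_vol"
      using B(1) s ann_vol_nonneg by (intro mult_right_mono) auto
    finally show ?thesis by (simp add: mult_ac)
  qed
  have bK: "norm (smean (radproj n u) s) \<le> (9 * B * ann_vol) * s^n" if s: "s \<in> ?I" for s
  proof -
    have "norm (smean (radproj n u) s) \<le> (9 * B * s^(n+1)) * ann_vol"
    proof (rule smean_norm_le)
      fix x :: "real^3" assume x: "norm x = s"
      then have "u differentiable (at x)" using C1 s by (simp add: C1_on_def)
      then show "norm (radproj n u x) \<le> 9 * B * s^(n+1)"
        using norm_radproj_le[OF n1, of u x B] B(2)[of x] x s by simp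
    qed (use s in simp)
    also have "\<dots> \<le> (9 * B * s^n) * ann_vol"
    proof (rule mult_right_mono[OF mult_left_mono ann_vol_nonneg])
      show "s^(n+1) \<le> s^n" using s by (intro power_decreasing) auto
    qed (use B in simp)
    finally show ?thesis by (simp add: mult_ac)
  qed
  note im = interior_mode[OF n k2 smean_proj_deriv[OF I n1 C1] Z bM bK lim r]
  show "norm (smean (proj n u) r - of_real (r^(2*n)) * m1) \<le> norm m1 * r^(n+2) / n^2"
    by (rule im(1))
  show "norm (smean (radproj n u) r - of_nat n * smean (proj n u) r) \<le> norm m1 * r^(n+2) / n"
    by (rule im(2))
qed

lemma at_within_Ioo_1: "at 1 within {0<..<1} = at_left (1::real)"
  by (rule at_within_nhd[where S="{0<..}", symmetric]) auto

lemma at_within_Ioo_2: "b > 1 \<Longrightarrow> at 1 within {1<..<b} = at_right (1::real)"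
  by (rule at_within_nhd[where S="{..<b}", symmetric]) auto

text \<open>K - M - (n - 1) M is the defect K - n M, whose bound |m| r^(n+2) / n is at most
  |m|/10.\<close>

lemma defect_limit:
  fixes M K :: "real \<Rightarrow> complex" and n :: nat
  assumes n: "n \<ge> 10" and e: "((\<lambda>r. K r - M r) \<longlongrightarrow> e) (at 1 within {0<..<1})"
    and m: "(M \<longlongrightarrow> m) (at 1 within {0<..<1})"
    and b: "\<And>r. r \<in> {0<..<1} \<Longrightarrow> norm (K r - of_nat n * M r) \<le> norm m * r^(n+2) / n"
  shows "norm (e - (of_nat n - 1) * m) \<le> norm m / 10"
proof (rule tendsto_upperbound)
  show "((\<lambda>r. norm (K r - M r - (of_nat n - 1) * M r)) \<longlongrightarrow> norm (e - (of_nat n - 1) * m)) (at 1 within {0<..<1})"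
    by (intro tendsto_intros e m)
  show "eventually (\<lambda>r. norm (K r - M r - (of_nat n - 1) * M r) \<le> norm m / 10) (at 1 within {0<..<1})"
    unfolding eventually_at_filter
  proof (rule always_eventually, intro allI impI)
    fix r :: real assume r: "r \<in> {0<..<1}"
    have "r^(n+2) \<le> 1" using r by (intro power_le_one) auto
    then have "norm m * r^(n+2) \<le> norm m" by (simp add: mult_left_le)
    then have "norm m * r^(n+2) / n \<le> norm m / 10" using n by (intro frac_le) auto
    with b[OF r] have "norm (K r - of_nat n * M r) \<le> norm m / 10" by linarith
    moreover have "K r - M r - (of_nat n - 1) * M r = K r - of_nat n * M r" by (simp add: algebra_simps)
    ultimately show "norm (K r - M r - (of_nat n - 1) * M r) \<le> norm m / 10" by (simp only:)
  qed
  show "at 1 within {0<..<1} \<noteq> (bot :: real filter)" by (simp add: at_within_Ioo_1)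
qed

lemma smean_tendsto_continuous:
  fixes F :: "real^3 \<Rightarrow> complex"
  assumes F: "continuous_on UNIV F" and I: "I \<subseteq> {0<..<b}"
  shows "(smean F \<longlongrightarrow> smean F 1) (at 1 within I)"
proof -
  have "bounded (F ` cball 0 b)"
    by (intro compact_imp_bounded compact_continuous_image continuous_on_subset[OF F]) auto
  then obtain B where B: "\<forall>x\<in>cball 0 b. norm (F x) \<le> B" by (auto simp: bounded_iff)
  show ?thesis
  proof (rule smean_tendsto)
    show "norm (F x) \<le> B" if "norm x \<in> I" for x using that I B by fastforce
    show "(F \<longlongrightarrow> F x) (at x within shell I)" for x
      using F by (auto simp: continuous_on_eq_continuous_at isCont_def intro: tendsto_within_subset)
  qed (use I in \<open>auto intro: continuous_on_subset[OF F]\<close>)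
qed

lemma sqrt_ratio_bound:
  assumes "0 < L" "0 \<le> x" "x^2 * L \<le> A"
  shows "x \<le> sqrt A / sqrt L"
proof -
  have "x^2 \<le> A / L" using assms by (simp add: pos_le_divide_eq)
  then have "x \<le> sqrt (A / L)" by (rule real_le_rsqrt)
  then show ?thesis by (simp add: real_sqrt_divide)
qed

text \<open>The non-asymptotic core: every smallness hypothesis appears as an explicit inequality,
  so that the theorem only has to choose thresholds.\<close>

lemma resonance_bounds:
  fixes R \<gamma>1 \<gamma>2 lam mu rho \<delta> \<epsilon> \<omega> :: real and n :: nat and f :: complex
  defines "k \<equiv> k_s mu rho \<omega>"
  assumes \<gamma>1: "0 < \<gamma>1" "\<gamma>1 < 1" "\<gamma>1 ^ (2*n+1) \<le> 1/2" and \<gamma>2: "1 < \<gamma>2" "\<gamma>2 < R" "(1/\<gamma>2) ^ (2*n+1) \<le> 1/2"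
    and n: "n \<ge> 100" and \<delta>: "0 < \<delta>" "\<delta> \<le> 1/40" and \<epsilon>: "0 < \<epsilon>" "\<delta> / \<epsilon> \<le> 1"
    and pos: "0 < mu" "0 < rho" "0 < \<omega>" and k\<gamma>: "k * \<gamma>2 \<le> 1/100" and f: "f \<noteq> 0"
    and uif: "ui = (\<lambda>x. (f * of_real (sph_bessel_j n (k * norm x))) *s vsh_T n (int n) x)"
    and es: "elastic_scattering (ball 0 1) (\<lambda>x. x /\<^sub>R norm x)
        lam mu rho (lam / \<delta>) (mu / \<delta>) (rho / \<epsilon>) \<omega> ui u us"
  shows "ratio_in (ball 0 1) (1 - \<gamma>1) ui u \<ge> real n * \<delta> / (4 * sqrt pi)"
    and "ratio_out (ball 0 1) R (\<gamma>2 - 1) ui us \<ge> real n / (9 * sqrt pi)"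
proof -
  have n1: "n \<ge> 1" and n10: "n \<ge> 10" using n by auto
  have ext: "- closure (ball 0 1) = shell {1<..}" by auto
  have LI: "lame_solution lam mu rho \<omega> UNIV ui" and LN: "lame_solution (lam / \<delta>) (mu / \<delta>) (rho / \<epsilon>) \<omega> (ball 0 1) u"
    and LO: "lame_solution lam mu rho \<omega> (shell {1<..}) u" and eq: "\<And>x. x \<in> shell {1<..} \<Longrightarrow> u x = ui x + us x"
    and tr: "transmission (ball 0 1) (\<lambda>x. x /\<^sub>R norm x) lam mu (lam / \<delta>) (mu / \<delta>) u"
    and ra: "radiating lam mu rho \<omega> us"
    using es unfolding elastic_scattering_def ext by auto
  have k0: "k > 0" using pos by (simp add: k_def k_s_def)
  have k2: "k^2 = \<omega>^2 * rho / mu" using pos by (simp add: k_def k_s_def power_mult_distrib)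
  have k1: "k \<le> 1/100"
  proof -
    have "k * 1 \<le> k * \<gamma>2" using k0 \<gamma>2 by (intro mult_left_mono) auto
    then show ?thesis using k\<gamma> by simp
  qed
  have kk: "k^2 \<le> 1/100"
  proof -
    have "k * k \<le> 1/100 * 1" using k0 k1 by (intro mult_mono) auto
    then show ?thesis by (simp add: power2_eq_square)
  qed
  have sub: "shell {0<..<1} \<subseteq> ball 0 1" by auto
  have C1I: "C1_on UNIV ui" and C1N: "C1_on (ball 0 1) u" and C1O: "C1_on (shell {1<..}) u"
    using LI LN LO by (auto simp: lame_solution_def C2_on_def)
  have C1Ns: "C1_on (shell {0<..<1}) u" using C1_on_subset[OF C1N sub] .
  have oS: "open (shell {1<..})" by (rule open_shell) simp
  have LS: "lame_solution lam mu rho \<omega> (shell {1<..}) us"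
    by (rule lame_solution_diff[OF oS LO lame_solution_subset[OF LI]]) (use eq in auto)
  then have C2S: "C2_on (shell {1<..}) us" and C1S: "C1_on (shell {1<..}) us"
    by (auto simp: lame_solution_def C2_on_def)

  \<comment> \<open>The incident mode\<close>
  obtain \<kappa> where \<kappa>: "\<kappa> \<noteq> 0" "\<And>x i. x \<noteq> 0 \<Longrightarrow> vsh_T n (int n) x $ i = \<kappa> * cnj (vb n i (x /\<^sub>R norm x))"
    using vsh_T_diag[OF n1] by blast
  define g where "g t = f * of_real (sph_bessel_j n (k * t)) * \<kappa>" for t
  have uf: "ui x $ i = g (norm x) * cnj (vb n i (x /\<^sub>R norm x))" if "norm x > 0" for x i
    using \<kappa>(2)[of x i] that by (simp add: uif g_def)
  define y where "y = smean (proj n ui) 1"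
  define Ei where "Ei = smean (tracproj n (gradv ui)) 1"
  have cI: "continuous_on UNIV ui" "continuous_on UNIV (gradv ui)"
    using C1_on_continuous[OF C1I] continuous_on_gradv[OF C1I] by auto
  have yl: "(smean (proj n ui) \<longlongrightarrow> y) (at 1 within I)"
    and El: "((\<lambda>r. smean (radproj n ui) r - smean (proj n ui) r) \<longlongrightarrow> Ei) (at 1 within I)"
    if I: "open I" "I \<subseteq> {0<..<\<gamma>2}" for I
  proof -
    show "(smean (proj n ui) \<longlongrightarrow> y) (at 1 within I)"
      unfolding y_def by (rule smean_tendsto_continuous[OF continuous_on_proj[OF cI(1)] I(2)])
    have "(smean (tracproj n (gradv ui)) \<longlongrightarrow> Ei) (at 1 within I)"
      unfolding Ei_def by (rule smean_tendsto_continuous[OF continuous_on_tracproj[OF cI(2)] I(2)])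
    moreover have "I \<subseteq> {0<..}" using I by auto
    ultimately show "((\<lambda>r. smean (radproj n ui) r - smean (proj n ui) r) \<longlongrightarrow> Ei) (at 1 within I)"
      using smean_tracproj[OF I(1) _ n1 C1_on_subset[OF C1I]]
      by (subst filterlim_cong[OF refl refl, of _ "smean (tracproj n (gradv ui))"])
         (auto simp: eventually_at_filter)
  qed
  have "bounded (ui ` cball 0 1)" "bounded (gradv ui ` cball 0 1)"
    by (intro compact_imp_bounded compact_continuous_image continuous_on_subset[OF cI(1)] continuous_on_subset[OF cI(2)] | simp)+
  then obtain B1 B2 where B12: "\<forall>x\<in>cball 0 1. norm (ui x) \<le> B1" "\<forall>x\<in>cball 0 1. norm (gradv ui x) \<le> B2"
    by (auto simp: bounded_iff)
  define BI where "BI = max 0 (max B1 B2)"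
  have BI: "BI \<ge> 0" "\<And>x. norm x \<in> {0<..<1} \<Longrightarrow> norm (ui x) \<le> BI \<and> norm (gradv ui x) \<le> BI"
    using B12 by (auto simp: BI_def le_max_iff_disj)
  have sub1: "{0<..<1} \<subseteq> {0<..<\<gamma>2}" using \<gamma>2 by auto
  have k2': "0 \<le> \<omega>^2 * rho / mu" "\<omega>^2 * rho / mu \<le> 1/100" using kk by (simp_all flip: k2)
  have yl1: "(smean (proj n ui) \<longlongrightarrow> y) (at 1 within {0<..<1})" by (rule yl[OF _ sub1]) simp
  have hI: "norm (smean (proj n ui) r - of_real (r^(2*n)) * y) \<le> norm y * r^(n+2) / n^2"
    "norm (smean (radproj n ui) r - of_nat n * smean (proj n ui) r) \<le> norm y * r^(n+2) / n"
    if "r \<in> {0<..<1}" for r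
  proof -
    show "norm (smean (proj n ui) r - of_real (r^(2*n)) * y) \<le> norm y * r^(n+2) / n^2"
      by (rule interior_mode_field(1)[OF n10 lame_solution_subset[OF LI subset_UNIV] pos(1) k2' BI yl1 that])
    show "norm (smean (radproj n ui) r - of_nat n * smean (proj n ui) r) \<le> norm y * r^(n+2) / n"
      by (rule interior_mode_field(2)[OF n10 lame_solution_subset[OF LI subset_UNIV] pos(1) k2' BI yl1 that])
  qed
  have z2: "norm (Ei - (of_nat n - 1) * y) \<le> norm y / 10"
    by (rule defect_limit[OF n10 El[OF _ sub1] yl[OF _ sub1] hI(2)]) auto
  \<comment> \<open>A zero boundary value would force the projection to vanish at radius 1/2 as
    well, where the Bessel function is positive.\<close>
  have y0: "y \<noteq> 0"
  proof
    assume "y = 0"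
    then have "smean (proj n ui) (1/2) = 0" using hI(1)[of "1/2"] by simp
    moreover have "smean (proj n ui) (1/2) = g (1/2) * of_real (1/2) ^ n * of_real (vb_mass n)"
    proof (rule smean_proj_toroidal[OF n1])
      show "ui x $ i = g (1/2) * cnj (vb n i (x /\<^sub>R norm x))" if x: "norm x = 1/2" for x i
      proof -
        have "norm x > 0" using x by linarith
        from uf[OF this, of i] show ?thesis by (simp only: x)
      qed
    qed simp
    moreover have "sph_bessel_j n (k * (1/2)) > 0" by (rule sph_bessel_j_pos) (use k0 k1 in auto)
    ultimately show False using vb_mass_pos[of n] f \<kappa>(1) by (simp add: g_def)
  qed

  \<comment> \<open>The total field inside the ball\<close>
  obtain BN where BN: "BN \<ge> 0" "\<And>x. norm x \<in> {0<..<1} \<Longrightarrow> norm (u x) \<le> BN \<and> norm (gradv u x) \<le> BN"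
    using bounded_inside[OF tr C1N C1O[folded ext] \<gamma>2(1)] by blast
  obtain BO where BO: "BO \<ge> 0" "\<And>x. norm x \<in> {1<..<\<gamma>2} \<Longrightarrow> norm (u x) \<le> BO \<and> norm (gradv u x) \<le> BO"
    using bounded_outside[OF tr C1N C1O[folded ext] \<gamma>2(1)] by blast
  obtain m1 ei eo where
    lm: "(smean (proj n u) \<longlongrightarrow> m1) (at 1 within {0<..<1})" "(smean (proj n u) \<longlongrightarrow> m1) (at 1 within {1<..<\<gamma>2})"
    and le: "((\<lambda>r. smean (radproj n u) r - smean (proj n u) r) \<longlongrightarrow> ei) (at 1 within {0<..<1})"
      "((\<lambda>r. smean (radproj n u) r - smean (proj n u) r) \<longlongrightarrow> eo) (at 1 within {1<..<\<gamma>2})"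
    and te: "of_real (mu / \<delta>) * ei = of_real mu * eo"
    using transmission_modes[OF tr C1N C1O[folded ext] \<gamma>2(1) n1] by blast
  \<comment> \<open>The squared inner wave number is k^2 \<tau>^2 with \<tau>^2 =
    \<delta>/\<epsilon>, so \<tau> \<le> 1 keeps it as small as the outer one.\<close>
  have kin: "\<omega>^2 * (rho / \<epsilon>) / (mu / \<delta>) = k^2 * (\<delta> / \<epsilon>)" unfolding k2 by simp
  have kin1: "0 \<le> \<omega>^2 * (rho / \<epsilon>) / (mu / \<delta>)" "\<omega>^2 * (rho / \<epsilon>) / (mu / \<delta>) \<le> 1/100"
  proof -
    show "0 \<le> \<omega>^2 * (rho / \<epsilon>) / (mu / \<delta>)" using pos \<delta> \<epsilon> by simp
    have "k^2 * (\<delta> / \<epsilon>) \<le> 1/100 * 1" using kk \<epsilon> \<delta> by (intro mult_mono) auto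
    then show "\<omega>^2 * (rho / \<epsilon>) / (mu / \<delta>) \<le> 1/100" unfolding kin by simp
  qed
  have mud: "mu / \<delta> > 0" using pos \<delta> by simp
  have hN: "norm (smean (proj n u) r - of_real (r^(2*n)) * m1) \<le> norm m1 * r^(n+2) / n^2"
    "norm (smean (radproj n u) r - of_nat n * smean (proj n u) r) \<le> norm m1 * r^(n+2) / n"
    if "r \<in> {0<..<1}" for r
  proof -
    show "norm (smean (proj n u) r - of_real (r^(2*n)) * m1) \<le> norm m1 * r^(n+2) / n^2"
      by (rule interior_mode_field(1)[OF n10 lame_solution_subset[OF LN sub] mud kin1 BN lm(1) that])
    show "norm (smean (radproj n u) r - of_nat n * smean (proj n u) r) \<le> norm m1 * r^(n+2) / n"
      by (rule interior_mode_field(2)[OF n10 lame_solution_subset[OF LN sub] mud kin1 BN lm(1) that])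
  qed
  have z1: "norm (ei - (of_nat n - 1) * m1) \<le> norm m1 / 10"
    by (rule defect_limit[OF n10 le(1) lm(1) hN(2)])
  have t: "ei = of_real \<delta> * eo"
    using te pos \<delta> by (simp add: field_simps)

  \<comment> \<open>The scattered field outside the ball\<close>
  let ?J = "{1::real<..}"
  have J: "open ?J" "?J \<subseteq> {0<..}" by auto
  obtain C r0 where r0: "r0 > 1" and rc: "\<And>x. norm x \<ge> r0 \<Longrightarrow> norm (rad_defect k us x) \<le> C / (norm x)^2"
  proof -
    have "(\<lambda>x. norm (rad_defect k us x)) \<in> O[at_infinity](\<lambda>x. 1 / norm x ^ 2)"
      using ra by (simp add: radiating_def rad_defect_def k_def)
    then obtain C where "eventually (\<lambda>x. norm (norm (rad_defect k us x)) \<le> C * norm (1 / norm x ^ 2)) at_infinity"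
      by (elim landau_o.bigE)
    then obtain b where b: "\<And>x. b \<le> norm x \<Longrightarrow> norm (norm (rad_defect k us x)) \<le> C * norm (1 / norm x ^ 2)"
      by (auto simp: eventually_at_infinity)
    show thesis
    proof (rule that[of "max b 2"])
      show "norm (rad_defect k us x) \<le> C / (norm x)^2" if "norm x \<ge> max b 2" for x
        using b[of x] that by simp
    qed simp
  qed
  have rad: "norm (of_real (r * k^2) * smean (proj n us) r + \<i> * of_real k * (smean (radproj n us) r + smean (proj n us) r))
      \<le> (6 * C * ann_vol) * r^n / r" if r: "r \<ge> r0" for r
  proof -
    have rJ: "r \<in> ?J" "r > 0" using r r0 by auto
    have "norm (of_real (r * k^2) * smean (proj n us) r + \<i> * of_real k * (smean (radproj n us) r + smean (proj n us) r))
      = norm (smean (\<lambda>x. \<Sum>i\<in>UNIV. rad_defect k us x $ i * xvb n x $ i) r)"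
      unfolding smean_rad_defect[OF J n1 LS pos(1) rJ(1)] k2[symmetric]
      by (subst norm_minus_cancel[symmetric]) (simp add: algebra_simps)
    also have "\<dots> \<le> C / r^2 * (6 * r^(n+1)) * ann_vol"
      by (rule smean_norm_rad_defect[OF n1 rJ(2)]) (use rc r in auto)
    also have "\<dots> = (6 * C * ann_vol) * r^n / r" using rJ(2) by (simp add: power2_eq_square)
    finally show ?thesis .
  qed
  have ZS: "((\<lambda>r. of_real r * (smean (radproj n us) r - of_nat n * smean (proj n us) r)) has_vector_derivative
      - of_real (k^2 * s^2) * smean (proj n us) s) (at s)" if "s > 1" for s
  proof -
    have sJ: "s \<in> ?J" using that by simp
    show ?thesis
      using smean_proj_deriv2[OF J n1 C2S sJ] unfolding smean_proj_laplacian[OF J n1 LS pos(1) sJ] k2[symmetric]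
      by (simp add: mult_ac)
  qed
  have kr: "k * r \<le> 1/100" if "r \<in> {1<..<\<gamma>2}" for r
  proof -
    have "k * r \<le> k * \<gamma>2" using that k0 by (intro mult_left_mono) auto
    then show ?thesis using k\<gamma> by linarith
  qed
  have MS: "(smean (proj n us) has_vector_derivative (smean (radproj n us) r + of_nat n * smean (proj n us) r) / of_real r) (at r)"
    if "r > 1" for r using smean_proj_deriv[OF J n1 C1S, of r] that by simp
  obtain c where
    cM: "\<And>r. r \<in> {1<..<\<gamma>2} \<Longrightarrow> smean (proj n us) r = c * q0 n k r / of_real r"
    and cK: "\<And>r. r \<in> {1<..<\<gamma>2} \<Longrightarrow> smean (radproj n us) r = c * (q1 n k r - (of_nat n + 1) * q0 n k r / of_real r)"
    using exterior_mode[OF n1 k0 MS ZS r0 rad kr \<gamma>2(1)] by blast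
  let ?F = "at 1 within {1<..<\<gamma>2}"
  have Fn: "?F \<noteq> bot" using \<gamma>2 by (simp add: at_within_Ioo_2)
  have sJ2: "{1<..<\<gamma>2} \<subseteq> {0<..<\<gamma>2}" and ssJ: "shell {1<..<\<gamma>2} \<subseteq> shell ?J" by auto
  have q0l: "(q0 n k \<longlongrightarrow> q0 n k 1) ?F" and q1l: "(q1 n k \<longlongrightarrow> q1 n k 1) ?F"
    using has_vector_derivative_continuous[OF q0_deriv[of n k 1]] has_vector_derivative_continuous[OF q1_deriv[OF n1, of 1 k]]
    by (auto simp: isCont_def intro: tendsto_within_subset)
  have pS: "partial j us x = partial j u x - partial j ui x" if "x \<in> shell ?J" for x j
  proof -
    have "partial j us x = partial j (\<lambda>x. u x - ui x) x" by (rule partial_cong[OF oS that]) (simp add: eq)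
    then show ?thesis using C1O C1I that by (simp add: partial_diff C1_on_def)
  qed
  have gS: "gradv us x = gradv u x - gradv ui x" if "x \<in> shell ?J" for x
    by (simp add: gradv_def pS[OF that] vec_eq_iff)
  have MSd: "smean (proj n us) r = smean (proj n u) r - smean (proj n ui) r" if r: "r \<in> {1<..<\<gamma>2}" for r
  proof -
    have r0: "r > 0" using r by simp
    have "smean (proj n us) r = smean (\<lambda>x. proj n u x - proj n ui x) r"
      by (rule smean_cong[OF _ r0]) (use r eq in \<open>simp add: proj_def sum_subtractf[symmetric] algebra_simps\<close>)
    also have "\<dots> = smean (proj n u) r - smean (proj n ui) r"
      by (rule smean_diff[where I="?J", OF _ _ _ r0])
         (use r in \<open>auto intro!: continuous_on_proj C1_on_continuous[OF C1O] continuous_on_subset[OF cI(1)]\<close>)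
    finally show ?thesis .
  qed
  have KSd: "smean (radproj n us) r - smean (proj n us) r
     = (smean (radproj n u) r - smean (proj n u) r) - (smean (radproj n ui) r - smean (proj n ui) r)" if r: "r \<in> {1<..<\<gamma>2}" for r
  proof -
    have r0: "r > 0" and rJ: "r \<in> ?J" using r by auto
    have "smean (radproj n us) r - smean (proj n us) r = smean (tracproj n (gradv us)) r"
      by (rule smean_tracproj[OF J n1 C1S rJ, symmetric])
    also have "\<dots> = smean (\<lambda>x. tracproj n (gradv u) x - tracproj n (gradv ui) x) r"
    proof (rule smean_cong[OF _ r0])
      fix x :: "real^3" assume "norm x = r"
      then have g: "gradv us x = gradv u x - gradv ui x" by (intro gS) (use r in simp)
      show "tracproj n (gradv us) x = tracproj n (gradv u) x - tracproj n (gradv ui) x"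
        unfolding tracproj_def g by (simp add: sum_subtractf[symmetric] algebra_simps)
    qed
    also have "\<dots> = smean (tracproj n (gradv u)) r - smean (tracproj n (gradv ui)) r"
      by (rule smean_diff[where I="?J", OF _ _ _ r0])
         (use r in \<open>auto intro!: continuous_on_tracproj continuous_on_gradv[OF C1O] continuous_on_subset[OF cI(2)]\<close>)
    also have "\<dots> = (smean (radproj n u) r - smean (proj n u) r) - (smean (radproj n ui) r - smean (proj n ui) r)"
      by (simp only: smean_tracproj[OF J n1 C1O rJ] smean_tracproj[OF J n1 C1_on_subset[OF C1I subset_UNIV] rJ])
    finally show ?thesis .
  qed

  \<comment> \<open>Matching at the interface\<close>
  define d where "d = m1 - y"
  have d1: "(smean (proj n us) \<longlongrightarrow> d) ?F"
  proof -
    have "((\<lambda>r. smean (proj n u) r - smean (proj n ui) r) \<longlongrightarrow> d) ?F"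
      unfolding d_def by (intro tendsto_diff lm(2) yl sJ2 open_greaterThanLessThan)
    then show ?thesis
      by (subst filterlim_cong[OF refl refl, of _ "\<lambda>r. smean (proj n u) r - smean (proj n ui) r"])
         (auto simp: eventually_at_filter MSd)
  qed
  have d2: "(smean (proj n us) \<longlongrightarrow> c * q0 n k 1 / of_real 1) ?F"
  proof -
    have "((\<lambda>r. c * q0 n k r / of_real r) \<longlongrightarrow> c * q0 n k 1 / of_real 1) ?F"
      by (intro tendsto_intros q0l) auto
    then show ?thesis
      by (subst filterlim_cong[OF refl refl, of _ "\<lambda>r. c * q0 n k r / of_real r"])
         (auto simp: eventually_at_filter cM)
  qed
  have dc: "d = c * q0 n k 1" using tendsto_unique[OF Fn d1 d2] by simp
  have e1: "((\<lambda>r. smean (radproj n us) r - smean (proj n us) r) \<longlongrightarrow> eo - Ei) ?F"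
  proof -
    have "((\<lambda>r. (smean (radproj n u) r - smean (proj n u) r) - (smean (radproj n ui) r - smean (proj n ui) r)) \<longlongrightarrow> eo - Ei) ?F"
      by (intro tendsto_diff[OF le(2) El] sJ2 open_greaterThanLessThan)
    then show ?thesis
      by (subst filterlim_cong[OF refl refl, of _ "\<lambda>r. (smean (radproj n u) r - smean (proj n u) r) - (smean (radproj n ui) r - smean (proj n ui) r)"])
         (auto simp: eventually_at_filter KSd)
  qed
  have e2: "((\<lambda>r. smean (radproj n us) r - smean (proj n us) r)
      \<longlongrightarrow> c * (q1 n k 1 - (of_nat n + 1) * q0 n k 1 / of_real 1) - c * q0 n k 1 / of_real 1) ?F"
  proof -
    have "((\<lambda>r. c * (q1 n k r - (of_nat n + 1) * q0 n k r / of_real r) - c * q0 n k r / of_real r)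
      \<longlongrightarrow> c * (q1 n k 1 - (of_nat n + 1) * q0 n k 1 / of_real 1) - c * q0 n k 1 / of_real 1) ?F"
      by (intro tendsto_intros q0l q1l) auto
    then show ?thesis
      by (subst filterlim_cong[OF refl refl, of _ "\<lambda>r. c * (q1 n k r - (of_nat n + 1) * q0 n k r / of_real r) - c * q0 n k r / of_real r"])
         (auto simp: eventually_at_filter cM cK)
  qed
  \<comment> \<open>The limit of K - M is known both from the traction data and from the Hankel
    solution. Adding (n + 2) M gives K + (n + 1) M, the derivative of r M, which is c times
    \<open>q1\<close> and measures the departure from static decay.\<close>
  have ec: "eo - Ei + (of_nat n + 2) * d = c * q1 n k 1"
    using tendsto_unique[OF Fn e1 e2] by (simp add: dc algebra_simps)
  have qb: "norm (q0 n k 1) \<le> 51/50" "norm (q0 n k 1) \<ge> 49/50" "norm (q1 n k 1) \<le> 1/25"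
    using q_bounds[of k 1 n] k0 k1 by auto
  have z3: "norm (eo - Ei + (of_nat n + 2) * d) \<le> norm d / 10"
  proof -
    have "norm c * norm (q1 n k 1) \<le> norm c * (1/10 * norm (q0 n k 1))"
      using qb by (intro mult_left_mono) auto
    then show ?thesis unfolding ec unfolding dc by (simp add: norm_mult)
  qed
  have my: "norm m1 \<ge> \<delta> * norm y" and dy: "norm d \<ge> 9/10 * norm y"
    using transmission_algebra[OF n \<delta> d_def z1 z2 z3 t] by auto
  \<comment> \<open>9/10 divided by 51/50 exceeds 4/5.\<close>
  have cy: "norm c \<ge> 4/5 * norm y"
  proof -
    have "norm d \<le> norm c * (51/50)" unfolding dc norm_mult using qb by (intro mult_left_mono) auto
    then show ?thesis using dy norm_ge_zero[of y] by linarith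
  qed

  \<comment> \<open>The two ratios\<close>
  define N where "N = vb_mass n"
  have N: "N > 0" using vb_mass_pos by (simp add: N_def)
  define L where "L = (LINT x:shell {0<..<1}|lborel. (norm (ui x))^2)"
  have Lu: "7/3 * L \<le> (norm y)^2 / N * (2 / n)" and Ll: "(norm y)^2 / N * (1 / (5 * n)) \<le> 7/3 * L"
    unfolding L_def N_def
    using incident_norm[OF n continuous_on_subset[OF cI(1)], of BI g y] BI(2) uf hI(1) by auto
  have "0 < (norm y)^2 / N * (1 / (5 * n))" using y0 N n by simp
  then have L0: "L > 0" using Ll by linarith
  have Lsq: "L2_norm_on (ball 0 1) ui = sqrt L"
    unfolding L2_norm_on_ball[OF continuous_on_subset[OF cI(1) subset_UNIV]] by (simp add: L2_norm_on_def L_def)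
  have pi2: "pi > 2" using pi_gt3 by simp
  show "ratio_in (ball 0 1) (1 - \<gamma>1) ui u \<ge> real n * \<delta> / (4 * sqrt pi)"
    unfolding ratio_in_def Lsq layer_in_ball[OF \<gamma>1(1,2)] unfolding L2_norm_on_def
  proof (rule sqrt_ratio_bound[OF L0])
    define A where "A = (LINT x:shell {\<gamma>1<..<1}|lborel. (norm (gradv u x))^2)"
    have A: "(norm m1)^2 / N * (n / 16) \<le> 7/3 * A"
      unfolding A_def N_def by (rule gradient_lower_interior[OF n C1Ns \<gamma>1 _ hN]) (use BN in auto)
    have "(real n * \<delta> / (4 * sqrt pi))^2 = (real n * \<delta>)^2 / (16 * pi)"
      by (simp add: power_divide power_mult_distrib)
    \<comment> \<open>\<pi> > 2 suffices: with the factor 2/n from the incident norm, 1/32 becomes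
      1/16, exactly the constant of the interior gradient bound.\<close>
    also have "\<dots> \<le> (real n * \<delta>)^2 / 32" using pi2 by (intro divide_left_mono) auto
    finally have s: "(real n * \<delta> / (4 * sqrt pi))^2 \<le> (real n * \<delta>)^2 / 32" .
    have "(real n * \<delta> / (4 * sqrt pi))^2 * (7/3 * L) \<le> (real n * \<delta>)^2 / 32 * ((norm y)^2 / N * (2 / n))"
      by (rule mult_mono[OF s Lu]) (use L0 in auto)
    also have "\<dots> = (\<delta> * norm y)^2 / N * (n / 16)" using n N by (simp add: power_mult_distrib power2_eq_square field_simps)
    also have "\<dots> \<le> (norm m1)^2 / N * (n / 16)"
      using my \<delta> N by (intro mult_right_mono divide_right_mono power_mono) auto
    also note A
    finally show "(real n * \<delta> / (4 * sqrt pi))^2 * L \<le> (LINT x:shell {\<gamma>1<..<1}|lborel. (norm (gradv u x))^2)"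
      unfolding A_def[symmetric] by (simp add: mult.commute)
  qed (use \<delta> in simp)
  show "ratio_out (ball 0 1) R (\<gamma>2 - 1) ui us \<ge> real n / (9 * sqrt pi)"
    unfolding ratio_out_def Lsq layer_out_ball[OF \<gamma>2(1,2)] unfolding L2_norm_on_def
  proof (rule sqrt_ratio_bound[OF L0])
    define A where "A = (LINT x:shell {1<..<\<gamma>2}|lborel. (norm (gradv us x))^2)"
    have "bounded (gradv ui ` cball 0 \<gamma>2)"
      by (intro compact_imp_bounded compact_continuous_image continuous_on_subset[OF cI(2)]) auto
    then obtain B3 where B3: "\<forall>x\<in>cball 0 \<gamma>2. norm (gradv ui x) \<le> B3" by (auto simp: bounded_iff)
    have bS: "norm (gradv us x) \<le> BO + B3" if x: "norm x \<in> {1<..<\<gamma>2}" for x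
    proof -
      have "gradv us x = gradv u x - gradv ui x" by (rule gS) (use x in simp)
      moreover have "norm (gradv u x) \<le> BO" using BO(2)[OF x] by simp
      moreover have "norm (gradv ui x) \<le> B3" using B3 x by simp
      ultimately show ?thesis using norm_triangle_ineq4[of "gradv u x" "gradv ui x"] by simp
    qed
    have A: "(norm c)^2 / N * (n / 6) \<le> 7/3 * A"
      unfolding A_def N_def
      by (rule gradient_lower_exterior[OF n C1_on_subset[OF C1S ssJ] \<gamma>2(1,3) _ k\<gamma> bS cK]) (use k0 in auto)
    have "(real n / (9 * sqrt pi))^2 = (real n)^2 / (81 * pi)"
      by (simp add: power_divide power_mult_distrib)
    also have "\<dots> \<le> (real n)^2 / 162" using pi2 by (intro divide_left_mono) auto
    finally have s: "(real n / (9 * sqrt pi))^2 \<le> (real n)^2 / 162" .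
    have "(real n / (9 * sqrt pi))^2 * (7/3 * L) \<le> (real n)^2 / 162 * ((norm y)^2 / N * (2 / n))"
      by (rule mult_mono[OF s Lu]) (use L0 in auto)
    also have "\<dots> = (norm y)^2 / N * (n / 81)" using n N by (simp add: power2_eq_square field_simps)
    \<comment> \<open>Here the margin is wide: (4/5)^2 / 6 = 8/75 against 1/81.\<close>
    also have "\<dots> \<le> (4/5 * norm y)^2 / N * (n / 6)"
    proof -
      have "(norm y)^2 / N * (real n / 81) \<le> (norm y)^2 / N * (16/25 * (real n / 6))"
        using N by (intro mult_left_mono) auto
      then show ?thesis by (simp add: power_mult_distrib power_divide mult_ac)
    qed
    also have "\<dots> \<le> (norm c)^2 / N * (n / 6)"
      using cy N by (intro mult_right_mono divide_right_mono power_mono) auto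
    also note A
    finally show "(real n / (9 * sqrt pi))^2 * L \<le> (LINT x:shell {1<..<\<gamma>2}|lborel. (norm (gradv us x))^2)"
      unfolding A_def[symmetric] by (simp add: mult.commute)
  qed simp
qed

lemma half_power:
  fixes b :: real
  assumes "b > 1" "real m * (b - 1) \<ge> 1"
  shows "(1/b) ^ m \<le> 1/2"
proof -
  have "1 + real m * (b - 1) \<le> (1 + (b - 1)) ^ m" by (rule Bernoulli_inequality) (use assms in simp)
  then have "2 \<le> b ^ m" using assms by simp
  then show ?thesis using assms by (simp add: power_one_over field_simps)
qed

text \<open>The asymptotic language is read through quantifiers: \<open>C\<close> expresses O(1),
  with a lower bound on \<open>mu\<close> that keeps the wave number below C \<omega>;
  \<open>K\<close> is an arbitrary level for \<gg> 1; and the thresholds are chosen before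
  \<open>n\<close>, the amplitude and the fields.\<close>

theorem proposition4p1:
  fixes R \<gamma>1 \<gamma>2 C K :: real
  assumes "0 < \<gamma>1" and "\<gamma>1 < 1" and "1 < \<gamma>2" and "\<gamma>2 < R" and "0 < C"
  shows "\<exists>\<delta>0>0. \<exists>\<epsilon>0>0. \<exists>\<omega>0>0.
    \<forall>(lam::real) (mu::real) (rho::real) (\<delta>::real) (\<epsilon>::real) (\<omega>::real) (n::nat) (f::complex)
      (ui :: real^3 \<Rightarrow> complex^3) (u :: real^3 \<Rightarrow> complex^3) (us :: real^3 \<Rightarrow> complex^3).
      0 < mu \<and> 0 < 3 * lam + 2 * mu \<and> 0 < rho \<and>
      \<bar>lam\<bar> \<le> C \<and> 1 / C \<le> mu \<and> mu \<le> C \<and> rho \<le> C \<and>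
      0 < \<delta> \<and> \<delta> < \<delta>0 \<and> 0 < \<epsilon> \<and> \<epsilon> < \<epsilon>0 \<and> sqrt (\<delta> / \<epsilon>) < 1 \<and>
      0 < \<omega> \<and> \<omega> < \<omega>0 \<and>
      1 \<le> n \<and> 1 / \<delta>\<^sup>2 \<le> real n \<and> f \<noteq> 0 \<and>
      ui = (\<lambda>x. (f * of_real (sph_bessel_j n (k_s mu rho \<omega> * norm x))) *s vsh_T n (int n) x) \<and>
      elastic_scattering (ball 0 1) (\<lambda>x. x /\<^sub>R norm x)
        lam mu rho (lam / \<delta>) (mu / \<delta>) (rho / \<epsilon>) \<omega> ui u us
      \<longrightarrow>
      ratio_in (ball 0 1) (1 - \<gamma>1) ui u \<ge> real n * \<delta> / (4 * sqrt pi) \<and>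
      real n * \<delta> / (4 * sqrt pi) \<ge> K \<and>
      ratio_out (ball 0 1) R (\<gamma>2 - 1) ui us \<ge> real n / (9 * sqrt pi) \<and>
      real n / (9 * sqrt pi) \<ge> K \<and>
      surface_resonance K (ball 0 1) R (1 - \<gamma>1) (\<gamma>2 - 1) ui u us"
proof -
  \<comment> \<open>T bounds n \<delta> and n from below. The summand 40 yields \<delta> \<le> 1/40
    and n \<ge> 100; the two reciprocals make n large enough for \<open>half_power\<close> in either
    layer; 18 covers K against 4 sqrt \<pi> and 9 sqrt \<pi>, because sqrt \<pi> \<le> 2.\<close>
  define T where "T = 40 + 1 / (1 - \<gamma>1) + 1 / (\<gamma>2 - 1) + 18 * \<bar>K\<bar>"
  have T: "T \<ge> 40" "T \<ge> 1 / (1 - \<gamma>1)" "T \<ge> 1 / (\<gamma>2 - 1)" "T \<ge> 18 * \<bar>K\<bar>"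
    using assms(1-3) by (auto simp: T_def add_nonneg_nonneg)
  have C\<gamma>: "100 * C * \<gamma>2 > 0" using assms by simp
  show ?thesis
  proof (rule exI[of _ "1 / T"], rule conjI, goal_cases)
    case 1
    then show ?case using T(1) by simp
  next
    case 2
    show ?case
    proof (rule exI[of _ 1], rule conjI, goal_cases)
      case 2
      show ?case
      \<comment> \<open>As rho / mu \<le> C^2, the shear wave number is at most C \<omega>, and this
        threshold makes its product with \<gamma>2 at most 1/100.\<close>
      proof (rule exI[of _ "1 / (100 * C * \<gamma>2)"], rule conjI, goal_cases)
        case 1
        then show ?case using C\<gamma> by simp
      next
        case 2
        show ?case
        proof (intro allI impI, goal_cases)
          case (1 lam mu rho \<delta> \<epsilon> \<omega> n f ui u us)
          then have pos: "0 < mu" "0 < rho" "0 < \<omega>" "0 < \<delta>" "0 < \<epsilon>" and muC: "1 / C \<le> mu" and rhoC: "rho \<le> C"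
            and \<delta>T: "\<delta> < 1 / T" and \<omega>C: "\<omega> < 1 / (100 * C * \<gamma>2)" and \<delta>\<epsilon>: "sqrt (\<delta> / \<epsilon>) < 1"
            and n\<delta>: "1 / \<delta>\<^sup>2 \<le> real n" and f: "f \<noteq> 0"
            and uif: "ui = (\<lambda>x. (f * of_real (sph_bessel_j n (k_s mu rho \<omega> * norm x))) *s vsh_T n (int n) x)"
            and es: "elastic_scattering (ball 0 1) (\<lambda>x. x /\<^sub>R norm x)
                lam mu rho (lam / \<delta>) (mu / \<delta>) (rho / \<epsilon>) \<omega> ui u us" by auto
          have T0: "T > 0" using T(1) by simp
          have T\<delta>: "T \<le> 1 / \<delta>" using \<delta>T pos(4) T0 by (simp add: field_simps)
          \<comment> \<open>The only use of n \<ge> 1/\<delta>^2: it makes n \<delta> at least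
            1/\<delta>, which is at least T.\<close>
          have "1 / \<delta> \<le> (1 / \<delta>) * (real n * \<delta>\<^sup>2)"
            using n\<delta> pos(4) by (simp add: field_simps)
          also have "\<dots> = real n * \<delta>" using pos(4) by (simp add: power2_eq_square)
          finally have nd: "T \<le> real n * \<delta>" using T\<delta> by simp
          have \<delta>40: "\<delta> \<le> 1/40"
          proof -
            have "1 / T \<le> 1 / 40" using T(1) by (intro divide_left_mono) auto
            then show ?thesis using \<delta>T by simp
          qed
          have nT: "T \<le> real n"
          proof -
            have "real n * \<delta> \<le> real n * 1" using \<delta>40 by (intro mult_left_mono) auto
            then show ?thesis using nd by simp
          qed
          have n100: "n \<ge> 100"
          proof -
            have "40 \<le> real n * \<delta>" using nd T(1) by simp
            also have "\<dots> \<le> real n * (1/40)" using \<delta>40 by (intro mult_left_mono) auto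
            finally show ?thesis by simp
          qed
          have h1: "\<gamma>1 ^ (2*n+1) \<le> 1/2"
          proof -
            \<comment> \<open>Prepares \<open>half_power\<close> for the base 1/\<gamma>1, whose
              excess over 1 is at least 1 - \<gamma>1.\<close>
            have "1 / (1 - \<gamma>1) * (1 - \<gamma>1) \<le> real (2*n+1) * (1 / \<gamma>1 - 1)"
            proof (rule mult_mono)
              show "1 / (1 - \<gamma>1) \<le> real (2*n+1)" using T(2) nT by simp
              have "(1 - \<gamma>1) * \<gamma>1 \<le> 1 - \<gamma>1" using assms(1,2) by (intro mult_left_le) auto
              then show "1 - \<gamma>1 \<le> 1 / \<gamma>1 - 1" using assms(1) by (simp add: field_simps)
            qed (use assms(2) in auto)
            then have "1 \<le> real (2*n+1) * (1 / \<gamma>1 - 1)" using assms(2) by simp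
            from half_power[OF _ this] show ?thesis using assms(1,2) by simp
          qed
          have h2: "(1/\<gamma>2) ^ (2*n+1) \<le> 1/2"
          proof -
            have "1 / (\<gamma>2 - 1) * (\<gamma>2 - 1) \<le> real (2*n+1) * (\<gamma>2 - 1)"
              using T(3) nT assms(3) by (intro mult_right_mono) auto
            then have "1 \<le> real (2*n+1) * (\<gamma>2 - 1)" using assms(3) by simp
            from half_power[OF assms(3) this] show ?thesis .
          qed
          have kC: "k_s mu rho \<omega> * \<gamma>2 \<le> 1/100"
          proof -
            have "1 \<le> C * mu" using muC assms(5) by (simp add: field_simps)
            then have "rho * 1 \<le> C * (C * mu)" using rhoC assms(5) by (intro mult_mono) auto
            then have "rho / mu \<le> C^2" using pos(1) by (simp add: power2_eq_square field_simps)
            then have "sqrt (rho / mu) \<le> C" using assms(5) by (simp add: real_le_lsqrt)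
            then have "\<omega> * sqrt (rho / mu) \<le> (1 / (100 * C * \<gamma>2)) * C"
              using \<omega>C pos assms(3,5) by (intro mult_mono) (auto intro!: mult_nonneg_nonneg)
            then have "k_s mu rho \<omega> * \<gamma>2 \<le> (1 / (100 * C * \<gamma>2)) * C * \<gamma>2"
              unfolding k_s_def using assms(3) by (intro mult_right_mono) auto
            then show ?thesis using assms(3,5) by simp
          qed
          have \<delta>\<epsilon>1: "\<delta> / \<epsilon> \<le> 1" using \<delta>\<epsilon> by simp
          note rb = resonance_bounds[OF assms(1,2) h1 assms(3,4) h2 n100 pos(4) \<delta>40 pos(5) \<delta>\<epsilon>1 pos(1,2,3) kC f uif es]
          have sp: "sqrt pi \<le> 2" "sqrt pi > 0" using pi_less_4 by (auto intro!: real_le_lsqrt)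
          have K1: "K \<le> real n * \<delta> / (4 * sqrt pi)"
          proof -
            have "\<bar>K\<bar> * (4 * sqrt pi) \<le> \<bar>K\<bar> * 8" using sp by (intro mult_left_mono) auto
            then have "K * (4 * sqrt pi) \<le> real n * \<delta>"
              using T(4) nd sp mult_right_mono[of K "\<bar>K\<bar>" "4 * sqrt pi"] by linarith
            then show ?thesis using sp by (simp add: pos_le_divide_eq)
          qed
          have K2: "K \<le> real n / (9 * sqrt pi)"
          proof -
            have "\<bar>K\<bar> * (9 * sqrt pi) \<le> \<bar>K\<bar> * 18" using sp by (intro mult_left_mono) auto
            then have "K * (9 * sqrt pi) \<le> real n"
              using T(4) nT sp mult_right_mono[of K "\<bar>K\<bar>" "9 * sqrt pi"] by linarith
            then show ?thesis using sp by (simp add: pos_le_divide_eq)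
          qed
          show ?case
            unfolding surface_resonance_def using rb K1 K2 by (auto intro: order_trans)
        qed
      qed
    qed simp
  qed
qed

end
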